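(* Let $(\mathcal S,\mathcal B)$ be a measurable space, $n\ge2$, and let $\{X_i^{(1)}\}_{i=1}^n$ and $\{X_i^{(2)}\}_{i=1}^n$ be independent copies of a sequence $X_1,\dots,X_n$ of i.i.d. $\mathcal S$-valued random variables. For each $(i_1,i_2)\in I_n^2$ let $H_{i_1,i_2}:\mathcal S\times\mathcal S\to\mathbb H^d$ be measurable kernels which are permutation-symmetric ($H_{i_1,i_2}(x_1,x_2)=H_{i_2,i_1}(x_2,x_1)$ for all $x_1,x_2$ and $i_1\neq i_2$) and degenerate ($\mathbb E H_{i_1,i_2}(x,X_1)=0$ for all $x\in\mathcal S$). Let $U_n=\sum_{(i_1,i_2)\in I_n^2}H_{i_1,i_2}(X_{i_1},X_{i_2})$. Let $\widetilde G\in\mathbb H^{nd}$ be the random block matrix whose $(i,j)$-th $d\times d$ block is $H_{i,j}(X_i^{(1)},X_j^{(2)})$ for $i\ne j$ and $0$ for $i=j$. Then for all $q\ge1$ and $r=\max(q,\log(ed))$, \begin{align*} \big(\mathbb E\|U_n\|^{2q}\big)^{1/2q} &\le 4\Big(\mathbb E\Big\|\sum_{(i_1,i_2)\in I_n^2}H_{i_1,i_2}\big(X^{(1)}_{i_1},X^{(2)}_{i_2}\big)\Big\|^{2q}\Big)^{1/2q}\\ &\le \frac{128}{\sqrt e}\Bigg[16\,r^{3/2}\Big(\mathbb E\max_{i_1}\Big\|\sum_{i_2:i_2\ne i_1}H^2_{i_1,i_2}\big(X^{(1)}_{i_1},X^{(2)}_{i_2}\big)\Big\|^q\Big)^{1/(2q)}\\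 &\qquad + r\Big\|\sum_{(i_1,i_2)\in I_n^2}\mathbb E H^2_{i_1,i_2}\big(X^{(1)}_{i_1},X^{(2)}_{i_2}\big)\Big\|^{1/2} + r\Big(\mathbb E\big\|\mathbb E_2\widetilde G\widetilde G^\ast\big\|^q\Big)^{1/2q}\Bigg]. \end{align*}
   Context: $\mathbb H^d$ denotes the set of $d\times d$ complex Hermitian matrices; $\|\cdot\|$ is the spectral norm; $A^\ast$ is the conjugate transpose. $I_n^2=\{(i_1,i_2):1\le i_1,i_2\le n,\ i_1\ne i_2\}$. $\mathbb E_2[\cdot]$ denotes expectation with respect to $\{X_i^{(2)}\}_{i=1}^n$ only, i.e. conditionally on all other random variables. *)

theory Defs
  imports "HOL-Probability.Probability"
begin

definition hermitian_mat :: "complex^'n^'n \<Rightarrow> bool" where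
  "hermitian_mat A \<longleftrightarrow> (\<forall>k l. A $ k $ l = cnj (A $ l $ k))"

definition adj_mat :: "complex^'n^'m \<Rightarrow> complex^'m^'n" where
  "adj_mat A = (\<chi> i j. cnj (A $ j $ i))"

definition spec_norm :: "complex^'n^'m \<Rightarrow> real" where
  "spec_norm A = onorm (\<lambda>x. A *v x)"

text \<open>Real powers of extended nonnegative reals (p > 0 intended): \<infinity> ^ p = \<infinity>.\<close>
definition epowr :: "ennreal \<Rightarrow> real \<Rightarrow> ennreal" where
  "epowr x p = (if x = \<infinity> then \<infinity> else ennreal (enn2real x powr p))"

definition moment :: "'a measure \<Rightarrow> ('a \<Rightarrow> real) \<Rightarrow> real \<Rightarrow> ennreal" where
  "moment M f p = epowr (\<integral>\<^sup>+ \<omega>. ennreal (f \<omega> powr p) \<partial>M) (1 / p)"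

definition iid :: "'a measure \<Rightarrow> 's measure \<Rightarrow> ('i \<Rightarrow> 'a \<Rightarrow> 's) \<Rightarrow> 'i set \<Rightarrow> bool" where
  "iid M S X I \<longleftrightarrow> prob_space.indep_vars M (\<lambda>_. S) X I \<and>
     (\<forall>i\<in>I. \<forall>j\<in>I. distr M S (X i) = distr M S (X j))"

definition offdiag :: "('i \<times> 'i) set" where
  "offdiag = {(i, j). i \<noteq> j}"

definition block_G :: "('i::finite \<Rightarrow> 'i \<Rightarrow> 's \<Rightarrow> 's \<Rightarrow> complex^'d::finite^'d) \<Rightarrow> ('i \<Rightarrow> 's) \<Rightarrow> ('i \<Rightarrow> 's)
     \<Rightarrow> complex^('i \<times> 'd)^('i \<times> 'd)" where
  "block_G H x y = (\<chi> a b. if fst a = fst b then 0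
                           else H (fst a) (fst b) (x (fst a)) (y (fst b)) $ snd a $ snd b)"

text \<open>E_2 [G~ G~^*] at \<omega>: integrate over X^(2) only, keeping X^(1) fixed at X1 \<omega>
  (X^(2) is independent of X^(1)). Valued in [0,\<infinity>] after taking the spectral norm;
  set to \<infinity> when the conditional expectation does not exist (non-integrable).\<close>
definition E2_norm :: "'a measure \<Rightarrow> ('i::finite \<Rightarrow> 'i \<Rightarrow> 's \<Rightarrow> 's \<Rightarrow> complex^'d::finite^'d)
     \<Rightarrow> ('i \<Rightarrow> 'a \<Rightarrow> 's) \<Rightarrow> ('i \<Rightarrow> 'a \<Rightarrow> 's) \<Rightarrow> 'a \<Rightarrow> ennreal" where
  "E2_norm M H X1 X2 \<omega> =
     (let F = (\<lambda>\<omega>'. block_G H (\<lambda>i. X1 i \<omega>) (\<lambda>j. X2 j \<omega>') **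
                     adj_mat (block_G H (\<lambda>i. X1 i \<omega>) (\<lambda>j. X2 j \<omega>')))
      in if integrable M F then ennreal (spec_norm (integral\<^sup>L M F)) else \<infinity>)"

end

theory Submission
  imports Defs
begin

text \<open>
  All probabilistic steps reduce to one Jensen argument: averaging out some coordinates of a sum of
  independent matrices does not increase the moments of its spectral norm. Writing
  \<open>\<Sum>\<^sub>i\<^sub>\<noteq>\<^sub>j H\<^sub>i\<^sub>j\<close> as four times the mean of its restrictions to \<open>J \<times> -J\<close> over all index sets \<open>J\<close>
  gives decoupling with the constant 4; splitting a centred sum by a sign vector gives symmetrization
  with the factor 2 for every single choice of signs.

  The decoupled sum is symmetrized in both sets of variables. The resulting Rademacher chaos is
  bounded by applying the matrix Khintchine inequality twice, the second time to the Hermitian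
  dilations \<open>D\<^sub>j\<close> of the block rows \<open>(H\<^sub>i\<^sub>j)\<^sub>i\<close>. This produces \<open>T = \<Sum>\<^sub>j D\<^sub>j\<^sup>2\<close>, which is block diagonal
  with blocks \<open>\<Sum>\<^sub>i\<^sub>j H\<^sub>i\<^sub>j\<^sup>2\<close> and \<open>G G\<^sup>*\<close>. Since \<open>tr T = 2 tr \<Sum>\<^sub>i\<^sub>j H\<^sub>i\<^sub>j\<^sup>2 \<le> 2 d \<parallel>T\<parallel>\<close>, only the dimension \<open>d\<close>, and
  not \<open>nd\<close>, enters the constants.

  For a sum \<open>T\<close> of independent positive semidefinite matrices, symmetrization and Khintchine yield a
  quadratic inequality for \<open>(E\<parallel>T\<parallel>\<^sup>q)\<^sup>1\<^sup>/\<^sup>2\<^sup>q\<close>, whose solution bounds it by \<open>\<surd>2 \<parallel>E T\<parallel>\<^sup>1\<^sup>/\<^sup>2\<close> plus a multiple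
  of \<open>\<surd>r\<close> times the maximal summand. This is applied to \<open>T\<close> given \<open>X\<^sup>(\<^sup>1\<^sup>)\<close>, and then to
  \<open>E\<^sub>2 \<Sum>\<^sub>i\<^sub>j H\<^sub>i\<^sub>j\<^sup>2\<close>, which is again a sum of independent positive semidefinite matrices.
\<close>

subsection \<open>The real inner product and the spectral norm\<close>

text \<open>No random signs are introduced. Symmetrization holds for each fixed sign vector, so
  Khintchine, a bound on the plain sum over all sign vectors, only has to supply one vector whose
  integral is at most the average. Powers are handled in the Frobenius inner product, without
  eigenvalues or Schatten norms; the price is a trace factor, tracked as a ratio \<open>t\<close> of
  trace to norm rather than as a matrix size.

  The constants leave little room. Decoupling costs 4, the two symmetrizations cost 4, and the two
  uses of the bound for positive semidefinite sums put sqrt 2 * sqrt 2 = 2 in front of the mean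
  term. Hence the chaos bound may carry at most 128 / (32 sqrt e) = 4 / sqrt e, about 2.426, in
  front of \<open>r\<close>. The value 12/5 just fits, although it also has to absorb the factor
  sqrt 2 * d per Khintchine step. This is why the double factorial is estimated so carefully at the
  order ceiling of r.\<close>

lemma inner_cnj_mult: "(a * x) \<bullet> y = x \<bullet> (cnj a * y)" for a x y :: complex
  by (simp add: inner_complex_def algebra_simps)

text \<open>On complex matrices \<open>\<bullet>\<close> is the real part of the trace of A^H B,
  where A^H is the adjoint. All trace manipulations below take place in this real inner
  product.\<close>

lemma inner_matrix_mult_left:
  fixes A :: "complex^'n^'m" and B :: "complex^'k^'n" and C :: "complex^'k^'m"
  shows "(A ** B) \<bullet> C = B \<bullet> (adj_mat A ** C)"
proof -
  have "(A ** B) \<bullet> C = (\<Sum>i\<in>UNIV. \<Sum>k\<in>UNIV. \<Sum>j\<in>UNIV. (A$i$j * B$j$k) \<bullet> C$i$k)"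
    by (simp add: inner_vec_def matrix_matrix_mult_def inner_sum_left)
  also have "\<dots> = (\<Sum>i\<in>UNIV. \<Sum>j\<in>UNIV. \<Sum>k\<in>UNIV. (A$i$j * B$j$k) \<bullet> C$i$k)"
    by (intro sum.cong refl sum.swap)
  also have "\<dots> = (\<Sum>j\<in>UNIV. \<Sum>i\<in>UNIV. \<Sum>k\<in>UNIV. (A$i$j * B$j$k) \<bullet> C$i$k)"
    by (rule sum.swap)
  also have "\<dots> = (\<Sum>j\<in>UNIV. \<Sum>k\<in>UNIV. \<Sum>i\<in>UNIV. (A$i$j * B$j$k) \<bullet> C$i$k)"
    by (intro sum.cong refl sum.swap)
  also have "\<dots> = B \<bullet> (adj_mat A ** C)"
    by (simp add: inner_vec_def matrix_matrix_mult_def inner_sum_right adj_mat_def inner_cnj_mult)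
  finally show ?thesis .
qed

lemma inner_matrix_mult_right:
  fixes A :: "complex^'k^'n" and B :: "complex^'n^'m" and C :: "complex^'k^'m"
  shows "(B ** A) \<bullet> C = B \<bullet> (C ** adj_mat A)"
proof -
  have "(B ** A) \<bullet> C = (\<Sum>i\<in>UNIV. \<Sum>k\<in>UNIV. \<Sum>j\<in>UNIV. (A$j$k * B$i$j) \<bullet> C$i$k)"
    by (simp add: inner_vec_def matrix_matrix_mult_def inner_sum_left mult.commute)
  also have "\<dots> = (\<Sum>i\<in>UNIV. \<Sum>j\<in>UNIV. \<Sum>k\<in>UNIV. (A$j$k * B$i$j) \<bullet> C$i$k)"
    by (intro sum.cong refl sum.swap)
  also have "\<dots> = B \<bullet> (C ** adj_mat A)"
    by (simp add: inner_vec_def matrix_matrix_mult_def inner_sum_right adj_mat_def inner_cnj_mult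
        mult.commute)
  finally show ?thesis .
qed

lemma inner_matrix_vector_mult:
  fixes A :: "complex^'n^'m"
  shows "(A *v u) \<bullet> v = u \<bullet> (adj_mat A *v v)"
proof -
  have "(A *v u) \<bullet> v = (\<Sum>i\<in>UNIV. \<Sum>j\<in>UNIV. (A$i$j * u$j) \<bullet> v$i)"
    by (simp add: inner_vec_def matrix_vector_mult_def inner_sum_left)
  also have "\<dots> = (\<Sum>j\<in>UNIV. \<Sum>i\<in>UNIV. (A$i$j * u$j) \<bullet> v$i)"
    by (rule sum.swap)
  also have "\<dots> = u \<bullet> (adj_mat A *v v)"
    by (simp add: inner_vec_def matrix_vector_mult_def inner_sum_right adj_mat_def inner_cnj_mult)
  finally show ?thesis .
qed

lemma hermitian_iff_adj: "hermitian_mat A \<longleftrightarrow> adj_mat A = A"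
  unfolding hermitian_mat_def adj_mat_def vec_eq_iff vec_lambda_beta by metis

lemma inner_hermitian: "hermitian_mat A \<Longrightarrow> (A *v u) \<bullet> v = u \<bullet> (A *v v)"
  by (simp add: inner_matrix_vector_mult hermitian_iff_adj)

lemma adj_mat_adj [simp]: "adj_mat (adj_mat A) = A"
  by (simp add: adj_mat_def vec_eq_iff)

lemma adj_mat_mult: "adj_mat (A ** B) = adj_mat B ** adj_mat A"
  by (simp add: adj_mat_def vec_eq_iff matrix_matrix_mult_def mult.commute)

lemma norm_adj_mat: "norm (adj_mat A) = norm A"
proof -
  have "adj_mat A \<bullet> adj_mat A = A \<bullet> A"
    unfolding inner_vec_def adj_mat_def by (simp add: inner_complex_def) (rule sum.swap)
  then show ?thesis by (simp add: norm_eq_sqrt_inner)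
qed

lemma bounded_bilinear_matrix_mult:
  "bounded_bilinear ((**) :: complex^'n^'m \<Rightarrow> complex^'k^'n \<Rightarrow> complex^'k^'m)"
proof -
  have "bilinear ((**) :: complex^'n^'m \<Rightarrow> complex^'k^'n \<Rightarrow> complex^'k^'m)"
    unfolding bilinear_def
    by (auto intro!: linearI simp: matrix_matrix_mult_def vec_eq_iff algebra_simps sum.distrib
        scaleR_right.sum)
  then show ?thesis by (simp add: bilinear_conv_bounded_bilinear)
qed

interpretation matrix_mult: bounded_bilinear
  "(**) :: complex^'n^'m \<Rightarrow> complex^'k^'n \<Rightarrow> complex^'k^'m"
  by (rule bounded_bilinear_matrix_mult)

lemma bounded_bilinear_matrix_vector_mult:
  "bounded_bilinear ((*v) :: complex^'n^'m \<Rightarrow> complex^'n \<Rightarrow> complex^'m)"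
proof -
  have "bilinear ((*v) :: complex^'n^'m \<Rightarrow> complex^'n \<Rightarrow> complex^'m)"
    unfolding bilinear_def
    by (auto intro!: linearI simp: matrix_vector_mult_def vec_eq_iff algebra_simps sum.distrib
        scaleR_right.sum)
  then show ?thesis by (simp add: bilinear_conv_bounded_bilinear)
qed

interpretation matrix_vector_mult: bounded_bilinear
  "(*v) :: complex^'n^'m \<Rightarrow> complex^'n \<Rightarrow> complex^'m"
  by (rule bounded_bilinear_matrix_vector_mult)

lemma bounded_linear_adj_mat: "bounded_linear (adj_mat :: complex^'n^'m \<Rightarrow> complex^'m^'n)"
proof -
  have "linear (adj_mat :: complex^'n^'m \<Rightarrow> complex^'m^'n)"
    by (auto intro!: linearI simp: adj_mat_def vec_eq_iff)
  then show ?thesis by (simp add: linear_conv_bounded_linear)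
qed

lemma hermitian_add: "hermitian_mat A \<Longrightarrow> hermitian_mat B \<Longrightarrow> hermitian_mat (A + B)"
  and hermitian_scaleR: "hermitian_mat A \<Longrightarrow> hermitian_mat (c *\<^sub>R A)"
  and hermitian_zero: "hermitian_mat 0"
  unfolding hermitian_iff_adj by (simp_all add: adj_mat_def vec_eq_iff)

lemma hermitian_sum: "(\<And>i. i \<in> I \<Longrightarrow> hermitian_mat (A i)) \<Longrightarrow> hermitian_mat (\<Sum>i\<in>I. A i)"
  by (induction I rule: infinite_finite_induct) (auto intro: hermitian_add hermitian_zero)

lemma hermitian_square: "hermitian_mat A \<Longrightarrow> hermitian_mat (A ** A)"
  by (simp add: hermitian_iff_adj adj_mat_mult)

section \<open>The spectral norm and its comparison with the Frobenius norm\<close>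

lemma spec_norm_mult_vec: "norm (A *v v) \<le> spec_norm A * norm v" for A :: "complex^'n^'m"
  unfolding spec_norm_def by (rule onorm) simp

lemma spec_norm_nonneg [simp]: "0 \<le> spec_norm A" for A :: "complex^'n^'m"
  unfolding spec_norm_def by (rule onorm_pos_le) simp

lemma spec_norm_le: "(\<And>v. norm (A *v v) \<le> c * norm v) \<Longrightarrow> spec_norm A \<le> c"
  for A :: "complex^'n^'m"
  unfolding spec_norm_def by (rule onorm_le)

lemma spec_norm_add: "spec_norm (A + B) \<le> spec_norm A + spec_norm B" for A B :: "complex^'n^'m"
  by (rule spec_norm_le) (metis add_mono distrib_right matrix_vector_mult_add_rdistrib
      norm_triangle_le spec_norm_mult_vec)

lemma spec_norm_zero [simp]: "spec_norm (0 :: complex^'n^'m) = 0"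
  by (rule antisym) (auto intro: spec_norm_le)

lemma spec_norm_minus [simp]: "spec_norm (- A) = spec_norm A" for A :: "complex^'n^'m"
  unfolding spec_norm_def by (subst onorm_neg[symmetric]) (simp add: matrix_vector_mult.minus_left)

lemma spec_norm_scaleR: "spec_norm (c *\<^sub>R A) = \<bar>c\<bar> * spec_norm A" for A :: "complex^'n^'m"
proof -
  have "(*v) (c *\<^sub>R A) = (\<lambda>x. c *\<^sub>R (A *v x))"
    by (simp add: fun_eq_iff matrix_vector_mult.scaleR_left)
  then show ?thesis
    by (simp add: spec_norm_def onorm_scaleR)
qed

lemma spec_norm_sum: "spec_norm (\<Sum>i\<in>I. A i) \<le> (\<Sum>i\<in>I. spec_norm (A i))"
  for A :: "'i \<Rightarrow> complex^'n^'m"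
  by (induction I rule: infinite_finite_induct) (auto intro: order_trans[OF spec_norm_add])

lemma norm_eq_sum_columns:
  "(norm A)\<^sup>2 = (\<Sum>k\<in>UNIV. (norm (column k A))\<^sup>2)" for A :: "complex^'n^'m"
  unfolding power2_norm_eq_inner inner_vec_def column_def by simp (rule sum.swap)

text \<open>\<open>norm\<close> of a matrix is the Frobenius norm, which splits over columns, and
  \<open>A\<close> acts on each column of \<open>B\<close> separately.\<close>

lemma norm_matrix_mult_le: "norm (A ** B) \<le> spec_norm A * norm B"
  for A :: "complex^'n^'m" and B :: "complex^'k^'n"
proof (rule power2_le_imp_le)
  have "column k (A ** B) = A *v column k B" for k
    by (simp add: column_def matrix_matrix_mult_def matrix_vector_mult_def vec_eq_iff)
  then have "(norm (A ** B))\<^sup>2 = (\<Sum>k\<in>UNIV. (norm (A *v column k B))\<^sup>2)"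
    by (simp add: norm_eq_sum_columns)
  also have "\<dots> \<le> (\<Sum>k\<in>UNIV. (spec_norm A * norm (column k B))\<^sup>2)"
    by (intro sum_mono power_mono spec_norm_mult_vec) auto
  also have "\<dots> = (spec_norm A * norm B)\<^sup>2"
    by (simp add: norm_eq_sum_columns power_mult_distrib sum_distrib_left)
  finally show "(norm (A ** B))\<^sup>2 \<le> (spec_norm A * norm B)\<^sup>2" .
qed simp

lemma norm_matrix_vector_le: "norm (A *v v) \<le> norm A * norm v" for A :: "complex^'n^'m"
proof (rule power2_le_imp_le)
  have "(norm (A *v v))\<^sup>2 = (\<Sum>i\<in>UNIV. (cmod (\<Sum>j\<in>UNIV. A$i$j * v$j))\<^sup>2)"
    by (simp add: norm_vec_def L2_set_def matrix_vector_mult_def sum_nonneg)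
  also have "\<dots> \<le> (\<Sum>i\<in>UNIV. (norm (A$i) * norm v)\<^sup>2)"
  proof (intro sum_mono power_mono)
    fix i
    have "cmod (\<Sum>j\<in>UNIV. A$i$j * v$j) \<le> (\<Sum>j\<in>UNIV. \<bar>cmod (A$i$j)\<bar> * \<bar>cmod (v$j)\<bar>)"
      by (rule order_trans[OF norm_sum]) (simp add: norm_mult)
    also have "\<dots> \<le> norm (A$i) * norm v"
      unfolding norm_vec_def by (rule L2_set_mult_ineq)
    finally show "cmod (\<Sum>j\<in>UNIV. A$i$j * v$j) \<le> norm (A$i) * norm v" .
  qed auto
  also have "\<dots> = (norm A * norm v)\<^sup>2"
    by (simp add: power_mult_distrib norm_vec_def[of A] L2_set_def sum_nonneg sum_distrib_right)
  finally show "(norm (A *v v))\<^sup>2 \<le> (norm A * norm v)\<^sup>2" .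
qed simp

lemma spec_norm_le_norm: "spec_norm A \<le> norm A" for A :: "complex^'n^'m"
  by (rule spec_norm_le) (rule norm_matrix_vector_le)

text \<open>By the triangle inequality the spectral norm is 1-Lipschitz for the Frobenius distance;
  this makes it Borel measurable.\<close>

lemma continuous_on_spec_norm: "continuous_on UNIV (spec_norm :: complex^'n^'m \<Rightarrow> real)"
proof (rule continuous_onI)
  fix A :: "complex^'n^'m" and e :: real assume "e > 0"
  have "dist (spec_norm B) (spec_norm A) \<le> dist B A" for B
    using spec_norm_add[of "B - A" A] spec_norm_add[of "A - B" B] spec_norm_minus[of "A - B"]
      spec_norm_le_norm[of "B - A"]
    by (simp add: dist_real_def dist_norm)
  then show "\<exists>d>0. \<forall>x'\<in>UNIV. dist x' A < d \<longrightarrow> dist (spec_norm x') (spec_norm A) \<le> e"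
    using \<open>e > 0\<close> by (intro exI[of _ e]) (meson less_imp_le order.trans)
qed

lemma measurable_spec_norm [measurable]:
  "(spec_norm :: complex^'n^'m \<Rightarrow> real) \<in> borel_measurable borel"
  by (rule borel_measurable_continuous_onI[OF continuous_on_spec_norm])

subsection \<open>Powers of Hermitian matrices\<close>

primrec mpow :: "complex^'n^'n \<Rightarrow> nat \<Rightarrow> complex^'n^'n" where
  "mpow A 0 = mat 1"
| "mpow A (Suc k) = A ** mpow A k"

lemma mpow_add: "mpow A (j + k) = mpow A j ** mpow A k"
  by (induction j) (simp_all add: matrix_mul_assoc)

lemma mpow_Suc_right: "mpow A (Suc k) = mpow A k ** A"
  using mpow_add[of A k 1] by simp

lemma hermitian_mpow: "hermitian_mat A \<Longrightarrow> hermitian_mat (mpow A k)"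
proof (induction k)
  case 0
  then show ?case by (simp add: hermitian_mat_def mat_def)
next
  case (Suc k)
  then show ?case by (metis adj_mat_mult hermitian_iff_adj mpow.simps(2) mpow_Suc_right)
qed

lemma mpow_diff:
  "mpow P (Suc m) - mpow Q (Suc m) = (\<Sum>k\<le>m. mpow P k ** (P - Q) ** mpow Q (m - k))"
proof (induction m)
  case (Suc m)
  have "mpow P (Suc (Suc m)) - mpow Q (Suc (Suc m))
     = P ** (mpow P (Suc m) - mpow Q (Suc m)) + (P - Q) ** mpow Q (Suc m)"
    by (simp only: mpow.simps matrix_mult.diff_left matrix_mult.diff_right) simp
  also have "P ** (mpow P (Suc m) - mpow Q (Suc m))
     = (\<Sum>k\<le>m. mpow P (Suc k) ** (P - Q) ** mpow Q (Suc m - Suc k))"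
    unfolding Suc matrix_mult.sum_right by (simp add: matrix_mul_assoc)
  finally show ?case
    by (subst sum.atMost_Suc_shift) (simp add: add.commute)
qed simp

text \<open>Moving one factor \<open>X\<close> across the inner product and applying Cauchy-Schwarz
  shows that a j = norm (X^j v) is log-convex, so the quotients of consecutive terms do not
  decrease. Bounding the first quotient by each of the first k + 1 quotients and multiplying gives
  the claim.\<close>

lemma norm_mult_vec_power_le:
  assumes "hermitian_mat X"
  shows "norm (X *v v) ^ Suc k \<le> norm (mpow X (Suc k) *v v) * norm v ^ k"
proof (cases "v = 0")
  case False
  define a where "a j = norm (mpow X j *v v)" for j
  have a0: "a 0 = norm v" by (simp add: a_def)
  have cs: "(a (Suc j))\<^sup>2 \<le> a j * a (Suc (Suc j))" for j
  proof -
    have "(a (Suc j))\<^sup>2 = (X *v (mpow X j *v v)) \<bullet> (mpow X (Suc j) *v v)"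
      by (simp add: a_def power2_norm_eq_inner matrix_vector_mul_assoc)
    also have "\<dots> = (mpow X j *v v) \<bullet> (mpow X (Suc (Suc j)) *v v)"
      by (subst inner_hermitian[OF assms]) (simp add: matrix_vector_mul_assoc)
    also have "\<dots> \<le> a j * a (Suc (Suc j))"
      unfolding a_def by (rule norm_cauchy_schwarz)
    finally show ?thesis .
  qed
  have nn: "0 \<le> a j" for j by (simp add: a_def)
  \<comment> \<open>Monotonicity of the quotients in cross-multiplied form, which stays meaningful
    when some term vanishes.\<close>
  have ratio: "a 1 * a j \<le> a (Suc j) * a 0" for j
  proof (induction j)
    case (Suc j)
    show ?case
    proof (cases "a (Suc j) = 0")
      case True
      then show ?thesis using nn by simp
    next
      case False
      then have pos: "a (Suc j) > 0" using nn[of "Suc j"] by simp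
      have "a j > 0" using cs[of j] pos nn[of j] by (metis less_le mult_zero_left not_le power2_less_eq_zero_iff zero_less_power)
      have "a 1 * (a (Suc j))\<^sup>2 \<le> a 1 * (a j * a (Suc (Suc j)))"
        by (intro mult_left_mono cs nn)
      also have "\<dots> = (a 1 * a j) * a (Suc (Suc j))" by simp
      also have "\<dots> \<le> (a (Suc j) * a 0) * a (Suc (Suc j))"
        by (intro mult_right_mono Suc nn)
      finally have "a (Suc j) * (a 1 * a (Suc j)) \<le> a (Suc j) * (a (Suc (Suc j)) * a 0)"
        by (simp add: power2_eq_square algebra_simps)
      then show ?thesis using pos by simp
    qed
  qed simp
  have "a 1 ^ Suc k \<le> a (Suc k) * a 0 ^ k"
  proof (induction k)
    case (Suc k)
    have "a 1 ^ Suc (Suc k) \<le> a 1 * (a (Suc k) * a 0 ^ k)"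
      using mult_left_mono[OF Suc nn[of 1]] by simp
    also have "\<dots> = (a 1 * a (Suc k)) * a 0 ^ k" by simp
    also have "\<dots> \<le> (a (Suc (Suc k)) * a 0) * a 0 ^ k"
      by (intro mult_right_mono ratio) (simp add: nn)
    finally show ?case by (simp add: algebra_simps)
  qed simp
  then show ?thesis by (simp add: a_def)
qed simp

text \<open>The square of the right-hand side is the trace of X^(2p), so this is the usual control
  of the norm by an even trace moment.\<close>

lemma spec_norm_power_le:
  assumes "hermitian_mat X" "p \<ge> 1"
  shows "spec_norm X ^ p \<le> norm (mpow X p)"
proof -
  obtain k where p: "p = Suc k" using assms(2) by (cases p) auto
  define c where "c = root p (norm (mpow X p))"
  have c0: "0 \<le> c" and cp: "c ^ p = norm (mpow X p)"
    unfolding c_def using p by (simp, intro real_root_pow_pos2) auto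
  have "spec_norm X \<le> c"
  proof (rule spec_norm_le)
    fix v
    have "norm (X *v v) ^ p \<le> (norm (mpow X p) * norm v) * norm v ^ k"
      unfolding p by (rule order_trans[OF norm_mult_vec_power_le[OF assms(1)]])
        (intro mult_right_mono norm_matrix_vector_le zero_le_power norm_ge_zero)
    also have "\<dots> = (c * norm v) ^ p"
      by (simp only: power_mult_distrib cp) (simp add: p)
    finally show "norm (X *v v) \<le> c * norm v"
      using power_mono_iff[of "norm (X *v v)" "c * norm v" p] c0 p by simp
  qed
  then show ?thesis using power_mono[of _ c p] cp by simp
qed

subsection \<open>Matrix Khintchine inequality\<close>

text \<open>The increments of a convex sequence do not decrease. Passing from N to N + 1 adds the
  increment at N - l on the left and the larger increment at N on the right.\<close>

lemma convex_seq_ends: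
  fixes g :: "nat \<Rightarrow> real"
  assumes conv: "\<And>l. Suc l < N \<Longrightarrow> 2 * g (Suc l) \<le> g l + g (Suc (Suc l))"
  shows "l \<le> N \<Longrightarrow> g l + g (N - l) \<le> g 0 + g N"
  using conv
proof (induction N arbitrary: l)
  case (Suc N)
  define d where "d k = g (Suc k) - g k" for k
  have d_mono: "d i \<le> d (i + k)" if "i + k \<le> N" for i k
    using that
  proof (induction k)
    case (Suc k)
    have "d (i + k) \<le> d (i + Suc k)"
      using Suc.prems Suc.IH \<open>\<And>l. Suc l < Suc N \<Longrightarrow> 2 * g (Suc l) \<le> g l + g (Suc (Suc l))\<close>[of "i + k"]
      by (simp add: d_def)
    then show ?case using Suc by simp
  qed simp
  show ?case
  proof (cases "l = Suc N")
    case False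
    with Suc.prems have l: "l \<le> N" by simp
    have "g l + g (N - l) \<le> g 0 + g N"
      using Suc.prems(2) by (intro Suc.IH l) simp
    moreover have "d (N - l) \<le> d N"
      using d_mono[of "N - l" l] l by simp
    moreover have "Suc N - l = Suc (N - l)" using l by simp
    ultimately show ?thesis by (simp add: d_def)
  qed simp
qed simp

text \<open>Trapezoid bound: after pairing \<open>l\<close> with \<open>N - l\<close>, the average
  of a convex sequence is at most the mean of its end values.\<close>

lemma sum_convex_seq_le:
  fixes g :: "nat \<Rightarrow> real"
  assumes "\<And>l. Suc l < N \<Longrightarrow> 2 * g (Suc l) \<le> g l + g (Suc (Suc l))"
  shows "2 * (\<Sum>l\<le>N. g l) \<le> real (N + 1) * (g 0 + g N)"
proof -
  have "2 * (\<Sum>l\<le>N. g l) = (\<Sum>l\<le>N. g l + g (N - l))"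
    using sum.reindex_bij_witness[of "{..N}" "\<lambda>l. N - l" "\<lambda>l. N - l" "{..N}" g "\<lambda>l. g (N - l)"]
    by (simp add: sum.distrib)
  also have "\<dots> \<le> (\<Sum>l\<le>N. g 0 + g N)"
    using assms by (intro sum_mono convex_seq_ends) auto
  finally show ?thesis by simp
qed

text \<open>For Hermitian \<open>P\<close> and \<open>Q\<close> the trace of \<open>A P\<^sup>k A Q\<^sup>m\<^sup>-\<^sup>k\<close> only depends on how many
  factors are moved across the inner product, so Cauchy--Schwarz makes it midpoint convex in
  \<open>k\<close> along the even indices. This replaces the spectral theorem.\<close>

lemma sum_trace_mixed_le:
  fixes A P Q :: "complex^'n^'n"
  assumes P: "hermitian_mat P" and Q: "hermitian_mat Q"
  shows "2 * (\<Sum>k\<le>2 * N. A \<bullet> (mpow P k ** A ** mpow Q (2 * N - k)))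
    \<le> real (2 * N + 1) * ((norm (A ** mpow Q N))\<^sup>2 + (norm (mpow P N ** A))\<^sup>2)"
proof -
  \<comment> \<open>The exponents of \<open>P\<close> and \<open>Q\<close> add up to 2 N. Even
    indices give the exact squares \<open>g l\<close>; odd ones are inner products of two
    neighbouring \<open>v l (N - l)\<close>.\<close>
  define f where "f k = A \<bullet> (mpow P k ** A ** mpow Q (2 * N - k))" for k
  define v where "v a b = mpow P a ** A ** mpow Q b" for a b
  define g where "g l = (norm (v l (N - l)))\<^sup>2" for l
  have split: "v a b \<bullet> v c e = A \<bullet> v (a + c) (b + e)" for a b c e
  proof -
    have "v a b \<bullet> v c e = (mpow P a ** A) \<bullet> (v c e ** mpow Q b)"
      using hermitian_mpow[OF Q, of b]
      by (simp add: v_def[of a b] inner_matrix_mult_right hermitian_iff_adj)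
    also have "\<dots> = A \<bullet> (mpow P a ** (v c e ** mpow Q b))"
      using hermitian_mpow[OF P, of a] by (simp add: inner_matrix_mult_left hermitian_iff_adj)
    also have "mpow P a ** (v c e ** mpow Q b) = v (a + c) (b + e)"
      by (simp add: v_def mpow_add[of P] add.commute[of b] mpow_add[of Q] matrix_mul_assoc)
    finally show ?thesis .
  qed
  have f_split: "f (a + c) = v a b \<bullet> v c e" if "a + b + c + e = 2 * N" for a b c e
  proof -
    have "2 * N - (a + c) = b + e" using that by simp
    then show ?thesis by (simp add: split f_def) (simp add: v_def)
  qed
  have amgm: "2 * (x \<bullet> y) \<le> (norm x)\<^sup>2 + (norm y)\<^sup>2" for x y :: "complex^'n^'n"
    using inner_ge_zero[of "x - y"] unfolding power2_norm_eq_inner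
    by (simp add: inner_diff_left inner_diff_right inner_commute)
  have f_even: "f (2 * l) = g l" if "l \<le> N" for l
    using that f_split[of l "N - l" l "N - l"] by (simp add: g_def power2_norm_eq_inner mult_2)
  have f_odd: "2 * f (2 * l + 1) \<le> g l + g (Suc l)" if "l < N" for l
  proof -
    have "f (2 * l + 1) = v l (N - l) \<bullet> v (Suc l) (N - Suc l)"
      using that f_split[of l "N - l" "Suc l" "N - Suc l"] by (simp add: mult_2)
    then show ?thesis unfolding g_def using amgm by simp
  qed
  have g_conv: "2 * g (Suc l) \<le> g l + g (Suc (Suc l))" if "Suc l < N" for l
  proof -
    have "g (Suc l) = f (2 * Suc l)"
      using that f_even[of "Suc l"] by simp
    also have "\<dots> = v l (N - l) \<bullet> v (Suc (Suc l)) (N - Suc (Suc l))"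
      using that f_split[of l "N - l" "Suc (Suc l)" "N - Suc (Suc l)"] by (simp add: mult_2)
    finally show ?thesis using amgm unfolding g_def[of l] g_def[of "Suc (Suc l)"] by simp
  qed
  have split_sum: "(\<Sum>k\<le>2 * N. f k) = (\<Sum>l\<le>N. f (2 * l)) + (\<Sum>l<N. f (2 * l + 1))"
    by (induction N) simp_all
  have even: "2 * (\<Sum>l\<le>N. f (2 * l)) \<le> real (N + 1) * (g 0 + g N)"
    using sum_convex_seq_le[of N g] g_conv f_even by simp
  \<comment> \<open>The N + 1 even terms cost (N + 1) (g 0 + g N). Each odd term is at most the mean
    of its neighbours, and dropping the end values once saves one such unit, leaving N. Together
    this is the factor 2 N + 1.\<close>
  have "2 * (\<Sum>l<N. f (2 * l + 1)) \<le> (\<Sum>l<N. g l + g (Suc l))"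
    using f_odd by (simp only: sum_distrib_left) (intro sum_mono, auto)
  also have "\<dots> = 2 * (\<Sum>l\<le>N. g l) - (g 0 + g N)"
    by (induction N) simp_all
  also have "\<dots> \<le> real (N + 1) * (g 0 + g N) - (g 0 + g N)"
    using sum_convex_seq_le[of N g] g_conv by simp
  finally have "2 * (\<Sum>k\<le>2 * N. f k) \<le> real (2 * N + 1) * (g 0 + g N)"
    using even unfolding split_sum by (simp add: algebra_simps)
  then show ?thesis by (simp add: f_def g_def v_def)
qed

section \<open>Rademacher sums and the flip of a single sign\<close>

definition sgn_of :: "bool \<Rightarrow> real" where
  "sgn_of b = (if b then 1 else - 1)"

lemma sgn_of_simps [simp]: "sgn_of (\<not> b) = - sgn_of b" "sgn_of b * sgn_of b = 1"
    "sgn_of b * (sgn_of b * x) = x"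
  by (simp_all add: sgn_of_def)

text \<open>A Rademacher series at one sign vector; its expectations are plain sums over the finite
  type \<open>'j \<Rightarrow> bool\<close>, normalised by \<open>2 ^ CARD('j)\<close>.\<close>

definition rad_sum :: "('j::finite \<Rightarrow> complex^'n^'m) \<Rightarrow> ('j \<Rightarrow> bool) \<Rightarrow> complex^'n^'m" where
  "rad_sum A e = (\<Sum>j\<in>UNIV. sgn_of (e j) *\<^sub>R A j)"

definition flip :: "'j \<Rightarrow> ('j \<Rightarrow> bool) \<Rightarrow> 'j \<Rightarrow> bool" where
  "flip j e = e(j := \<not> e j)"

lemma flip_flip [simp]: "flip j (flip j e) = e"
  by (simp add: flip_def)

lemma sum_flip: "(\<Sum>e\<in>UNIV. F (flip j e)) = (\<Sum>e\<in>UNIV. F e)"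
  for F :: "('j::finite \<Rightarrow> bool) \<Rightarrow> 'b::comm_monoid_add"
  by (rule sum.reindex_bij_witness[of _ "flip j" "flip j"]) auto

lemma rad_sum_flip: "rad_sum A e - rad_sum A (flip j e) = (2 * sgn_of (e j)) *\<^sub>R A j"
proof -
  have "rad_sum A e - rad_sum A (flip j e)
    = (\<Sum>i\<in>UNIV. if i = j then (2 * sgn_of (e j)) *\<^sub>R A j else 0)"
    unfolding rad_sum_def sum_subtractf[symmetric] flip_def
    by (intro sum.cong) (auto simp: scaleR_2 simp flip: scaleR_scaleR)
  then show ?thesis by simp
qed

lemma hermitian_rad_sum: "(\<And>j. hermitian_mat (A j)) \<Longrightarrow> hermitian_mat (rad_sum A e)"
  unfolding rad_sum_def by (intro hermitian_sum hermitian_scaleR)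

text \<open>\<open>dfact p\<close> is \<open>(2p - 1)!! = 1 \<cdot> 3 \<cdots> (2p - 1)\<close>.\<close>

fun dfact :: "nat \<Rightarrow> real" where
  "dfact 0 = 1"
| "dfact (Suc p) = real (2 * p + 1) * dfact p"

lemma dfact_pos: "dfact p > 0"
  by (induction p) auto

text \<open>Discrete integration by parts. One factor of X^(2N+2) is expanded into its summands, and
  for each \<open>j\<close> the remaining odd power is compared with the one in which the sign of
  \<open>A j\<close> is flipped. The difference telescopes into mixed traces, which
  \<open>sum_trace_mixed_le\<close> bounds by unmixed ones.\<close>

lemma khintchine_step:
  fixes A :: "'j::finite \<Rightarrow> complex^'n^'n"
  assumes A: "\<And>j. hermitian_mat (A j)"
  shows "(\<Sum>e\<in>UNIV. (norm (mpow (rad_sum A e) (Suc N)))\<^sup>2)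
    \<le> real (2 * N + 1) * (\<Sum>e\<in>UNIV. \<Sum>j\<in>UNIV. (norm (A j ** mpow (rad_sum A e) N))\<^sup>2)"
proof -
  note hX = hermitian_rad_sum[of A, OF A]
  let ?X = "rad_sum A"
  have "(norm (mpow (?X e) (Suc N)))\<^sup>2 = (\<Sum>j\<in>UNIV. sgn_of (e j) * (A j \<bullet> mpow (?X e) (Suc (2 * N))))" for e
  proof -
    have "(norm (mpow (?X e) (Suc N)))\<^sup>2 = (?X e ** mpow (?X e) N) \<bullet> mpow (?X e) (Suc N)"
      by (simp add: power2_norm_eq_inner)
    also have "\<dots> = ?X e \<bullet> (mpow (?X e) (Suc N) ** mpow (?X e) N)"
      using hermitian_mpow[OF hX, of e N] by (simp only: inner_matrix_mult_right hermitian_iff_adj)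
    also have "\<dots> = ?X e \<bullet> mpow (?X e) (Suc (2 * N))"
      by (simp only: mpow_add[symmetric]) (simp add: mult_2)
    also have "?X e \<bullet> Z = (\<Sum>j\<in>UNIV. sgn_of (e j) * (A j \<bullet> Z))" for Z
      by (simp add: rad_sum_def inner_sum_left)
    finally show ?thesis .
  qed
  then have "(\<Sum>e\<in>UNIV. (norm (mpow (?X e) (Suc N)))\<^sup>2)
     = (\<Sum>e\<in>UNIV. \<Sum>j\<in>UNIV. sgn_of (e j) * (A j \<bullet> mpow (?X e) (Suc (2 * N))))"
    by simp
  also have "\<dots> = (\<Sum>j\<in>UNIV. \<Sum>e\<in>UNIV. sgn_of (e j) * (A j \<bullet> mpow (?X e) (Suc (2 * N))))"
    by (rule sum.swap)
  also have "\<dots> \<le> (\<Sum>j\<in>UNIV. \<Sum>e\<in>UNIV. real (2 * N + 1) * (norm (A j ** mpow (?X e) N))\<^sup>2)"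
  proof (rule sum_mono)
    fix j
    let ?F = "\<lambda>e. A j \<bullet> mpow (?X e) (Suc (2 * N))"
    let ?B = "\<lambda>e. (norm (A j ** mpow (?X e) N))\<^sup>2"
    have bound: "2 * (sgn_of (e j) * (?F e - ?F (flip j e)))
      \<le> 2 * real (2 * N + 1) * (?B (flip j e) + ?B e)" for e
    proof -
      \<comment> \<open>The two sums differ by 2 sgn (e j) A j alone, so every term of the
        telescoped difference contains \<open>A j\<close> twice.\<close>
      have "?F e - ?F (flip j e)
        = A j \<bullet> (\<Sum>k\<le>2 * N. mpow (?X e) k ** ((2 * sgn_of (e j)) *\<^sub>R A j) ** mpow (?X (flip j e)) (2 * N - k))"
        by (simp only: inner_diff_right[symmetric] mpow_diff rad_sum_flip)
      then have "sgn_of (e j) * (?F e - ?F (flip j e))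
        = 2 * (\<Sum>k\<le>2 * N. A j \<bullet> (mpow (?X e) k ** A j ** mpow (?X (flip j e)) (2 * N - k)))"
        by (simp add: inner_sum_right matrix_mult.scaleR_left matrix_mult.scaleR_right
            sum_distrib_left mult.assoc mult.left_commute[of "sgn_of (e j)" 2])
      also have "\<dots> \<le> real (2 * N + 1) * (?B (flip j e) + (norm (mpow (?X e) N ** A j))\<^sup>2)"
        by (rule sum_trace_mixed_le[OF hX hX])
      also have "norm (mpow (?X e) N ** A j) = norm (A j ** mpow (?X e) N)"
        using A[of j] hermitian_mpow[OF hX, of e N]
        by (metis adj_mat_mult hermitian_iff_adj norm_adj_mat)
      finally show ?thesis by (simp add: algebra_simps)
    qed
    \<comment> \<open>The flip is a bijection that negates the weight, so the weighted sum is half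
      of the weighted sum of differences.\<close>
    have "(\<Sum>e\<in>UNIV. sgn_of (e j) * ?F (flip j e)) = - (\<Sum>e\<in>UNIV. sgn_of (e j) * ?F e)"
      using sum_flip[of "\<lambda>e. - (sgn_of (e j) * ?F e)" j] by (simp add: flip_def sum_negf)
    then have "4 * (\<Sum>e\<in>UNIV. sgn_of (e j) * ?F e)
      = (\<Sum>e\<in>UNIV. 2 * (sgn_of (e j) * (?F e - ?F (flip j e))))"
      by (simp add: right_diff_distrib sum_subtractf sum_distrib_left[symmetric])
    also have "\<dots> \<le> (\<Sum>e\<in>UNIV. 2 * real (2 * N + 1) * (?B (flip j e) + ?B e))"
      by (intro sum_mono bound)
    also have "\<dots> = 4 * (\<Sum>e\<in>UNIV. real (2 * N + 1) * ?B e)"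
      using sum_flip[of ?B j] by (simp only: sum_distrib_left[symmetric] sum.distrib) simp
    finally show "(\<Sum>e\<in>UNIV. sgn_of (e j) * ?F e) \<le> (\<Sum>e\<in>UNIV. real (2 * N + 1) * ?B e)"
      by simp
  qed
  also have "\<dots> = real (2 * N + 1) * (\<Sum>e\<in>UNIV. \<Sum>j\<in>UNIV. (norm (A j ** mpow (?X e) N))\<^sup>2)"
    by (subst sum.swap) (simp only: sum_distrib_left)
  finally show ?thesis .
qed

text \<open>Each step lowers the power by one at the cost of an odd factor and of \<open>b\<close>,
  because the sum of (norm (A j ** Y))^2 is the quadratic form of the variance matrix at
  \<open>Y\<close>. The last step leaves the total Frobenius mass, not a dimension times
  \<open>b\<close>; families of small trace profit from this.\<close>

theorem khintchine:
  fixes A :: "'j::finite \<Rightarrow> complex^'n^'n"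
  assumes A: "\<And>j. hermitian_mat (A j)" and b: "spec_norm (\<Sum>j\<in>UNIV. A j ** A j) \<le> b"
  shows "(\<Sum>e\<in>UNIV. (norm (mpow (rad_sum A e) (Suc N)))\<^sup>2)
    \<le> 2 ^ CARD('j) * dfact (Suc N) * b ^ N * (\<Sum>j\<in>UNIV. (norm (A j))\<^sup>2)"
proof (induction N)
  case 0
  show ?case using khintchine_step[of A 0, OF A] by (simp add: card_fun)
next
  case (Suc N)
  have "0 \<le> b" using b spec_norm_nonneg order_trans by blast
  have "(\<Sum>j\<in>UNIV. (norm (A j ** Y))\<^sup>2) \<le> b * (norm Y)\<^sup>2" for Y :: "complex^'n^'n"
  proof -
    have "(\<Sum>j\<in>UNIV. (norm (A j ** Y))\<^sup>2) = ((\<Sum>j\<in>UNIV. A j ** A j) ** Y) \<bullet> Y"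
      using A by (simp add: power2_norm_eq_inner inner_matrix_mult_left[of "A _"] hermitian_iff_adj
          matrix_mul_assoc matrix_mult.sum_left inner_sum_left inner_sum_right inner_commute)
    also have "\<dots> \<le> norm ((\<Sum>j\<in>UNIV. A j ** A j) ** Y) * norm Y"
      by (rule norm_cauchy_schwarz)
    also have "\<dots> \<le> (b * norm Y) * norm Y"
      by (intro mult_right_mono order_trans[OF norm_matrix_mult_le] b) auto
    finally show ?thesis by (simp add: power2_eq_square)
  qed
  then have "(\<Sum>e\<in>UNIV. (norm (mpow (rad_sum A e) (Suc (Suc N))))\<^sup>2)
    \<le> real (2 * Suc N + 1) * (\<Sum>e\<in>UNIV. b * (norm (mpow (rad_sum A e) (Suc N)))\<^sup>2)"
    by (intro order_trans[OF khintchine_step[of A, OF A]] mult_left_mono sum_mono) auto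
  also have "\<dots> = (real (2 * Suc N + 1) * b) * (\<Sum>e\<in>UNIV. (norm (mpow (rad_sum A e) (Suc N)))\<^sup>2)"
    by (simp add: sum_distrib_left mult.assoc)
  also have "\<dots> \<le> (real (2 * Suc N + 1) * b) *
      (2 ^ CARD('j) * dfact (Suc N) * b ^ N * (\<Sum>j\<in>UNIV. (norm (A j))\<^sup>2))"
    using \<open>0 \<le> b\<close> by (intro mult_left_mono Suc) auto
  finally show ?case by (simp add: algebra_simps)
qed

text \<open>\<open>t\<close> takes the place of the dimension: it compares the trace of the variance
  matrix with the bound \<open>b\<close> on its norm.\<close>

corollary spec_norm_khintchine:
  fixes A :: "'j::finite \<Rightarrow> complex^'n^'n"
  assumes A: "\<And>j. hermitian_mat (A j)" and b: "spec_norm (\<Sum>j\<in>UNIV. A j ** A j) \<le> b"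
    and t: "(\<Sum>j\<in>UNIV. (norm (A j))\<^sup>2) \<le> t * b" and p: "p \<ge> 1"
  shows "(\<Sum>e\<in>UNIV. spec_norm (rad_sum A e) ^ (2 * p)) \<le> 2 ^ CARD('j) * (dfact p * t * b ^ p)"
proof -
  obtain N where N: "p = Suc N" using p by (cases p) auto
  have "0 \<le> b" using b spec_norm_nonneg order_trans by blast
  have "(\<Sum>e\<in>UNIV. spec_norm (rad_sum A e) ^ (2 * p))
    \<le> (\<Sum>e\<in>UNIV. (norm (mpow (rad_sum A e) (Suc N)))\<^sup>2)"
    unfolding N mult.commute[of 2] power_mult
    by (intro sum_mono power_mono spec_norm_power_le hermitian_rad_sum A) auto
  also have "\<dots> \<le> 2 ^ CARD('j) * dfact (Suc N) * b ^ N * (\<Sum>j\<in>UNIV. (norm (A j))\<^sup>2)"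
    by (rule khintchine[OF A b])
  also have "\<dots> \<le> 2 ^ CARD('j) * dfact (Suc N) * b ^ N * (t * b)"
    using \<open>0 \<le> b\<close> by (intro mult_left_mono t) (auto intro!: mult_nonneg_nonneg less_imp_le[OF dfact_pos])
  also have "\<dots> = 2 ^ CARD('j) * (dfact p * t * b ^ p)"
    by (simp add: N algebra_simps)
  finally show ?thesis .
qed

subsection \<open>Positive semidefinite matrices\<close>

text \<open>The real inner product loses nothing here, since v^H A v is real for Hermitian
  \<open>A\<close>.\<close>

definition psd_mat :: "complex^'n^'n \<Rightarrow> bool" where
  "psd_mat A \<longleftrightarrow> hermitian_mat A \<and> (\<forall>v. 0 \<le> v \<bullet> (A *v v))"

lemma psd_sum: "(\<And>i. i \<in> I \<Longrightarrow> psd_mat (A i)) \<Longrightarrow> psd_mat (\<Sum>i\<in>I. A i)"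
  unfolding psd_mat_def
  by (auto intro!: hermitian_sum sum_nonneg simp: matrix_vector_mult.sum_left inner_sum_right)

lemma inner_square: "hermitian_mat A \<Longrightarrow> v \<bullet> ((A ** A) *v v) = (norm (A *v v))\<^sup>2"
  by (simp add: power2_norm_eq_inner inner_hermitian matrix_vector_mul_assoc)

lemma psd_square: "hermitian_mat A \<Longrightarrow> psd_mat (A ** A)"
  unfolding psd_mat_def by (auto simp: hermitian_square inner_square)

lemma quadratic_nonneg_discriminant:
  fixes a b c :: real
  assumes c: "0 \<le> c" and nonneg: "\<And>t. 0 \<le> a + 2 * t * b + t\<^sup>2 * c"
  shows "b\<^sup>2 \<le> a * c"
proof (cases "c = 0")
  case True
  have "b = 0"
  proof (rule ccontr)
    assume "b \<noteq> 0"
    \<comment> \<open>At this argument the affine function a + 2 t b takes the value -1.\<close>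
    with nonneg[of "- (a + 1) / (2 * b)"] True show False by (simp add: field_simps)
  qed
  with True show ?thesis by simp
next
  case False
  with c have "c > 0" by simp
  have "0 \<le> a + 2 * (- b / c) * b + (- b / c)\<^sup>2 * c" by (rule nonneg)
  also have "\<dots> = a - b\<^sup>2 / c" using False by (simp add: field_simps power2_eq_square)
  finally show ?thesis using \<open>c > 0\<close> by (simp add: field_simps)
qed

lemma psd_cauchy_schwarz:
  assumes "psd_mat A"
  shows "(u \<bullet> (A *v v))\<^sup>2 \<le> (u \<bullet> (A *v u)) * (v \<bullet> (A *v v))"
proof (rule quadratic_nonneg_discriminant)
  fix t :: real
  have A: "hermitian_mat A" and nn: "\<And>v. 0 \<le> v \<bullet> (A *v v)"
    using assms by (auto simp: psd_mat_def)
  have "v \<bullet> (A *v u) = u \<bullet> (A *v v)"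
    using inner_hermitian[OF A, of v u] by (simp add: inner_commute)
  then have "(u + t *\<^sub>R v) \<bullet> (A *v (u + t *\<^sub>R v))
      = u \<bullet> (A *v u) + 2 * t * (u \<bullet> (A *v v)) + t\<^sup>2 * (v \<bullet> (A *v v))"
    by (simp add: matrix_vector_mult.add_right matrix_vector_mult.scaleR_right inner_add_left
        inner_add_right power2_eq_square algebra_simps)
  with nn[of "u + t *\<^sub>R v"]
  show "0 \<le> u \<bullet> (A *v u) + 2 * t * (u \<bullet> (A *v v)) + t\<^sup>2 * (v \<bullet> (A *v v))" by simp
qed (use assms in \<open>auto simp: psd_mat_def\<close>)

lemma inner_mult_vec_le: "v \<bullet> (A *v v) \<le> spec_norm A * (norm v)\<^sup>2" for A :: "complex^'n^'n"
proof -
  have "v \<bullet> (A *v v) \<le> norm v * norm (A *v v)" by (rule norm_cauchy_schwarz)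
  also have "\<dots> \<le> norm v * (spec_norm A * norm v)"
    by (intro mult_left_mono spec_norm_mult_vec) auto
  finally show ?thesis by (simp add: power2_eq_square algebra_simps)
qed

text \<open>In operator form, A^2 is at most the norm of A times A. Cauchy-Schwarz for the form of
  \<open>A\<close>, applied to A v and v, avoids a square root of \<open>A\<close>.\<close>

lemma psd_norm_mult_vec:
  assumes "psd_mat A"
  shows "(norm (A *v v))\<^sup>2 \<le> spec_norm A * (v \<bullet> (A *v v))"
proof (cases "A *v v = 0")
  case False
  let ?u = "A *v v"
  have nn: "0 \<le> v \<bullet> (A *v v)" using assms by (auto simp: psd_mat_def)
  have "((norm ?u)\<^sup>2)\<^sup>2 = (?u \<bullet> (A *v v))\<^sup>2" by (simp add: power2_norm_eq_inner)
  also have "\<dots> \<le> (?u \<bullet> (A *v ?u)) * (v \<bullet> (A *v v))" by (rule psd_cauchy_schwarz[OF assms])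
  also have "\<dots> \<le> (spec_norm A * (norm ?u)\<^sup>2) * (v \<bullet> (A *v v))"
    by (intro mult_right_mono inner_mult_vec_le nn)
  finally have "(norm ?u)\<^sup>2 * (norm ?u)\<^sup>2 \<le> (norm ?u)\<^sup>2 * (spec_norm A * (v \<bullet> (A *v v)))"
    by (simp add: power2_eq_square algebra_simps)
  then show ?thesis by (rule mult_left_le_imp_le) (use False in simp)
next
  case True
  then show ?thesis by simp
qed

text \<open>Self-improvement: the previous bound turns the form estimate into s^2 \<le> s b for s =
  \<open>spec_norm A\<close>, and s can be cancelled.\<close>

lemma psd_spec_norm_le:
  assumes A: "psd_mat A" and b: "\<And>v. v \<bullet> (A *v v) \<le> b * (norm v)\<^sup>2"
  shows "spec_norm A \<le> b"
proof -
  \<comment> \<open>Testing the form with any unit vector shows that \<open>b\<close> is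
    nonnegative.\<close>
  have "0 \<le> axis undefined 1 \<bullet> (A *v axis undefined 1)" using A by (auto simp: psd_mat_def)
  also have "\<dots> \<le> b" using b[of "axis undefined 1"] by simp
  finally have b0: "0 \<le> b" .
  have "spec_norm A \<le> sqrt (spec_norm A * b)"
  proof (rule spec_norm_le)
    fix v
    have "(norm (A *v v))\<^sup>2 \<le> spec_norm A * (b * (norm v)\<^sup>2)"
      by (intro order_trans[OF psd_norm_mult_vec[OF A]] mult_left_mono b) auto
    then have "norm (A *v v) \<le> sqrt (spec_norm A * (b * (norm v)\<^sup>2))" by (rule real_le_rsqrt)
    then show "norm (A *v v) \<le> sqrt (spec_norm A * b) * norm v"
      by (simp add: real_sqrt_mult)
  qed
  from power_mono[OF this spec_norm_nonneg, of 2] have "spec_norm A * spec_norm A \<le> spec_norm A * b"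
    using b0 by (simp add: power2_eq_square)
  then show ?thesis using b0 spec_norm_nonneg[of A] by (cases "spec_norm A = 0") auto
qed

lemma psd_spec_norm_mono:
  assumes "psd_mat A" "\<And>v. v \<bullet> (A *v v) \<le> v \<bullet> (B *v v)"
  shows "spec_norm A \<le> spec_norm B"
  by (rule psd_spec_norm_le) (auto intro: assms order_trans inner_mult_vec_le)

text \<open>The real part of the trace, written through quadratic forms so that form inequalities
  can be summed directly.\<close>

definition rtrace :: "complex^'n^'n \<Rightarrow> real" where
  "rtrace A = (\<Sum>k\<in>UNIV. axis k 1 \<bullet> (A *v axis k 1))"

lemma rtrace_sum: "rtrace (\<Sum>i\<in>I. A i) = (\<Sum>i\<in>I. rtrace (A i))"
  unfolding rtrace_def by (simp add: matrix_vector_mult.sum_left inner_sum_right) (rule sum.swap)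

lemma rtrace_le: "rtrace A \<le> real CARD('n) * spec_norm A" for A :: "complex^'n^'n"
proof -
  have "rtrace A \<le> (\<Sum>k\<in>(UNIV::'n set). spec_norm A)"
    unfolding rtrace_def by (intro sum_mono order_trans[OF inner_mult_vec_le]) simp
  then show ?thesis by simp
qed

lemma norm_eq_sum_axis: "(norm A)\<^sup>2 = (\<Sum>k\<in>UNIV. (norm (A *v axis k 1))\<^sup>2)" for A :: "complex^'n^'m"
proof -
  have "column k A = A *v axis k 1" for k
    by (simp add: column_def matrix_vector_mult_def axis_def vec_eq_iff if_distrib cong: if_cong)
  then show ?thesis by (simp add: norm_eq_sum_columns)
qed

lemma rtrace_square: "hermitian_mat A \<Longrightarrow> rtrace (A ** A) = (norm A)\<^sup>2"
  unfolding rtrace_def norm_eq_sum_axis by (simp add: inner_square)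

text \<open>Summing W j^2 \<le> \<mu> W j over \<open>j\<close> bounds the variance matrix by \<mu>
  times the sum of the W j. The same inequality, tested on basis vectors, bounds the Frobenius mass,
  so both hypotheses of Khintchine follow from \<open>key\<close>.\<close>

lemma psd_khintchine:
  fixes W :: "'j::finite \<Rightarrow> complex^'n^'n"
  assumes W: "\<And>j. psd_mat (W j)" and mu: "\<And>j. spec_norm (W j) \<le> \<mu>"
    and t: "rtrace (\<Sum>j\<in>UNIV. W j) \<le> t * spec_norm (\<Sum>j\<in>UNIV. W j)" and p: "p \<ge> 1"
  shows "(\<Sum>e\<in>UNIV. spec_norm (rad_sum W e) ^ (2 * p))
    \<le> 2 ^ CARD('j) * (dfact p * t * (\<mu> * spec_norm (\<Sum>j\<in>UNIV. W j)) ^ p)"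
proof -
  let ?T = "\<Sum>j\<in>UNIV. W j"
  have H: "hermitian_mat (W j)" and nn: "0 \<le> v \<bullet> (W j *v v)" for j v
    using W by (auto simp: psd_mat_def)
  have mu0: "0 \<le> \<mu>" using mu spec_norm_nonneg order_trans by blast
  have key: "(\<Sum>j\<in>UNIV. (norm (W j *v v))\<^sup>2) \<le> \<mu> * (v \<bullet> (?T *v v))" for v
  proof -
    have "(\<Sum>j\<in>UNIV. (norm (W j *v v))\<^sup>2) \<le> (\<Sum>j\<in>UNIV. \<mu> * (v \<bullet> (W j *v v)))"
      by (intro sum_mono order_trans[OF psd_norm_mult_vec[OF W]] mult_right_mono mu nn)
    then show ?thesis
      by (simp add: matrix_vector_mult.sum_left inner_sum_right sum_distrib_left)
  qed
  show ?thesis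
  proof (rule spec_norm_khintchine[OF H _ _ p])
    show "spec_norm (\<Sum>j\<in>UNIV. W j ** W j) \<le> \<mu> * spec_norm ?T"
    proof (rule psd_spec_norm_le)
      fix v
      have "v \<bullet> ((\<Sum>j\<in>UNIV. W j ** W j) *v v) = (\<Sum>j\<in>UNIV. (norm (W j *v v))\<^sup>2)"
        by (simp add: matrix_vector_mult.sum_left inner_sum_right inner_square[OF H])
      also have "\<dots> \<le> \<mu> * (spec_norm ?T * (norm v)\<^sup>2)"
        using key[of v] mult_left_mono[OF inner_mult_vec_le[of v ?T] mu0] by simp
      finally show "v \<bullet> ((\<Sum>j\<in>UNIV. W j ** W j) *v v) \<le> \<mu> * spec_norm ?T * (norm v)\<^sup>2" by simp
    qed (auto intro: psd_sum psd_square H)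
    have "(\<Sum>j\<in>UNIV. (norm (W j))\<^sup>2) = (\<Sum>k\<in>UNIV. \<Sum>j\<in>UNIV. (norm (W j *v axis k 1))\<^sup>2)"
      unfolding norm_eq_sum_axis by (rule sum.swap)
    also have "\<dots> \<le> (\<Sum>k\<in>UNIV. \<mu> * (axis k 1 \<bullet> (?T *v axis k 1)))"
      by (intro sum_mono key)
    also have "\<dots> = \<mu> * rtrace ?T" by (simp add: rtrace_def sum_distrib_left)
    also have "\<dots> \<le> \<mu> * (t * spec_norm ?T)" by (intro mult_left_mono t mu0)
    finally show "(\<Sum>j\<in>UNIV. (norm (W j))\<^sup>2) \<le> t * (\<mu> * spec_norm ?T)" by (simp add: algebra_simps)
  qed
qed

subsection \<open>Dilations and the Rademacher chaos\<close>

text \<open>The Hermitian matrix with first block row \<open>(0, R\<^sub>1, \<dots>, R\<^sub>n)\<close>, first block column its adjoint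
  (the \<open>R\<^sub>i\<close> are Hermitian throughout), and zeros elsewhere.\<close>

definition dilation :: "('i \<Rightarrow> complex^'d^'d) \<Rightarrow> complex^('i::finite option \<times> 'd)^('i option \<times> 'd)" where
  "dilation R = (\<chi> a b. case (fst a, fst b) of
      (None, Some i) \<Rightarrow> R i $ snd a $ snd b
    | (Some i, None) \<Rightarrow> R i $ snd a $ snd b
    | _ \<Rightarrow> 0)"

definition blk :: "'a \<Rightarrow> complex^('a::finite \<times> 'd::finite) \<Rightarrow> complex^'d" where
  "blk a u = (\<chi> k. u $ (a, k))"

lemma sum_option: "(\<Sum>a\<in>UNIV. f a) = f None + (\<Sum>i\<in>UNIV. f (Some i))"
  for f :: "'i::finite option \<Rightarrow> 'b::comm_monoid_add"
  by (simp add: UNIV_option_conv sum.reindex)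

lemma sum_UNIV_prod: "(\<Sum>x\<in>UNIV. f x) = (\<Sum>a\<in>UNIV. \<Sum>b\<in>UNIV. f (a, b))"
  for f :: "'a::finite \<times> 'b::finite \<Rightarrow> 'c::comm_monoid_add"
  by (simp add: sum.cartesian_product flip: UNIV_Times_UNIV)

lemma norm_blk: "(norm u)\<^sup>2 = (\<Sum>a\<in>UNIV. (norm (blk a u))\<^sup>2)"
  unfolding power2_norm_eq_inner inner_vec_def blk_def
  by (simp add: sum_UNIV_prod)

lemma blk_dilation_None:
  "blk None (dilation R *v u) = (\<Sum>i\<in>UNIV. R i *v blk (Some i) u)"
  by (simp add: vec_eq_iff blk_def matrix_vector_mult_def dilation_def sum_option sum_UNIV_prod
      sum_component)

lemma blk_dilation_Some:
  "blk (Some i) (dilation R *v u) = R i *v blk None u"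
  by (simp add: vec_eq_iff blk_def matrix_vector_mult_def dilation_def sum_option sum_UNIV_prod)

lemma norm_dilation_vec: "(norm (dilation R *v u))\<^sup>2
  = (norm (\<Sum>i\<in>UNIV. R i *v blk (Some i) u))\<^sup>2 + (\<Sum>i\<in>UNIV. (norm (R i *v blk None u))\<^sup>2)"
  by (simp add: norm_blk[of "dilation R *v u"] sum_option blk_dilation_None blk_dilation_Some)

lemma hermitian_dilation: "(\<And>i. hermitian_mat (R i)) \<Longrightarrow> hermitian_mat (dilation R)"
  unfolding hermitian_mat_def[of "dilation R"] dilation_def
  by (auto simp: hermitian_iff_adj adj_mat_def vec_eq_iff split: option.split)

lemma dilation_sum: "dilation (\<lambda>i. \<Sum>j\<in>J. c j *\<^sub>R R j i) = (\<Sum>j\<in>J. c j *\<^sub>R dilation (R j))"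
  by (auto simp: vec_eq_iff dilation_def sum_component split: option.split)

text \<open>Test vectors supported in the distinguished block; a dilation sends such a vector to the
  stack of all R i v.\<close>

definition at_None :: "complex^'d \<Rightarrow> complex^('i::finite option \<times> 'd::finite)" where
  "at_None v = (\<chi> a. if fst a = None then v $ snd a else 0)"

lemma blk_at_None [simp]: "blk None (at_None v) = v" "blk (Some i) (at_None v) = 0"
  by (simp_all add: blk_def at_None_def vec_eq_iff)

lemma norm_at_None [simp]: "norm (at_None v) = norm v"
proof -
  have "(norm (at_None v))\<^sup>2 = (norm v)\<^sup>2" by (simp add: norm_blk sum_option)
  then show ?thesis by simp
qed

lemma norm_dilation_at_None: "(norm (dilation R *v at_None v))\<^sup>2 = (\<Sum>i\<in>UNIV. (norm (R i *v v))\<^sup>2)"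
  by (simp add: norm_dilation_vec)

lemma inner_sum_squares:
  assumes "\<And>i. hermitian_mat (R i)"
  shows "v \<bullet> ((\<Sum>i\<in>I. R i ** R i) *v v) = (\<Sum>i\<in>I. (norm (R i *v v))\<^sup>2)"
  using assms by (simp add: matrix_vector_mult.sum_left inner_sum_right inner_square)

lemma norm_dilation: "(norm (dilation R))\<^sup>2 = 2 * (\<Sum>i\<in>UNIV. (norm (R i))\<^sup>2)"
proof -
  have "(norm (dilation R))\<^sup>2 = (\<Sum>a\<in>UNIV. \<Sum>b\<in>UNIV. (cmod (dilation R $ a $ b))\<^sup>2)"
    by (simp add: norm_vec_def L2_set_def sum_nonneg)
  also have "\<dots> = 2 * (\<Sum>i\<in>UNIV. \<Sum>k\<in>UNIV. \<Sum>l\<in>UNIV. (cmod (R i $ k $ l))\<^sup>2)"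
    using sum.swap[of "\<lambda>i k. \<Sum>l\<in>UNIV. (cmod (R i $ k $ l))\<^sup>2" UNIV UNIV]
    by (simp add: dilation_def sum_option sum_UNIV_prod)
  also have "\<dots> = 2 * (\<Sum>i\<in>UNIV. (norm (R i))\<^sup>2)"
    by (simp add: norm_vec_def L2_set_def sum_nonneg)
  finally show ?thesis .
qed

text \<open>The squared dilation is block diagonal, with the sum of the squares R i^2 as one block
  and the product of the stacked column with its adjoint as the other. The two blocks have the same
  norm; for the second one this is a duality argument.\<close>

lemma spec_norm_dilation_square_le:
  assumes R: "\<And>i. hermitian_mat (R i)"
  shows "spec_norm (dilation R ** dilation R) \<le> spec_norm (\<Sum>i\<in>UNIV. R i ** R i)"
proof (rule psd_spec_norm_le)
  let ?s = "spec_norm (\<Sum>i\<in>UNIV. R i ** R i)"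
  note D = hermitian_dilation[of R, OF R]
  show "psd_mat (dilation R ** dilation R)" by (rule psd_square[OF D])
  fix u
  let ?w = "\<Sum>i\<in>UNIV. R i *v blk (Some i) u"
  have s: "(\<Sum>i\<in>UNIV. (norm (R i *v v))\<^sup>2) \<le> ?s * (norm v)\<^sup>2" for v
    using inner_mult_vec_le[of v "\<Sum>i\<in>UNIV. R i ** R i"] by (simp add: inner_sum_squares[OF R])
  \<comment> \<open>The vector \<open>?w\<close> is paired with itself, the R i are moved onto it,
    and Cauchy-Schwarz over the blocks leaves one factor (norm ?w)^2 to cancel.\<close>
  have "(norm ?w)\<^sup>2 \<le> ?s * (\<Sum>i\<in>UNIV. (norm (blk (Some i) u))\<^sup>2)"
  proof (cases "?w = 0")
    case False
    have "(norm ?w)\<^sup>2 = (\<Sum>i\<in>UNIV. (R i *v ?w) \<bullet> blk (Some i) u)"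
      by (simp add: power2_norm_eq_inner inner_sum_right inner_hermitian[OF R])
    also have "\<dots> \<le> (\<Sum>i\<in>UNIV. \<bar>norm (R i *v ?w)\<bar> * \<bar>norm (blk (Some i) u)\<bar>)"
      by (intro sum_mono) (simp add: norm_cauchy_schwarz)
    also have "\<dots> \<le> L2_set (\<lambda>i. norm (R i *v ?w)) UNIV * L2_set (\<lambda>i. norm (blk (Some i) u)) UNIV"
      by (rule L2_set_mult_ineq)
    finally have "((norm ?w)\<^sup>2)\<^sup>2 \<le> (\<Sum>i\<in>UNIV. (norm (R i *v ?w))\<^sup>2) * (\<Sum>i\<in>UNIV. (norm (blk (Some i) u))\<^sup>2)"
      using power_mono[of "(norm ?w)\<^sup>2" _ 2] by (fastforce simp: L2_set_def power_mult_distrib sum_nonneg)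
    also have "\<dots> \<le> (?s * (norm ?w)\<^sup>2) * (\<Sum>i\<in>UNIV. (norm (blk (Some i) u))\<^sup>2)"
      by (intro mult_right_mono s sum_nonneg) auto
    finally have "(norm ?w)\<^sup>2 * (norm ?w)\<^sup>2 \<le> (norm ?w)\<^sup>2 * (?s * (\<Sum>i\<in>UNIV. (norm (blk (Some i) u))\<^sup>2))"
      by (simp only: power2_eq_square mult.assoc mult.left_commute)
    then show ?thesis by (rule mult_left_le_imp_le) (use False in simp)
  qed (simp add: sum_nonneg)
  then have "(norm (dilation R *v u))\<^sup>2 \<le> ?s * (norm u)\<^sup>2"
    using s[of "blk None u"] unfolding norm_dilation_vec norm_blk[of u] sum_option
    by (simp add: algebra_simps)
  then show "u \<bullet> ((dilation R ** dilation R) *v u) \<le> ?s * (norm u)\<^sup>2"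
    by (simp add: inner_square[OF D])
qed

text \<open>Written as a sum over \<open>j\<close> so that, for a fixed first sample, it is a sum of
  independent positive semidefinite terms; \<open>inner_gram\<close> identifies its two diagonal
  blocks.\<close>

definition gram :: "('i::finite \<Rightarrow> 'j::finite \<Rightarrow> complex^'d^'d) \<Rightarrow> complex^('i option \<times> 'd)^('i option \<times> 'd)" where
  "gram A = (\<Sum>j\<in>UNIV. dilation (\<lambda>i. A i j) ** dilation (\<lambda>i. A i j))"

lemma sum_square_vec_le_gram:
  assumes A: "\<And>i j. hermitian_mat (A i j)"
  shows "(\<Sum>j\<in>UNIV. \<Sum>i\<in>UNIV. (norm (A i j *v v))\<^sup>2) \<le> spec_norm (gram A) * (norm v)\<^sup>2"
proof -
  have "(\<Sum>j\<in>UNIV. \<Sum>i\<in>UNIV. (norm (A i j *v v))\<^sup>2) = at_None v \<bullet> (gram A *v at_None v)"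
    unfolding gram_def by (simp add: inner_sum_squares hermitian_dilation A norm_dilation_at_None)
  also have "\<dots> \<le> spec_norm (gram A) * (norm v)\<^sup>2"
    using inner_mult_vec_le[of "at_None v" "gram A"] by simp
  finally show ?thesis .
qed

text \<open>Both occurrences of a block carry the same Frobenius mass, so it suffices to test the
  \<open>d\<close> basis vectors of the distinguished block.\<close>

lemma sum_norm_dilation_le_gram:
  fixes A :: "'i::finite \<Rightarrow> 'j::finite \<Rightarrow> complex^'d^'d"
  assumes A: "\<And>i j. hermitian_mat (A i j)"
  shows "(\<Sum>j\<in>UNIV. (norm (dilation (\<lambda>i. A i j)))\<^sup>2) \<le> 2 * real CARD('d) * spec_norm (gram A)"
proof -
  have "(\<Sum>j\<in>UNIV. (norm (dilation (\<lambda>i. A i j)))\<^sup>2)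
    = 2 * (\<Sum>j\<in>UNIV. \<Sum>i\<in>UNIV. \<Sum>k\<in>UNIV. (norm (A i j *v axis k 1))\<^sup>2)"
    by (simp add: norm_dilation norm_eq_sum_axis[of "A _ _"] sum_distrib_left)
  also have "(\<Sum>j\<in>UNIV. \<Sum>i\<in>UNIV. \<Sum>k\<in>UNIV. (norm (A i j *v axis k 1))\<^sup>2)
    = (\<Sum>j\<in>UNIV. \<Sum>k\<in>UNIV. \<Sum>i\<in>UNIV. (norm (A i j *v axis k 1))\<^sup>2)"
    by (intro sum.cong refl sum.swap)
  also have "\<dots> = (\<Sum>k\<in>UNIV. \<Sum>j\<in>UNIV. \<Sum>i\<in>UNIV. (norm (A i j *v axis k 1))\<^sup>2)"
    by (rule sum.swap)
  also have "\<dots> \<le> (\<Sum>k\<in>(UNIV::'d set). spec_norm (gram A))"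
    by (intro sum_mono order_trans[OF sum_square_vec_le_gram[OF A]]) simp
  finally show ?thesis by simp
qed

lemma rtrace_gram_le:
  fixes A :: "'i::finite \<Rightarrow> 'j::finite \<Rightarrow> complex^'d^'d"
  assumes A: "\<And>i j. hermitian_mat (A i j)"
  shows "rtrace (gram A) \<le> 2 * real CARD('d) * spec_norm (gram A)"
  using sum_norm_dilation_le_gram[of A, OF A] unfolding gram_def
  by (simp add: rtrace_sum rtrace_square hermitian_dilation A)

text \<open>For fixed signs e' the first Khintchine step acts on d x d matrices. Its variance is
  bounded by the squared norm of a Rademacher sum of dilations, to which the second step applies
  with trace ratio 2 d.\<close>

lemma chaos_moment:
  fixes A :: "'i::finite \<Rightarrow> 'j::finite \<Rightarrow> complex^'d^'d"
  assumes A: "\<And>i j. hermitian_mat (A i j)" and p: "p \<ge> 1"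
  shows "(\<Sum>e'\<in>UNIV. \<Sum>e\<in>UNIV. spec_norm (rad_sum (\<lambda>i. rad_sum (A i) e') e) ^ (2 * p))
    \<le> 2 ^ CARD('i) * 2 ^ CARD('j) * (2 * (dfact p * real CARD('d))\<^sup>2 * spec_norm (gram A) ^ p)"
proof -
  let ?D = "\<lambda>j. dilation (\<lambda>i. A i j)"
  have step: "(\<Sum>e\<in>UNIV. spec_norm (rad_sum (\<lambda>i. rad_sum (A i) e') e) ^ (2 * p))
    \<le> 2 ^ CARD('i) * (dfact p * real CARD('d)) * spec_norm (rad_sum ?D e') ^ (2 * p)" for e'
  proof -
    let ?B = "\<lambda>i. rad_sum (A i) e'"
    let ?b = "(spec_norm (rad_sum ?D e'))\<^sup>2"
    have B: "hermitian_mat (?B i)" for i by (intro hermitian_rad_sum A)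
    have D: "rad_sum ?D e' = dilation ?B"
      unfolding rad_sum_def by (rule dilation_sum[symmetric])
    \<comment> \<open>The dilation of \<open>?B\<close> maps a distinguished vector to the stack of
      all \<open>?B i *v v\<close>, so its norm dominates the variance form.\<close>
    have b: "(\<Sum>i\<in>UNIV. (norm (?B i *v v))\<^sup>2) \<le> ?b * (norm v)\<^sup>2" for v
    proof -
      have "norm (dilation ?B *v at_None v) \<le> spec_norm (dilation ?B) * norm v"
        using spec_norm_mult_vec[of "dilation ?B" "at_None v"] by simp
      from power_mono[OF this, of 2] show ?thesis
        unfolding D by (simp add: norm_dilation_at_None power_mult_distrib)
    qed
    have "(\<Sum>e\<in>UNIV. spec_norm (rad_sum ?B e) ^ (2 * p)) \<le> 2 ^ CARD('i) * (dfact p * real CARD('d) * ?b ^ p)"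
    proof (rule spec_norm_khintchine[OF B _ _ p])
      show "spec_norm (\<Sum>i\<in>UNIV. ?B i ** ?B i) \<le> ?b"
        by (rule psd_spec_norm_le) (auto intro: psd_sum psd_square B simp: b inner_sum_squares B)
      have "(\<Sum>i\<in>UNIV. (norm (?B i))\<^sup>2) = (\<Sum>k\<in>UNIV. \<Sum>i\<in>UNIV. (norm (?B i *v axis k 1))\<^sup>2)"
        unfolding norm_eq_sum_axis by (rule sum.swap)
      also have "\<dots> \<le> (\<Sum>k\<in>(UNIV::'d set). ?b)"
        by (intro sum_mono order_trans[OF b]) simp
      finally show "(\<Sum>i\<in>UNIV. (norm (?B i))\<^sup>2) \<le> real CARD('d) * ?b" by simp
    qed
    then show ?thesis by (simp add: power_mult mult.assoc)
  qed
  have "(\<Sum>e'\<in>UNIV. \<Sum>e\<in>UNIV. spec_norm (rad_sum (\<lambda>i. rad_sum (A i) e') e) ^ (2 * p))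
    \<le> 2 ^ CARD('i) * (dfact p * real CARD('d)) * (\<Sum>e'\<in>UNIV. spec_norm (rad_sum ?D e') ^ (2 * p))"
    unfolding sum_distrib_left by (intro sum_mono step)
  also have "\<dots> \<le> 2 ^ CARD('i) * (dfact p * real CARD('d))
      * (2 ^ CARD('j) * (dfact p * (2 * real CARD('d)) * spec_norm (gram A) ^ p))"
  proof (intro mult_left_mono spec_norm_khintchine)
    show "spec_norm (\<Sum>j\<in>UNIV. ?D j ** ?D j) \<le> spec_norm (gram A)" by (simp add: gram_def)
    show "0 \<le> 2 ^ CARD('i) * (dfact p * real CARD('d))" using dfact_pos[of p] by simp
  qed (use p in \<open>auto intro: hermitian_dilation A sum_norm_dilation_le_gram\<close>)
  finally show ?thesis by (simp add: power2_eq_square algebra_simps)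
qed

subsection \<open>Constants and moments\<close>

lemma exp_1_le_power: "n \<ge> 1 \<Longrightarrow> exp 1 \<le> (real (Suc n) / real n) ^ Suc n"
proof -
  assume n: "n \<ge> 1"
  define a where "a = real n / real (Suc n)"
  have a: "a > 0" using n by (simp add: a_def)
  have "ln a \<le> a - 1" using a by (rule ln_le_minus_one)
  then have "1 / real (Suc n) \<le> - ln a" by (simp add: a_def field_simps)
  then have "1 \<le> real (Suc n) * (- ln a)" by (simp add: field_simps)
  also have "\<dots> = ln ((1 / a) ^ Suc n)" using a by (simp add: ln_realpow ln_div algebra_simps)
  finally have "exp 1 \<le> (1 / a) ^ Suc n" using a by (subst (asm) ln_ge_iff) auto
  then show ?thesis by (simp add: a_def)
qed

lemma exp_1_less: "exp 1 < (2.72 :: real)"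
  using e_less_272 by simp

lemma sqrt_2_less: "sqrt 2 < (1.42 :: real)"
  by (rule real_less_lsqrt) (auto simp: power2_eq_square)

text \<open>With p = n + 2 this is the estimate at the worst point, r close to p - 1: the order is
  already p, but the base contains only p - 1 = n + 1. The dimension there is at most exp (p - 2) =
  exp n.\<close>

lemma dfact_exp_le: "dfact (n + 2) * sqrt 2 * exp (real n) \<le> (12 / 5 * real (n + 1)) ^ (n + 2)"
proof (induction n)
  case 0
  show ?case using sqrt_2_less by (simp add: power2_eq_square numeral_2_eq_2)
next
  case (Suc n)
  show ?case
  proof (cases "n = 0")
    case True
    have "sqrt 2 * exp 1 \<le> (1.42 * 2.72 :: real)"
      by (intro mult_mono less_imp_le[OF sqrt_2_less] less_imp_le[OF exp_1_less]) auto
    then show ?thesis using True by (simp add: eval_nat_numeral algebra_simps)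
  next
    case False
    define m where "m = n + 1"
    \<comment> \<open>The induction step needs 2 m + 3 \<le> 12/5 (m + 1), that is m \<ge> 3/2; this
      is why the step from n = 0 is done numerically.\<close>
    have m: "m \<ge> 2" using False by (simp add: m_def)
    have IH: "dfact (Suc m) * sqrt 2 * exp (real n) \<le> (12 / 5 * real m) ^ Suc m"
      using Suc by (simp add: m_def)
    have "dfact (Suc (Suc m)) * sqrt 2 * exp (real (Suc n))
      = (real (2 * Suc m + 1) * exp 1) * (dfact (Suc m) * sqrt 2 * exp (real n))"
      by (simp add: exp_add algebra_simps)
    also have "\<dots> \<le> (real (2 * Suc m + 1) * exp 1) * (12 / 5 * real m) ^ Suc m"
      by (intro mult_left_mono IH) auto
    also have "\<dots> \<le> (12 / 5 * real (Suc m) * (real (Suc m) / real m) ^ Suc m) * (12 / 5 * real m) ^ Suc m"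
      using m by (intro mult_right_mono mult_mono exp_1_le_power) auto
    also have "\<dots> = 12 / 5 * real (Suc m) * (real (Suc m) / real m * (12 / 5 * real m)) ^ Suc m"
      by (simp only: power_mult_distrib mult.assoc)
    also have "real (Suc m) / real m * (12 / 5 * real m) = 12 / 5 * real (Suc m)"
      using m by simp
    finally show ?thesis by (simp add: m_def)
  qed
qed

text \<open>The moment order \<open>\<lceil>r\<rceil>\<close> is large enough to absorb the dimension: \<open>d \<le> exp (r - 1)\<close> is equivalent
  to \<open>r \<ge> ln (e d)\<close>.\<close>

lemma dfact_ceiling_le:
  fixes r :: real
  assumes r: "1 \<le> r" and d: "0 \<le> d" "d \<le> exp (r - 1)" and p: "p = nat \<lceil>r\<rceil>"
  shows "dfact p * sqrt 2 * d \<le> (12 / 5 * r) ^ p"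
proof -
  have pr: "real p - 1 < r" "r \<le> real p" using p r by linarith+
  show ?thesis
  proof (cases "p \<le> 1")
    case True
    with pr r have "p = 1" "r = 1" by linarith+
    moreover from this d have "sqrt 2 * d \<le> 1.42 * 1"
      using sqrt_2_less by (intro mult_mono) auto
    ultimately show ?thesis by simp
  next
    case False
    then obtain n where n: "p = n + 2" by (metis add.commute le_add_diff_inverse not_less_eq_eq numeral_2_eq_2 One_nat_def)
    \<comment> \<open>\<open>a\<close> is the left end of the interval of all \<open>r\<close> with
      ceiling \<open>p\<close>. Going from \<open>a\<close> to \<open>r\<close> multiplies the
      dimension bound by exp (r - a) and the right-hand side by (r / a)^p, and the latter factor is
      larger.\<close>
    define a where "a = real (n + 1)"
    have a: "a \<ge> 1" "a < r" "r \<le> a + 1" using pr by (simp_all add: a_def n)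
    have "ln (a / r) \<le> a / r - 1" using a by (intro ln_le_minus_one) auto
    then have "(r - a) / r \<le> ln (r / a)" using a by (simp add: ln_div field_simps)
    then have "(a + 1) * ((r - a) / r) \<le> (a + 1) * ln (r / a)" using a by (intro mult_left_mono) auto
    moreover have "r - a \<le> (a + 1) * ((r - a) / r)"
      using a mult_right_mono[of 1 "(a + 1) / r" "r - a"] by simp
    ultimately have "r - a \<le> real p * ln (r / a)" by (simp add: a_def n)
    also have "\<dots> = ln ((r / a) ^ p)" using a by (simp add: ln_realpow)
    finally have e: "exp (r - a) \<le> (r / a) ^ p" using a by (subst (asm) ln_ge_iff) auto
    have "dfact p * sqrt 2 * d \<le> dfact p * sqrt 2 * exp (r - 1)"
      using dfact_pos[of p] by (intro mult_left_mono d) auto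
    also have "exp (r - 1) = exp (real n) * exp (r - a)"
      by (simp add: a_def flip: exp_add)
    also have "dfact p * sqrt 2 * (exp (real n) * exp (r - a))
       \<le> (12 / 5 * a) ^ p * (r / a) ^ p"
      using mult_mono[OF dfact_exp_le[of n] e] a by (simp add: n a_def algebra_simps)
    also have "\<dots> = (12 / 5 * r) ^ p"
      using a by (simp only: power_mult_distrib[symmetric]) simp
    finally show ?thesis .
  qed
qed

section \<open>Convexity of powers, power means and Jensen's inequality\<close>

lemma powr_tangent:
  fixes w m s :: real
  assumes "0 \<le> w" "0 < m" "1 \<le> s"
  shows "m powr s + s * m powr (s - 1) * (w - m) \<le> w powr s"
proof -
  \<comment> \<open>Bernoulli's inequality for real exponents, read off from Young's inequality with
    x^s and 1 as the two factors.\<close>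
  have bern: "1 + s * (x - 1) \<le> x powr s" if "0 \<le> x" for x
  proof (cases "x = 0")
    case False
    have "(x powr s) powr (1 / s) * 1 powr (1 - 1 / s) \<le> 1 / s * x powr s + (1 - 1 / s) * 1"
      using assms that False by (intro Youngs_inequality_0) auto
    then have "x \<le> 1 / s * x powr s + 1 - 1 / s"
      using assms that by (simp add: powr_powr)
    then have "s * x \<le> s * (1 / s * x powr s + 1 - 1 / s)"
      using assms by (intro mult_left_mono) auto
    then show ?thesis using assms by (simp add: algebra_simps)
  qed (use assms in auto)
  have "m powr s * (1 + s * (w / m - 1)) \<le> m powr s * (w / m) powr s"
    using assms by (intro mult_left_mono bern) auto
  also have "\<dots> = w powr s" using assms by (simp add: powr_divide)
  also have "m powr s * (1 + s * (w / m - 1)) = m powr s + s * (m powr s / m) * (w - m)"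
    using assms by (simp add: field_simps)
  also have "m powr s / m = m powr (s - 1)" using assms by (simp add: powr_diff)
  finally show ?thesis .
qed

lemma powr_convex_nonneg:
  fixes x y a b s :: real
  assumes "0 \<le> x" "0 \<le> y" "0 \<le> a" "0 \<le> b" "a + b = 1" "1 \<le> s"
  shows "(a * x + b * y) powr s \<le> a * x powr s + b * y powr s"
proof (cases "a * x + b * y = 0")
  case False
  define m where "m = a * x + b * y"
  have m: "m > 0" using False assms by (simp add: m_def less_le)
  have "m powr s = a * (m powr s + s * m powr (s - 1) * (x - m)) + b * (m powr s + s * m powr (s - 1) * (y - m))"
  proof -
    have "a * (m powr s + s * m powr (s - 1) * (x - m)) + b * (m powr s + s * m powr (s - 1) * (y - m))
      = (a + b) * m powr s + s * m powr (s - 1) * (a * x + b * y - (a + b) * m)"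
      by (simp add: algebra_simps)
    then show ?thesis using assms by (simp add: m_def)
  qed
  also have "\<dots> \<le> a * x powr s + b * y powr s"
    using assms m by (intro add_mono mult_left_mono powr_tangent) auto
  finally show ?thesis by (simp add: m_def)
qed (use assms in auto)

text \<open>The tangent of the power t / s at c^s is summed. This is how bounds of even integer
  order are brought down to a real order.\<close>

lemma power_mean_sum:
  fixes u :: "'a \<Rightarrow> real"
  assumes I: "finite I" and u: "\<And>i. i \<in> I \<Longrightarrow> 0 \<le> u i" and s: "0 < s" "s \<le> t" and c: "0 \<le> c"
    and le: "(\<Sum>i\<in>I. u i powr t) \<le> real (card I) * c powr t"
  shows "(\<Sum>i\<in>I. u i powr s) \<le> real (card I) * c powr s"
proof (cases "c = 0")
  case True
  with le s have "(\<Sum>i\<in>I. u i powr t) = 0" by (intro antisym sum_nonneg) auto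
  then have "u i = 0" if "i \<in> I" for i
    using that I by (subst (asm) sum_nonneg_eq_0_iff) auto
  with True s show ?thesis by (simp cong: sum.cong)
next
  case False
  then have c: "c > 0" using c by simp
  have "(\<Sum>i\<in>I. u i powr s) * c powr (t - s) * (t / s)
     \<le> (\<Sum>i\<in>I. u i powr t + (t / s - 1) * c powr t)"
    unfolding sum_distrib_right
  proof (rule sum_mono)
    fix i assume "i \<in> I"
    have "(c powr s) powr (t / s) + (t / s) * (c powr s) powr (t / s - 1) * (u i powr s - c powr s)
      \<le> (u i powr s) powr (t / s)"
      using c s by (intro powr_tangent) auto
    moreover have "(c powr s) powr (t / s - 1) = c powr (t - s)"
      using s by (simp add: powr_powr right_diff_distrib)
    moreover have "c powr (t - s) * c powr s = c powr t" by (simp flip: powr_add)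
    ultimately show "u i powr s * c powr (t - s) * (t / s) \<le> u i powr t + (t / s - 1) * c powr t"
      using s by (simp add: powr_powr algebra_simps diff_divide_distrib add_divide_distrib)
  qed
  also have "\<dots> = (\<Sum>i\<in>I. u i powr t) + real (card I) * ((t / s - 1) * c powr t)"
    by (simp add: sum.distrib)
  also have "\<dots> \<le> real (card I) * c powr t + real (card I) * ((t / s - 1) * c powr t)"
    using le by simp
  also have "\<dots> = real (card I) * (c powr t * (t / s))" by (simp add: algebra_simps)
  also have "c powr t = c powr s * c powr (t - s)" by (simp flip: powr_add)
  finally have "(\<Sum>i\<in>I. u i powr s) * (c powr (t - s) * (t / s))
    \<le> (real (card I) * c powr s) * (c powr (t - s) * (t / s))" by (simp add: algebra_simps)
  then show ?thesis by (rule mult_right_le_imp_le) (use c s in auto)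
qed

lemma (in prob_space) jensen_powr:
  assumes f: "integrable M f" "\<And>x. x \<in> space M \<Longrightarrow> 0 \<le> f x" and s: "1 \<le> s"
  shows "ennreal ((\<integral>x. f x \<partial>M) powr s) \<le> (\<integral>\<^sup>+x. ennreal (f x powr s) \<partial>M)"
proof -
  define m where "m = (\<integral>x. f x \<partial>M)"
  have m0: "0 \<le> m" unfolding m_def using f by (intro integral_nonneg_AE) auto
  have [measurable]: "f \<in> borel_measurable M" using f by auto
  show ?thesis
  proof (cases "m = 0 \<or> (\<integral>\<^sup>+x. ennreal (f x powr s) \<partial>M) = \<infinity>")
    case False
    then have m: "m > 0" and fin: "(\<integral>\<^sup>+x. ennreal (f x powr s) \<partial>M) < \<infinity>"
      using m0 by (auto simp: less_top)
    have int: "integrable M (\<lambda>x. f x powr s)"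
      using fin by (intro integrableI_nonneg) auto
    have "m powr s = (\<integral>x. m powr s + s * m powr (s - 1) * (f x - m) \<partial>M)"
      using f by (simp add: prob_space m_def)
    also have "\<dots> \<le> (\<integral>x. f x powr s \<partial>M)"
      using f int m s by (intro integral_mono powr_tangent) auto
    finally show ?thesis
      by (subst nn_integral_eq_integral[OF int]) (auto simp: m_def)
  qed (use s in \<open>auto simp: m_def\<close>)
qed

section \<open>Real-valued bounds on moments and Minkowski's inequality\<close>

definition lp_le :: "'a measure \<Rightarrow> ('a \<Rightarrow> real) \<Rightarrow> real \<Rightarrow> real \<Rightarrow> bool" where
  "lp_le M f s c \<longleftrightarrow> (\<integral>\<^sup>+x. ennreal (f x powr s) \<partial>M) \<le> ennreal (c powr s)"

text \<open>f + g is (a + b) times the convex combination of f / a and g / b with weights a / (a +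
  b) and b / (a + b), and convexity of the power is integrated. If a or b is 0, the corresponding
  function vanishes almost everywhere.\<close>

lemma lp_le_add:
  assumes [measurable]: "f \<in> borel_measurable M" "g \<in> borel_measurable M"
    and nn: "\<And>x. x \<in> space M \<Longrightarrow> 0 \<le> f x" "\<And>x. x \<in> space M \<Longrightarrow> 0 \<le> g x" and s: "1 \<le> s"
    and ab: "0 \<le> a" "0 \<le> b"
    and f: "lp_le M f s a" and g: "lp_le M g s b"
  shows "lp_le M (\<lambda>x. f x + g x) s (a + b)"
proof -
  have zero: "AE x in M. h x = 0" if "lp_le M h s 0" "h \<in> borel_measurable M" for h
    using that s by (auto simp: lp_le_def nn_integral_0_iff_AE)
  consider "a = 0" | "b = 0" | "a > 0" "b > 0" using ab by linarith
  then show ?thesis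
  proof cases
    case 1
    with f have "AE x in M. f x = 0" using zero by auto
    then have "(\<integral>\<^sup>+x. ennreal ((f x + g x) powr s) \<partial>M) = (\<integral>\<^sup>+x. ennreal (g x powr s) \<partial>M)"
      by (intro nn_integral_cong_AE) auto
    with g 1 show ?thesis by (simp add: lp_le_def)
  next
    case 2
    with g have "AE x in M. g x = 0" using zero by auto
    then have "(\<integral>\<^sup>+x. ennreal ((f x + g x) powr s) \<partial>M) = (\<integral>\<^sup>+x. ennreal (f x powr s) \<partial>M)"
      by (intro nn_integral_cong_AE) auto
    with f 2 show ?thesis by (simp add: lp_le_def)
  next
    case 3
    define C where "C = (a + b) powr s"
    define k l where "k = C * (a / (a + b)) * (1 / a powr s)" and "l = C * (b / (a + b)) * (1 / b powr s)"
    have kl: "0 \<le> k" "0 \<le> l" using 3 by (auto simp: k_def l_def C_def)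
    have pt: "(f x + g x) powr s \<le> k * f x powr s + l * g x powr s" if "x \<in> space M" for x
    proof -
      have "(f x + g x) = (a + b) * (a / (a + b) * (f x / a) + b / (a + b) * (g x / b))"
        using 3 by (simp add: distrib_left)
      then have "(f x + g x) powr s = C * (a / (a + b) * (f x / a) + b / (a + b) * (g x / b)) powr s"
        using 3 nn[OF that] by (simp only: C_def powr_mult)
      also have "\<dots> \<le> C * (a / (a + b) * (f x / a) powr s + b / (a + b) * (g x / b) powr s)"
        using 3 nn[OF that] s
        by (intro mult_left_mono powr_convex_nonneg) (auto simp: C_def add_divide_distrib[symmetric])
      also have "\<dots> = k * f x powr s + l * g x powr s"
        using 3 nn[OF that] by (simp add: k_def l_def powr_divide algebra_simps)
      finally show ?thesis .
    qed
    have "(\<integral>\<^sup>+x. ennreal ((f x + g x) powr s) \<partial>M)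
       \<le> (\<integral>\<^sup>+x. ennreal k * ennreal (f x powr s) + ennreal l * ennreal (g x powr s) \<partial>M)"
      using kl pt by (intro nn_integral_mono) (simp flip: ennreal_mult ennreal_plus add: ennreal_leI)
    also have "\<dots> = ennreal k * (\<integral>\<^sup>+x. ennreal (f x powr s) \<partial>M) + ennreal l * (\<integral>\<^sup>+x. ennreal (g x powr s) \<partial>M)"
      by (simp add: nn_integral_add nn_integral_cmult)
    also have "\<dots> \<le> ennreal k * ennreal (a powr s) + ennreal l * ennreal (b powr s)"
      using f g by (intro add_mono mult_left_mono) (auto simp: lp_le_def)
    also have "\<dots> = ennreal (k * a powr s + l * b powr s)"
      using kl by (simp flip: ennreal_mult ennreal_plus)
    also have "k * a powr s + l * b powr s = C * ((a + b) / (a + b))"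
    proof -
      have "k * a powr s = C * (a / (a + b))" "l * b powr s = C * (b / (a + b))"
        using 3 by (simp_all add: k_def l_def)
      then show ?thesis by (simp only: add_divide_distrib distrib_left)
    qed
    also have "\<dots> = (a + b) powr s" using 3 by (simp add: C_def)
    finally show ?thesis by (simp add: lp_le_def)
  qed
qed

lemma lp_le_mono:
  assumes "lp_le M g s b" "b \<le> c" "0 \<le> b" "0 \<le> s"
    "\<And>x. x \<in> space M \<Longrightarrow> 0 \<le> f x \<and> f x \<le> g x"
  shows "lp_le M f s c"
proof -
  have "(\<integral>\<^sup>+x. ennreal (f x powr s) \<partial>M) \<le> (\<integral>\<^sup>+x. ennreal (g x powr s) \<partial>M)"
    using assms by (intro nn_integral_mono ennreal_leI powr_mono2) auto
  also have "\<dots> \<le> ennreal (b powr s)" using assms by (simp add: lp_le_def)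
  also have "\<dots> \<le> ennreal (c powr s)" using assms by (intro ennreal_leI powr_mono2) auto
  finally show ?thesis by (simp add: lp_le_def)
qed

section \<open>Khintchine bounds at real moment orders\<close>

lemma card_bool_fun: "real (card (UNIV :: ('j::finite \<Rightarrow> bool) set)) = 2 ^ CARD('j)"
  by (simp add: card_fun)

lemma powr_2_realpow: "0 \<le> x \<Longrightarrow> p \<ge> 1 \<Longrightarrow> x powr (2 * real p) = x ^ (2 * p)"
  by (cases "x = 0") (auto simp flip: powr_realpow)

lemma rad_moment:
  fixes W :: "'j::finite \<Rightarrow> complex^'n^'n"
  assumes W: "\<And>j. psd_mat (W j)" and mu: "\<And>j. spec_norm (W j) \<le> \<mu>"
    and t: "rtrace (\<Sum>j\<in>UNIV. W j) \<le> 2 * d * spec_norm (\<Sum>j\<in>UNIV. W j)"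
    and r: "1 \<le> r" and d: "0 \<le> d" "d \<le> exp (r - 1)" and q: "1 \<le> q" "q \<le> r"
  shows "(\<Sum>e\<in>UNIV. spec_norm (rad_sum W e) powr q)
    \<le> 2 ^ CARD('j) * sqrt (24 / 5 * r * \<mu> * spec_norm (\<Sum>j\<in>UNIV. W j)) powr q"
proof -
  define p where "p = nat \<lceil>r\<rceil>"
  have p: "p \<ge> 1" "r \<le> real p" using r by (simp_all add: p_def) linarith+
  have mu0: "0 \<le> \<mu>" using mu spec_norm_nonneg order_trans by blast
  let ?b = "\<mu> * spec_norm (\<Sum>j\<in>UNIV. W j)"
  have b: "0 \<le> ?b" using mu0 by simp
  define c where "c = sqrt (24 / 5 * r * \<mu> * spec_norm (\<Sum>j\<in>UNIV. W j))"
  have c2: "c\<^sup>2 = 24 / 5 * r * ?b" and c: "0 \<le> c" using mu0 r by (simp_all add: c_def)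
  \<comment> \<open>The factor 2 of the trace ratio is split: one sqrt 2 is part of
    \<open>dfact_ceiling_le\<close>, the other is absorbed by 2^p. This doubles 12/5 to
    24/5.\<close>
  have "dfact p * (2 * d) = sqrt 2 * (dfact p * sqrt 2 * d)" by simp
  also have "\<dots> \<le> 2 ^ p * (12 / 5 * r) ^ p"
  proof (intro mult_mono dfact_ceiling_le[OF r d p_def])
    show "sqrt 2 \<le> 2 ^ p" using sqrt_2_less power_increasing[OF p(1), of "2::real"] by simp
  qed (use dfact_pos[of p] d in auto)
  also have "\<dots> = (24 / 5 * r) ^ p" by (simp flip: power_mult_distrib)
  finally have dp: "dfact p * (2 * d) \<le> (24 / 5 * r) ^ p" .
  have "(\<Sum>e\<in>UNIV. spec_norm (rad_sum W e) ^ (2 * p)) \<le> 2 ^ CARD('j) * (dfact p * (2 * d) * ?b ^ p)"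
    by (rule psd_khintchine[OF W mu t p(1)])
  also have "\<dots> \<le> 2 ^ CARD('j) * ((24 / 5 * r) ^ p * ?b ^ p)"
    using dp b by (intro mult_left_mono mult_right_mono) auto
  also have "(24 / 5 * r) ^ p * ?b ^ p = c ^ (2 * p)"
    by (simp only: power_mult c2 power_mult_distrib)
  finally have "(\<Sum>e\<in>UNIV. spec_norm (rad_sum W e) powr (2 * real p))
    \<le> real (card (UNIV :: ('j \<Rightarrow> bool) set)) * c powr (2 * real p)"
    unfolding card_bool_fun powr_2_realpow[OF c p(1)] powr_2_realpow[OF spec_norm_nonneg p(1)] .
  then have "(\<Sum>e\<in>UNIV. spec_norm (rad_sum W e) powr q)
    \<le> real (card (UNIV :: ('j \<Rightarrow> bool) set)) * c powr q"
    by (rule power_mean_sum[rotated 5]) (use p q c in auto)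
  then show ?thesis unfolding card_bool_fun c_def .
qed

lemma chaos_moment_powr:
  fixes A :: "'i::finite \<Rightarrow> 'j::finite \<Rightarrow> complex^'d^'d"
  assumes A: "\<And>i j. hermitian_mat (A i j)"
    and r: "1 \<le> r" and d: "real CARD('d) \<le> exp (r - 1)" and q: "1 \<le> q" "q \<le> r"
  shows "(\<Sum>e'\<in>UNIV. \<Sum>e\<in>UNIV. spec_norm (rad_sum (\<lambda>i. rad_sum (A i) e') e) powr (2 * q))
    \<le> 2 ^ CARD('i) * 2 ^ CARD('j) * (12 / 5 * r * sqrt (spec_norm (gram A))) powr (2 * q)"
proof -
  define p where "p = nat \<lceil>r\<rceil>"
  have p: "p \<ge> 1" "r \<le> real p" using r by (simp_all add: p_def) linarith+
  define u where "u = (\<lambda>(e', e). spec_norm (rad_sum (\<lambda>i. rad_sum (A i) e') e))"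
  have sums: "(\<Sum>e'\<in>UNIV. \<Sum>e\<in>UNIV. spec_norm (rad_sum (\<lambda>i. rad_sum (A i) e') e) powr s)
     = (\<Sum>x\<in>UNIV. u x powr s)" for s
    by (simp add: u_def sum_UNIV_prod)
  let ?c = "12 / 5 * r * sqrt (spec_norm (gram A))"
  have c: "0 \<le> ?c" using r by simp
  have cardU: "real (card (UNIV :: (('j \<Rightarrow> bool) \<times> ('i \<Rightarrow> bool)) set)) = 2 ^ CARD('i) * 2 ^ CARD('j)"
    unfolding UNIV_Times_UNIV[symmetric] card_cartesian_product of_nat_mult card_bool_fun
    by (rule mult.commute)
  \<comment> \<open>The 2 shared by the two Khintchine steps gives one sqrt 2 to each; this is the
    sqrt 2 in \<open>dfact_ceiling_le\<close>.\<close>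
  have "2 * (dfact p * real CARD('d))\<^sup>2 = (dfact p * sqrt 2 * real CARD('d))\<^sup>2"
    by (simp add: power_mult_distrib)
  also have "\<dots> \<le> ((12 / 5 * r) ^ p)\<^sup>2"
    using dfact_pos[of p] by (intro power_mono dfact_ceiling_le[OF r _ d p_def]) auto
  finally have dp: "2 * (dfact p * real CARD('d))\<^sup>2 \<le> (12 / 5 * r) ^ (2 * p)"
    by (simp add: power_mult mult.commute)
  have "(\<Sum>e'\<in>UNIV. \<Sum>e\<in>UNIV. spec_norm (rad_sum (\<lambda>i. rad_sum (A i) e') e) ^ (2 * p))
    \<le> 2 ^ CARD('i) * 2 ^ CARD('j) * (2 * (dfact p * real CARD('d))\<^sup>2 * spec_norm (gram A) ^ p)"
    by (rule chaos_moment[OF A p(1)])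
  also have "\<dots> \<le> 2 ^ CARD('i) * 2 ^ CARD('j) * ((12 / 5 * r) ^ (2 * p) * spec_norm (gram A) ^ p)"
    using dp by (intro mult_left_mono mult_right_mono) auto
  also have "(12 / 5 * r) ^ (2 * p) * spec_norm (gram A) ^ p = ?c ^ (2 * p)"
    by (simp only: power_mult_distrib) (simp add: power_mult)
  finally have "(\<Sum>x\<in>UNIV. u x powr (2 * real p))
    \<le> real (card (UNIV :: (('j \<Rightarrow> bool) \<times> ('i \<Rightarrow> bool)) set)) * ?c powr (2 * real p)"
    unfolding sums[symmetric]
    unfolding cardU powr_2_realpow[OF c p(1)] powr_2_realpow[OF spec_norm_nonneg p(1)] .
  then have "(\<Sum>x\<in>UNIV. u x powr (2 * q))
    \<le> real (card (UNIV :: (('j \<Rightarrow> bool) \<times> ('i \<Rightarrow> bool)) set)) * ?c powr (2 * q)"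
    by (rule power_mean_sum[rotated 5]) (use p q c in \<open>auto simp: u_def\<close>)
  then show ?thesis unfolding sums cardU .
qed

subsection \<open>Averaging and symmetrization\<close>

text \<open>Resampling of the coordinates outside \<open>J\<close>: averaging a function of the
  sample over those coordinates is integration over \<open>y\<close>.\<close>

definition merge_on :: "'i set \<Rightarrow> ('i \<Rightarrow> 's) \<Rightarrow> ('i \<Rightarrow> 's) \<Rightarrow> 'i \<Rightarrow> 's" where
  "merge_on J x y = (\<lambda>i. if i \<in> J then x i else y i)"

abbreviation iid_prod :: "'s measure \<Rightarrow> ('i \<Rightarrow> 's) measure" where
  "iid_prod N \<equiv> PiM UNIV (\<lambda>_. N)"

lemma measurable_merge_on [measurable]:
  "(\<lambda>(x, y). merge_on J x y) \<in> iid_prod N \<Otimes>\<^sub>M iid_prod N \<rightarrow>\<^sub>M iid_prod N"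
proof -
  have "(\<lambda>z. merge_on J (fst z) (snd z)) \<in> iid_prod N \<Otimes>\<^sub>M iid_prod N \<rightarrow>\<^sub>M iid_prod N"
    unfolding merge_on_def
  proof (rule measurable_PiM_single')
    fix i
    show "(\<lambda>z. if i \<in> J then fst z i else snd z i) \<in> iid_prod N \<Otimes>\<^sub>M iid_prod N \<rightarrow>\<^sub>M N"
      by (cases "i \<in> J") auto
  qed (auto simp: space_pair_measure space_PiM PiE_iff)
  then show ?thesis by (simp add: case_prod_beta')
qed

lemma space_iid_prod: "x \<in> space (iid_prod N) \<longleftrightarrow> (\<forall>i. x i \<in> space N)"
  by (auto simp: space_PiM PiE_iff)

lemma inner_mult_integral:
  fixes W :: "'a \<Rightarrow> complex^'n^'n"
  assumes "integrable M W"
  shows "integrable M (\<lambda>x. v \<bullet> (W x *v v))" "v \<bullet> ((\<integral>x. W x \<partial>M) *v v) = (\<integral>x. v \<bullet> (W x *v v) \<partial>M)"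
proof -
  have bl: "bounded_linear (\<lambda>A. v \<bullet> (A *v v))"
    by (intro bounded_linear_compose[OF bounded_linear_inner_right] matrix_vector_mult.bounded_linear_left)
  show "integrable M (\<lambda>x. v \<bullet> (W x *v v))" by (rule integrable_bounded_linear[OF bl assms])
  show "v \<bullet> ((\<integral>x. W x \<partial>M) *v v) = (\<integral>x. v \<bullet> (W x *v v) \<partial>M)"
    by (rule integral_bounded_linear[OF bl assms, symmetric])
qed

text \<open>This also covers non-integrable \<open>W\<close>, whose Bochner integral is the positive
  semidefinite matrix 0.\<close>

lemma psd_integral:
  fixes W :: "'a \<Rightarrow> complex^'n^'n"
  assumes "\<And>x. x \<in> space M \<Longrightarrow> psd_mat (W x)"
  shows "psd_mat (\<integral>x. W x \<partial>M)"
proof (cases "integrable M W")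
  case True
  have "adj_mat (\<integral>x. W x \<partial>M) = (\<integral>x. adj_mat (W x) \<partial>M)"
    by (rule integral_bounded_linear[OF bounded_linear_adj_mat True, symmetric])
  also have "\<dots> = (\<integral>x. W x \<partial>M)"
    using assms by (intro Bochner_Integration.integral_cong) (auto simp: psd_mat_def hermitian_iff_adj)
  finally have "hermitian_mat (\<integral>x. W x \<partial>M)" by (simp add: hermitian_iff_adj)
  moreover have "0 \<le> v \<bullet> ((\<integral>x. W x \<partial>M) *v v)" for v
    unfolding inner_mult_integral[OF True] using assms by (intro integral_nonneg_AE) (auto simp: psd_mat_def)
  ultimately show ?thesis by (simp add: psd_mat_def)
qed (simp add: not_integrable_integral_eq psd_mat_def hermitian_zero)

context prob_space begin

lemma prob_space_iid_prod: "prob_space (iid_prod M)"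
  by (rule prob_space_PiM) (rule prob_space_axioms)

text \<open>The preimage of a box is a product of two boxes, one constrained on \<open>J\<close> and
  the other off \<open>J\<close>, so the measures agree on boxes.\<close>

lemma distr_merge_on:
  fixes J :: "'i::finite set"
  shows "distr (iid_prod M \<Otimes>\<^sub>M iid_prod M) (iid_prod M) (\<lambda>(x, y). merge_on J x y) = iid_prod M"
proof -
  interpret PP: prob_space "iid_prod M :: ('i \<Rightarrow> 'a) measure" by (rule prob_space_iid_prod)
  interpret P: product_prob_space "\<lambda>_::'i. M" UNIV by standard
  let ?D = "distr (iid_prod M \<Otimes>\<^sub>M iid_prod M) (iid_prod M) (\<lambda>(x, y). merge_on J x y)"
  show ?thesis
  proof (rule P.PiM_eqI)
    fix A :: "'i \<Rightarrow> 'a set" assume A: "\<And>i. i \<in> UNIV \<Longrightarrow> A i \<in> sets M"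
    define B C where "B = Pi\<^sub>E UNIV (\<lambda>i. if i \<in> J then A i else space M)"
      and "C = Pi\<^sub>E UNIV (\<lambda>i. if i \<in> J then space M else A i)"
    have sub: "A i \<subseteq> space M" for i using A sets.sets_into_space by blast
    have BC: "B \<in> sets (iid_prod M)" "C \<in> sets (iid_prod M)"
      unfolding B_def C_def using A by (auto intro!: sets_PiM_I_finite)
    have "emeasure ?D (Pi\<^sub>E UNIV A)
      = emeasure (iid_prod M \<Otimes>\<^sub>M iid_prod M) ((\<lambda>(x, y). merge_on J x y) -` Pi\<^sub>E UNIV A \<inter> space (iid_prod M \<Otimes>\<^sub>M iid_prod M))"
      using A by (intro emeasure_distr measurable_merge_on sets_PiM_I_finite) auto
    also have "(\<lambda>(x, y). merge_on J x y) -` Pi\<^sub>E UNIV A \<inter> space (iid_prod M \<Otimes>\<^sub>M iid_prod M) = B \<times> C"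
      using sub by (fastforce simp: B_def C_def merge_on_def space_pair_measure space_PiM PiE_iff split: if_splits)
    also have "emeasure (iid_prod M \<Otimes>\<^sub>M iid_prod M) (B \<times> C) = emeasure (iid_prod M) B * emeasure (iid_prod M) C"
      using BC by (rule PP.emeasure_pair_measure_Times)
    also have "emeasure (iid_prod M) B = (\<Prod>i\<in>UNIV. emeasure M (if i \<in> J then A i else space M))"
      unfolding B_def using A by (subst P.emeasure_PiM) auto
    also have "emeasure (iid_prod M) C = (\<Prod>i\<in>UNIV. emeasure M (if i \<in> J then space M else A i))"
      unfolding C_def using A by (subst P.emeasure_PiM) auto
    also have "(\<Prod>i\<in>UNIV. emeasure M (if i \<in> J then A i else space M)) *
       (\<Prod>i\<in>UNIV. emeasure M (if i \<in> J then space M else A i)) = (\<Prod>i\<in>UNIV. emeasure M (A i))"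
      unfolding prod.distrib[symmetric] by (intro prod.cong) (auto simp: emeasure_space_1)
    finally show "emeasure ?D (Pi\<^sub>E UNIV A) = (\<Prod>i\<in>UNIV. emeasure M (A i))" .
  qed auto
qed

lemma nn_integral_merge_on:
  fixes J :: "'i::finite set"
  assumes f [measurable]: "f \<in> borel_measurable (iid_prod M)"
  shows "(\<integral>\<^sup>+x. \<integral>\<^sup>+y. f (merge_on J x y) \<partial>iid_prod M \<partial>iid_prod M) = (\<integral>\<^sup>+x. f x \<partial>iid_prod M)"
proof -
  interpret PP: prob_space "iid_prod M :: ('i \<Rightarrow> 'a) measure" by (rule prob_space_iid_prod)
  have "(\<integral>\<^sup>+x. f x \<partial>iid_prod M)
    = (\<integral>\<^sup>+z. f z \<partial>distr (iid_prod M \<Otimes>\<^sub>M iid_prod M) (iid_prod M) (\<lambda>(x, y). merge_on J x y))"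
    by (simp only: distr_merge_on)
  also have "\<dots> = (\<integral>\<^sup>+z. f (case z of (x, y) \<Rightarrow> merge_on J x y) \<partial>(iid_prod M \<Otimes>\<^sub>M iid_prod M))"
    by (rule nn_integral_distr) measurable
  also have "\<dots> = (\<integral>\<^sup>+x. \<integral>\<^sup>+y. f (merge_on J x y) \<partial>iid_prod M \<partial>iid_prod M)"
    by (subst PP.nn_integral_fst[symmetric]) auto
  finally show ?thesis ..
qed

lemma integral_iid_component:
  fixes f :: "'a \<Rightarrow> 'b::{banach, second_countable_topology}" and i :: "'i::finite"
  assumes "integrable M f"
  shows "integrable (iid_prod M) (\<lambda>x. f (x i))" "(\<integral>x. f (x i) \<partial>iid_prod M) = (\<integral>y. f y \<partial>M)"
proof -
  have D: "distr (iid_prod M) M (\<lambda>x. x i) = M"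
    by (rule distr_PiM_component) (auto intro: prob_space_axioms)
  have [measurable]: "f \<in> borel_measurable M" using assms by auto
  show "integrable (iid_prod M) (\<lambda>x. f (x i))"
    using integrable_distr[of "\<lambda>x. x i" "iid_prod M" M f] assms by (simp add: D)
  have "(\<integral>y. f y \<partial>M) = (\<integral>y. f y \<partial>distr (iid_prod M) M (\<lambda>x. x i))" by (simp only: D)
  also have "\<dots> = (\<integral>x. f (x i) \<partial>iid_prod M)" by (rule integral_distr) auto
  finally show "(\<integral>x. f (x i) \<partial>iid_prod M) = (\<integral>y. f y \<partial>M)" ..
qed

lemma spec_norm_integral_le:
  fixes Z :: "'a \<Rightarrow> complex^'n^'m"
  assumes Z: "integrable M Z"
  shows "integrable M (\<lambda>x. spec_norm (Z x))" "spec_norm (\<integral>x. Z x \<partial>M) \<le> (\<integral>x. spec_norm (Z x) \<partial>M)"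
proof -
  have [measurable]: "Z \<in> borel_measurable M" using Z by auto
  show int: "integrable M (\<lambda>x. spec_norm (Z x))"
    by (rule Bochner_Integration.integrable_bound[OF Z]) (auto simp: spec_norm_le_norm)
  show "spec_norm (\<integral>x. Z x \<partial>M) \<le> (\<integral>x. spec_norm (Z x) \<partial>M)"
  proof (rule spec_norm_le)
    fix v
    have iv: "integrable M (\<lambda>x. Z x *v v)"
      by (rule integrable_bounded_linear[OF matrix_vector_mult.bounded_linear_left Z])
    have "norm ((\<integral>x. Z x \<partial>M) *v v) = norm (\<integral>x. Z x *v v \<partial>M)"
      by (simp add: integral_bounded_linear[OF matrix_vector_mult.bounded_linear_left Z])
    also have "\<dots> \<le> (\<integral>x. norm (Z x *v v) \<partial>M)" by (rule integral_norm_bound)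
    also have "\<dots> \<le> (\<integral>x. spec_norm (Z x) * norm v \<partial>M)"
      using iv int by (intro integral_mono spec_norm_mult_vec) auto
    finally show "norm ((\<integral>x. Z x \<partial>M) *v v) \<le> (\<integral>x. spec_norm (Z x) \<partial>M) * norm v" by simp
  qed
qed

lemma jensen_spec_norm:
  fixes Z :: "'a \<Rightarrow> complex^'n^'m"
  assumes Z: "integrable M Z" and s: "1 \<le> s"
  shows "ennreal (spec_norm (\<integral>x. Z x \<partial>M) powr s) \<le> (\<integral>\<^sup>+x. ennreal (spec_norm (Z x) powr s) \<partial>M)"
proof -
  have "ennreal (spec_norm (\<integral>x. Z x \<partial>M) powr s) \<le> ennreal ((\<integral>x. spec_norm (Z x) \<partial>M) powr s)"
    using s by (intro ennreal_leI powr_mono2 spec_norm_integral_le Z) auto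
  also have "\<dots> \<le> (\<integral>\<^sup>+x. ennreal (spec_norm (Z x) powr s) \<partial>M)"
    by (intro jensen_powr spec_norm_integral_le Z s) auto
  finally show ?thesis .
qed

text \<open>With the coordinates in \<open>J\<close> frozen, the left integrand is the power of the
  norm of a mean over the others. Jensen moves the mean outside, and the merged sample has the
  original law.\<close>

lemma partial_average_le:
  fixes f :: "'i::finite \<Rightarrow> 'a \<Rightarrow> complex^'n^'m"
  assumes f: "\<And>i. integrable M (f i)" and s: "1 \<le> s"
  shows "(\<integral>\<^sup>+x. ennreal (spec_norm ((\<Sum>i\<in>J. f i (x i)) + (\<Sum>i\<in>-J. \<integral>y. f i y \<partial>M)) powr s) \<partial>iid_prod M)
    \<le> (\<integral>\<^sup>+x. ennreal (spec_norm (\<Sum>i\<in>UNIV. f i (x i)) powr s) \<partial>iid_prod M)"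
proof -
  interpret PP: prob_space "iid_prod M :: ('i \<Rightarrow> 'a) measure" by (rule prob_space_iid_prod)
  have [measurable]: "f i \<in> borel_measurable M" for i using f by auto
  have eq: "(\<Sum>i\<in>UNIV. f i (merge_on J x y i)) = (\<Sum>i\<in>J. f i (x i)) + (\<Sum>i\<in>-J. f i (y i))" for x y
    by (subst sum.subset_diff[of J UNIV])
      (auto simp: merge_on_def Compl_eq_Diff_UNIV add.commute intro!: arg_cong2[where f = "(+)"] sum.cong)
  have "(\<integral>\<^sup>+x. ennreal (spec_norm ((\<Sum>i\<in>J. f i (x i)) + (\<Sum>i\<in>-J. \<integral>y. f i y \<partial>M)) powr s) \<partial>iid_prod M)
    \<le> (\<integral>\<^sup>+x. \<integral>\<^sup>+y. ennreal (spec_norm (\<Sum>i\<in>UNIV. f i (merge_on J x y i)) powr s) \<partial>iid_prod M \<partial>iid_prod M)"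
  proof (rule nn_integral_mono)
    fix x :: "'i \<Rightarrow> 'a"
    have int: "integrable (iid_prod M) (\<lambda>y. (\<Sum>i\<in>J. f i (x i)) + (\<Sum>i\<in>-J. f i (y i)))"
      by (intro Bochner_Integration.integrable_add Bochner_Integration.integrable_sum
          integral_iid_component f) auto
    have "(\<integral>y. (\<Sum>i\<in>J. f i (x i)) + (\<Sum>i\<in>-J. f i (y i)) \<partial>iid_prod M)
       = (\<Sum>i\<in>J. f i (x i)) + (\<Sum>i\<in>-J. \<integral>y. f i y \<partial>M)"
      by (simp add: integral_iid_component f PP.prob_space)
    then show "ennreal (spec_norm ((\<Sum>i\<in>J. f i (x i)) + (\<Sum>i\<in>-J. \<integral>y. f i y \<partial>M)) powr s)
      \<le> (\<integral>\<^sup>+y. ennreal (spec_norm (\<Sum>i\<in>UNIV. f i (merge_on J x y i)) powr s) \<partial>iid_prod M)"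
      using PP.jensen_spec_norm[OF int s] by (simp add: eq)
  qed
  also have "\<dots> = (\<integral>\<^sup>+x. ennreal (spec_norm (\<Sum>i\<in>UNIV. f i (x i)) powr s) \<partial>iid_prod M)"
    by (rule nn_integral_merge_on) measurable
  finally show ?thesis .
qed

text \<open>On the set \<open>J\<close> of positive signs, and likewise on its complement, the
  signed and the plain half sum agree up to one global sign. Averaging out the other half, which has
  mean zero, bounds each half by the full signed sum; the factor 2 counts the halves.\<close>

lemma symmetrization:
  fixes f :: "'i::finite \<Rightarrow> 'a \<Rightarrow> complex^'n^'m"
  assumes f: "\<And>i. integrable M (f i)" "\<And>i. (\<integral>y. f i y \<partial>M) = 0" and s: "1 \<le> s"
  shows "(\<integral>\<^sup>+x. ennreal (spec_norm (\<Sum>i\<in>UNIV. f i (x i)) powr s) \<partial>iid_prod M)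
    \<le> ennreal (2 powr s) * (\<integral>\<^sup>+x. ennreal (spec_norm (rad_sum (\<lambda>i. f i (x i)) e) powr s) \<partial>iid_prod M)"
proof -
  define J where "J = {i. e i}"
  have [measurable]: "f i \<in> borel_measurable M" for i using f by auto
  let ?R = "\<integral>\<^sup>+x. ennreal (spec_norm (rad_sum (\<lambda>i. f i (x i)) e) powr s) \<partial>iid_prod M"
  have part: "(\<integral>\<^sup>+x. ennreal (spec_norm (\<Sum>i\<in>K. f i (x i)) powr s) \<partial>iid_prod M) \<le> ?R" if "K = J \<or> K = -J" for K
  proof -
    have "(\<integral>\<^sup>+x. ennreal (spec_norm ((\<Sum>i\<in>K. sgn_of (e i) *\<^sub>R f i (x i)) + (\<Sum>i\<in>-K. \<integral>y. sgn_of (e i) *\<^sub>R f i y \<partial>M)) powr s) \<partial>iid_prod M) \<le> ?R"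
      unfolding rad_sum_def using f s by (intro partial_average_le) auto
    moreover have "spec_norm (\<Sum>i\<in>K. sgn_of (e i) *\<^sub>R f i (x i)) = spec_norm (\<Sum>i\<in>K. f i (x i))" for x
    proof -
      have "(\<Sum>i\<in>K. sgn_of (e i) *\<^sub>R f i (x i)) = (\<Sum>i\<in>K. f i (x i)) \<or>
        (\<Sum>i\<in>K. sgn_of (e i) *\<^sub>R f i (x i)) = - (\<Sum>i\<in>K. f i (x i))"
        using that by (auto simp: J_def sgn_of_def sum_negf)
      then show ?thesis by auto
    qed
    ultimately show ?thesis by (simp add: f)
  qed
  have "(\<integral>\<^sup>+x. ennreal (spec_norm (\<Sum>i\<in>UNIV. f i (x i)) powr s) \<partial>iid_prod M)
    \<le> (\<integral>\<^sup>+x. ennreal (2 powr s / 2) * ennreal (spec_norm (\<Sum>i\<in>J. f i (x i)) powr s)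
        + ennreal (2 powr s / 2) * ennreal (spec_norm (\<Sum>i\<in>-J. f i (x i)) powr s) \<partial>iid_prod M)"
  proof (rule nn_integral_mono)
    fix x :: "'i \<Rightarrow> 'a"
    let ?a = "spec_norm (\<Sum>i\<in>J. f i (x i))" and ?b = "spec_norm (\<Sum>i\<in>-J. f i (x i))"
    have "(\<Sum>i\<in>UNIV. f i (x i)) = (\<Sum>i\<in>J. f i (x i)) + (\<Sum>i\<in>-J. f i (x i))"
      by (subst sum.subset_diff[of J UNIV]) (auto simp: Compl_eq_Diff_UNIV add.commute)
    then have "spec_norm (\<Sum>i\<in>UNIV. f i (x i)) \<le> 2 * (1 / 2 * ?a + 1 / 2 * ?b)"
      using spec_norm_add by simp
    then have "spec_norm (\<Sum>i\<in>UNIV. f i (x i)) powr s \<le> (2 * (1 / 2 * ?a + 1 / 2 * ?b)) powr s"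
      using s by (intro powr_mono2) auto
    also have "\<dots> = 2 powr s * (1 / 2 * ?a + 1 / 2 * ?b) powr s" by (subst powr_mult) auto
    also have "\<dots> \<le> 2 powr s * (1 / 2 * ?a powr s + 1 / 2 * ?b powr s)"
      using s by (intro mult_left_mono powr_convex_nonneg) auto
    finally show "ennreal (spec_norm (\<Sum>i\<in>UNIV. f i (x i)) powr s)
      \<le> ennreal (2 powr s / 2) * ennreal (?a powr s) + ennreal (2 powr s / 2) * ennreal (?b powr s)"
      by (simp add: distrib_left ennreal_leI flip: ennreal_mult ennreal_plus)
  qed
  also have "\<dots> = ennreal (2 powr s / 2) * (\<integral>\<^sup>+x. ennreal (spec_norm (\<Sum>i\<in>J. f i (x i)) powr s) \<partial>iid_prod M)
      + ennreal (2 powr s / 2) * (\<integral>\<^sup>+x. ennreal (spec_norm (\<Sum>i\<in>-J. f i (x i)) powr s) \<partial>iid_prod M)"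
    by (simp add: nn_integral_add nn_integral_cmult)
  also have "\<dots> \<le> ennreal (2 powr s / 2) * ?R + ennreal (2 powr s / 2) * ?R"
    by (intro add_mono mult_left_mono part) auto
  also have "\<dots> = ennreal (2 powr s) * ?R"
    by (simp flip: distrib_right ennreal_plus)
  finally show ?thesis .
qed

text \<open>Without centring, averaging out one half leaves its mean behind. Positivity bounds that
  mean by the full mean, so each half contributes the full mean plus \<open>c\<close>.\<close>

lemma symmetrization_psd:
  fixes W :: "'i::finite \<Rightarrow> 'a \<Rightarrow> complex^'n^'n"
  assumes W: "\<And>i. integrable M (W i)" "\<And>i x. x \<in> space M \<Longrightarrow> psd_mat (W i x)" and s: "1 \<le> s" and c: "0 \<le> c"
    and e: "lp_le (iid_prod M) (\<lambda>x. spec_norm (rad_sum (\<lambda>i. W i (x i)) e)) s c"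
  shows "lp_le (iid_prod M) (\<lambda>x. spec_norm (\<Sum>i\<in>UNIV. W i (x i))) s
    (2 * spec_norm (\<Sum>i\<in>UNIV. \<integral>x. W i x \<partial>M) + 2 * c)"
proof -
  interpret PP: prob_space "iid_prod M :: ('i \<Rightarrow> 'a) measure" by (rule prob_space_iid_prod)
  define J where "J = {i. e i}"
  let ?t = "spec_norm (\<Sum>i\<in>UNIV. \<integral>x. W i x \<partial>M)"
  have [measurable]: "W i \<in> borel_measurable M" for i using W by auto
  have EW: "psd_mat (\<integral>x. W i x \<partial>M)" for i
    using W by (intro psd_integral) auto
  have part: "lp_le (iid_prod M) (\<lambda>x. spec_norm (\<Sum>i\<in>K. W i (x i))) s (?t + c)" if K: "K = J \<or> K = -J" for K
  proof (rule lp_le_mono)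
    let ?m = "\<Sum>i\<in>-K. \<integral>x. W i x \<partial>M"
    let ?g = "\<lambda>x. spec_norm ((\<Sum>i\<in>K. W i (x i)) - ?m)"
    \<comment> \<open>The mean of the omitted half lies below the full mean in the positive
      semidefinite order.\<close>
    have mt: "spec_norm ?m \<le> ?t"
    proof (rule psd_spec_norm_mono)
      show "psd_mat ?m" by (intro psd_sum EW)
      fix v
      have "(\<Sum>i\<in>-K. v \<bullet> ((\<integral>x. W i x \<partial>M) *v v)) \<le> (\<Sum>i\<in>UNIV. v \<bullet> ((\<integral>x. W i x \<partial>M) *v v))"
        using EW by (intro sum_mono2) (auto simp: psd_mat_def)
      then show "v \<bullet> (?m *v v) \<le> v \<bullet> ((\<Sum>i\<in>UNIV. \<integral>x. W i x \<partial>M) *v v)"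
        by (simp add: matrix_vector_mult.sum_left inner_sum_right)
    qed
    have "lp_le (iid_prod M) (\<lambda>x :: 'i \<Rightarrow> 'a. ?t) s ?t"
      by (simp add: lp_le_def PP.emeasure_space_1)
    moreover have "lp_le (iid_prod M) ?g s c"
    proof -
      have "(\<integral>\<^sup>+x. ennreal (spec_norm ((\<Sum>i\<in>K. sgn_of (e i) *\<^sub>R W i (x i)) + (\<Sum>i\<in>-K. \<integral>y. sgn_of (e i) *\<^sub>R W i y \<partial>M)) powr s) \<partial>iid_prod M)
        \<le> (\<integral>\<^sup>+x. ennreal (spec_norm (rad_sum (\<lambda>i. W i (x i)) e) powr s) \<partial>iid_prod M)"
        unfolding rad_sum_def using W s by (intro partial_average_le) auto
      also have "\<dots> \<le> ennreal (c powr s)" using e by (simp add: lp_le_def)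
      finally have le: "(\<integral>\<^sup>+x. ennreal (spec_norm ((\<Sum>i\<in>K. sgn_of (e i) *\<^sub>R W i (x i)) + (\<Sum>i\<in>-K. \<integral>y. sgn_of (e i) *\<^sub>R W i y \<partial>M)) powr s) \<partial>iid_prod M)
        \<le> ennreal (c powr s)" .
      \<comment> \<open>Signs agree inside K and are opposite outside it, so the expression is the
        difference in \<open>?g\<close> up to a global sign.\<close>
      have "spec_norm ((\<Sum>i\<in>K. sgn_of (e i) *\<^sub>R W i (x i)) + (\<Sum>i\<in>-K. \<integral>y. sgn_of (e i) *\<^sub>R W i y \<partial>M)) = ?g x" for x
      proof -
        have "(\<Sum>i\<in>K. sgn_of (e i) *\<^sub>R W i (x i)) + (\<Sum>i\<in>-K. \<integral>y. sgn_of (e i) *\<^sub>R W i y \<partial>M) = (\<Sum>i\<in>K. W i (x i)) - ?m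
          \<or> (\<Sum>i\<in>K. sgn_of (e i) *\<^sub>R W i (x i)) + (\<Sum>i\<in>-K. \<integral>y. sgn_of (e i) *\<^sub>R W i y \<partial>M) = - ((\<Sum>i\<in>K. W i (x i)) - ?m)"
          using K by (auto simp: J_def sgn_of_def sum_negf)
        then show ?thesis by (elim disjE) (simp_all only: spec_norm_minus)
      qed
      with le show ?thesis by (simp add: lp_le_def)
    qed
    ultimately show "lp_le (iid_prod M) (\<lambda>x. ?t + ?g x) s (?t + c)"
      using s c by (intro lp_le_add) auto
    fix x
    show "0 \<le> spec_norm (\<Sum>i\<in>K. W i (x i)) \<and> spec_norm (\<Sum>i\<in>K. W i (x i)) \<le> ?t + ?g x"
      using mt spec_norm_add[of "(\<Sum>i\<in>K. W i (x i)) - ?m" ?m] by simp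
  qed (use s c in auto)
  show ?thesis
  proof (rule lp_le_mono)
    show "lp_le (iid_prod M) (\<lambda>x. spec_norm (\<Sum>i\<in>J. W i (x i)) + spec_norm (\<Sum>i\<in>-J. W i (x i))) s ((?t + c) + (?t + c))"
      by (intro lp_le_add part) (use s c in auto)
    fix x
    have "(\<Sum>i\<in>UNIV. W i (x i)) = (\<Sum>i\<in>J. W i (x i)) + (\<Sum>i\<in>-J. W i (x i))"
      by (subst sum.subset_diff[of J UNIV]) (auto simp: Compl_eq_Diff_UNIV add.commute)
    then show "0 \<le> spec_norm (\<Sum>i\<in>UNIV. W i (x i)) \<and> spec_norm (\<Sum>i\<in>UNIV. W i (x i)) \<le>
       spec_norm (\<Sum>i\<in>J. W i (x i)) + spec_norm (\<Sum>i\<in>-J. W i (x i))"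
      using spec_norm_add by simp
  qed (use s c in auto)
qed

end

subsection \<open>Sums of independent positive semidefinite matrices\<close>

text \<open>The minimal term is at most the average. This selects one good sign vector, also when
  \<open>B\<close> is infinite.\<close>

lemma exists_le_of_sum_le:
  fixes F :: "'a \<Rightarrow> ennreal"
  assumes "finite I" "I \<noteq> {}" "(\<Sum>i\<in>I. F i) \<le> of_nat (card I) * B"
  shows "\<exists>i\<in>I. F i \<le> B"
proof -
  obtain k where k: "k \<in> I" "\<And>i. i \<in> I \<Longrightarrow> F k \<le> F i"
    using assms(1,2) by (metis arg_min_if_finite(1) arg_min_least)
  have "of_nat (card I) * F k = (\<Sum>i\<in>I. F k)" by simp
  also have "\<dots> \<le> (\<Sum>i\<in>I. F i)" by (intro sum_mono k)
  also have "\<dots> \<le> of_nat (card I) * B" by fact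
  finally have "F k \<le> B"
    using assms(1,2) by (subst (asm) ennreal_mult_le_mult_iff) auto
  with k show ?thesis by blast
qed

lemma ennreal_power2_le_imp_le:
  assumes "a\<^sup>2 \<le> (ennreal b)\<^sup>2" "0 \<le> b" shows "a \<le> ennreal b"
proof (cases a)
  case (real l)
  have "l\<^sup>2 \<le> b\<^sup>2" using assms real by (simp add: ennreal_power)
  then have "l \<le> b" using assms(2) by (rule power2_le_imp_le)
  then show ?thesis using real by (simp add: ennreal_leI)
qed (use assms in \<open>auto simp: ennreal_power top_unique power2_eq_square ennreal_mult_eq_top_iff\<close>)

lemma quadratic_le_imp_le:
  fixes z a b :: real
  assumes "z\<^sup>2 \<le> a + b * z" "0 \<le> a" "0 \<le> b" "0 \<le> z"
  shows "z \<le> sqrt a + b"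
proof (rule ccontr)
  assume "\<not> z \<le> sqrt a + b"
  then have lt: "sqrt a + b < z" by simp
  then have za: "sqrt a < z" using assms by linarith
  have "a + b * z \<le> sqrt a * z + b * z"
    using za assms mult_left_mono[of "sqrt a" z "sqrt a"] by simp
  also have "\<dots> = (sqrt a + b) * z" by (simp add: algebra_simps)
  also have "\<dots> < z * z" using lt za assms by (intro mult_strict_right_mono) (auto intro: le_less_trans[of 0 "sqrt a"])
  finally show False using assms by (simp add: power2_eq_square)
qed

text \<open>A quadratic inequality for a moment says nothing if the moment is infinite; the crude
  bound by \<open>n\<close> times the largest summand excludes that case beforehand.\<close>

lemma finite_max_moment:
  fixes T \<mu> :: "'b \<Rightarrow> real"
  assumes "\<And>x. x \<in> space M \<Longrightarrow> 0 \<le> T x \<and> T x \<le> real n * \<mu> x" "0 \<le> q"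
    "\<And>x. x \<in> space M \<Longrightarrow> 0 \<le> \<mu> x" "\<mu> \<in> borel_measurable M"
    "(\<integral>\<^sup>+x. ennreal (\<mu> x powr q) \<partial>M) < \<infinity>"
  shows "(\<integral>\<^sup>+x. ennreal (T x powr q) \<partial>M) < \<infinity>"
proof -
  have "(\<integral>\<^sup>+x. ennreal (T x powr q) \<partial>M) \<le> (\<integral>\<^sup>+x. ennreal (real n powr q) * ennreal (\<mu> x powr q) \<partial>M)"
  proof (rule nn_integral_mono)
    fix x assume x: "x \<in> space M"
    have "T x powr q \<le> (real n * \<mu> x) powr q" using assms x by (intro powr_mono2) auto
    then show "ennreal (T x powr q) \<le> ennreal (real n powr q) * ennreal (\<mu> x powr q)"
      using assms(3)[OF x] by (simp add: powr_mult ennreal_leI flip: ennreal_mult)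
  qed
  also have "\<dots> = ennreal (real n powr q) * (\<integral>\<^sup>+x. ennreal (\<mu> x powr q) \<partial>M)"
    using assms(4) by (intro nn_integral_cmult) auto
  also have "\<dots> < \<infinity>" using assms(5) by (simp add: ennreal_mult_less_top)
  finally show ?thesis .
qed

context prob_space begin

text \<open>Khintchine bounds the signed sum by the root of r \<mu> T up to a constant, where T is
  the norm of the whole sum. The moment of T thus occurs on both sides, and solving the resulting
  quadratic inequality isolates it. Hypothesis \<open>tr\<close> makes \<open>d\<close> the
  effective dimension, whatever the size of the matrices.\<close>

lemma psd_sum_moment:
  fixes W :: "'i::finite \<Rightarrow> 'a \<Rightarrow> complex^'n^'n"
  assumes W: "\<And>i. integrable M (W i)" "\<And>i x. x \<in> space M \<Longrightarrow> psd_mat (W i x)"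
    and tr: "\<And>x. x \<in> space (iid_prod M) \<Longrightarrow>
      rtrace (\<Sum>i\<in>UNIV. W i (x i)) \<le> 2 * d * spec_norm (\<Sum>i\<in>UNIV. W i (x i))"
    and mu [measurable]: "\<mu> \<in> borel_measurable (iid_prod M)"
    and mu_ge: "\<And>i x. x \<in> space (iid_prod M) \<Longrightarrow> spec_norm (W i (x i)) \<le> \<mu> x"
    and r: "1 \<le> r" and d: "0 \<le> d" "d \<le> exp (r - 1)" and q: "1 \<le> q" "q \<le> r"
    and al: "0 \<le> \<alpha>" "(\<integral>\<^sup>+x. ennreal (\<mu> x powr q) \<partial>iid_prod M) \<le> ennreal (\<alpha> powr (2 * q))"
  shows "(\<integral>\<^sup>+x. ennreal (spec_norm (\<Sum>i\<in>UNIV. W i (x i)) powr q) \<partial>iid_prod M)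
    \<le> ennreal ((sqrt (2 * spec_norm (\<Sum>i\<in>UNIV. \<integral>x. W i x \<partial>M)) + 2 * sqrt (24 / 5 * r) * \<alpha>) powr (2 * q))"
proof -
  have [measurable]: "W i \<in> borel_measurable M" for i using W by auto
  let ?T = "\<lambda>x. spec_norm (\<Sum>i\<in>UNIV. W i (x i))"
  let ?I = "\<integral>\<^sup>+x. ennreal (?T x powr q) \<partial>iid_prod M"
  let ?t = "spec_norm (\<Sum>i\<in>UNIV. \<integral>x. W i x \<partial>M)"
  define k where "k = sqrt (24 / 5 * r)"
  have k0: "0 \<le> k" using r by (simp add: k_def)
  have mu0: "0 \<le> \<mu> x" if "x \<in> space (iid_prod M)" for x
    using mu_ge[OF that] spec_norm_nonneg order_trans by blast
  have "?I < \<infinity>"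
  proof (rule finite_max_moment[OF _ _ mu0 mu])
    show "(\<integral>\<^sup>+x. ennreal (\<mu> x powr q) \<partial>iid_prod M) < \<infinity>"
      using al(2) by (auto intro: le_less_trans)
    fix x :: "'i \<Rightarrow> 'a" assume x: "x \<in> space (iid_prod M)"
    have "?T x \<le> (\<Sum>i\<in>(UNIV::'i set). \<mu> x)"
      by (intro order_trans[OF spec_norm_sum] sum_mono mu_ge x)
    then show "0 \<le> ?T x \<and> ?T x \<le> real CARD('i) * \<mu> x" by simp
  qed (use q in auto)
  \<comment> \<open>\<open>z\<close> is the L^(2q) norm of the square root of T, the scale on which
    the inequality is quadratic.\<close>
  define z where "z = enn2real ?I powr (1 / (2 * q))"
  have z0: "0 \<le> z" by (simp add: z_def)
  have I: "?I = ennreal (z powr (2 * q))"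
    using \<open>?I < \<infinity>\<close> q by (simp add: z_def powr_powr less_top)
  \<comment> \<open>Cauchy-Schwarz separates the maximal summand from T, which need not be
    independent.\<close>
  have CS: "(\<integral>\<^sup>+x. ennreal (\<mu> x powr (q / 2)) * ennreal (?T x powr (q / 2)) \<partial>iid_prod M)
     \<le> ennreal ((\<alpha> * z) powr q)" (is "?L \<le> _")
  proof -
    have sq: "ennreal (w powr (q / 2)) ^ 2 = ennreal (w powr q)" for w :: real
      by (simp add: power2_eq_square flip: ennreal_mult powr_add)
    have "?L\<^sup>2 \<le> (\<integral>\<^sup>+x. ennreal (\<mu> x powr (q / 2)) ^ 2 \<partial>iid_prod M) * (\<integral>\<^sup>+x. ennreal (?T x powr (q / 2)) ^ 2 \<partial>iid_prod M)"
      by (rule Cauchy_Schwarz_nn_integral) measurable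
    also have "\<dots> \<le> ennreal (\<alpha> powr (2 * q)) * ennreal (z powr (2 * q))"
      unfolding sq I by (intro mult_mono al(2) order_refl) auto
    also have "\<dots> = (ennreal ((\<alpha> * z) powr q))\<^sup>2"
    proof -
      have "w powr (2 * q) = w powr q * w powr q" for w :: real by (simp flip: powr_add)
      then have "\<alpha> powr (2 * q) * z powr (2 * q) = (\<alpha> * z) powr q * (\<alpha> * z) powr q"
        using al(1) z0 by (simp add: powr_mult)
      then show ?thesis unfolding power2_eq_square by (simp flip: ennreal_mult)
    qed
    finally show ?thesis by (rule ennreal_power2_le_imp_le) simp
  qed
  have "(\<Sum>e\<in>UNIV. \<integral>\<^sup>+x. ennreal (spec_norm (rad_sum (\<lambda>i. W i (x i)) e) powr q) \<partial>iid_prod M)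
    = (\<integral>\<^sup>+x. (\<Sum>e\<in>UNIV. ennreal (spec_norm (rad_sum (\<lambda>i. W i (x i)) e) powr q)) \<partial>iid_prod M)"
    unfolding rad_sum_def by (rule nn_integral_sum[symmetric]) measurable
  also have "\<dots> \<le> (\<integral>\<^sup>+x. ennreal (2 ^ CARD('i) * k powr q) * (ennreal (\<mu> x powr (q / 2)) * ennreal (?T x powr (q / 2))) \<partial>iid_prod M)"
  proof (rule nn_integral_mono)
    fix x :: "'i \<Rightarrow> 'a" assume x: "x \<in> space (iid_prod M)"
    have "(\<Sum>e\<in>UNIV. spec_norm (rad_sum (\<lambda>i. W i (x i)) e) powr q)
      \<le> 2 ^ CARD('i) * sqrt (24 / 5 * r * \<mu> x * ?T x) powr q"
      using x by (intro rad_moment[OF _ mu_ge[OF x] tr[OF x] r d q] W(2)) (simp add: space_iid_prod)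
    also have "sqrt (24 / 5 * r * \<mu> x * ?T x) powr q = k powr q * (\<mu> x powr (q / 2) * ?T x powr (q / 2))"
    proof -
      have "sqrt (24 / 5 * r * \<mu> x * ?T x) = k * (sqrt (\<mu> x) * sqrt (?T x))"
        by (simp only: k_def real_sqrt_mult mult.assoc)
      then show ?thesis
        using mu0[OF x] k0 by (simp add: powr_mult powr_half_sqrt[symmetric] powr_powr)
    qed
    finally show "(\<Sum>e\<in>UNIV. ennreal (spec_norm (rad_sum (\<lambda>i. W i (x i)) e) powr q))
      \<le> ennreal (2 ^ CARD('i) * k powr q) * (ennreal (\<mu> x powr (q / 2)) * ennreal (?T x powr (q / 2)))"
      by (subst sum_ennreal) (auto simp: mult.assoc ennreal_leI simp flip: ennreal_mult)
  qed
  also have "\<dots> = ennreal (2 ^ CARD('i) * k powr q) * ?L"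
    by (rule nn_integral_cmult) measurable
  also have "\<dots> \<le> ennreal (2 ^ CARD('i) * k powr q) * ennreal ((\<alpha> * z) powr q)"
    by (intro mult_left_mono CS) auto
  also have "\<dots> = of_nat (card (UNIV :: ('i \<Rightarrow> bool) set)) * ennreal ((k * \<alpha> * z) powr q)"
  proof -
    have "of_nat (card (UNIV :: ('i \<Rightarrow> bool) set)) = ennreal (2 ^ CARD('i))"
      by (simp add: card_bool_fun[symmetric] ennreal_of_nat_eq_real_of_nat)
    then show ?thesis using k0 al z0 by (simp add: powr_mult mult.assoc flip: ennreal_mult)
  qed
  finally obtain e where "(\<integral>\<^sup>+x. ennreal (spec_norm (rad_sum (\<lambda>i. W i (x i)) e) powr q) \<partial>iid_prod M)
      \<le> ennreal ((k * \<alpha> * z) powr q)"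
    using exists_le_of_sum_le[of UNIV "\<lambda>e. \<integral>\<^sup>+x. ennreal (spec_norm (rad_sum (\<lambda>i. W i (x i)) e) powr q) \<partial>iid_prod M"]
    by fastforce
  then have "lp_le (iid_prod M) (\<lambda>x. spec_norm (rad_sum (\<lambda>i. W i (x i)) e)) q (k * \<alpha> * z)"
    by (simp add: lp_le_def)
  from symmetrization_psd[OF W q(1) _ this]
  have "lp_le (iid_prod M) ?T q (2 * ?t + 2 * (k * \<alpha> * z))"
    using k0 al z0 by simp
  then have "z powr (2 * q) \<le> (2 * ?t + 2 * (k * \<alpha> * z)) powr q"
    by (simp add: lp_le_def I)
  also have "z powr (2 * q) = (z\<^sup>2) powr q"
    using z0 by (simp add: power2_eq_square powr_mult flip: powr_add)
  finally have le: "(z\<^sup>2) powr q \<le> (2 * ?t + 2 * (k * \<alpha> * z)) powr q" .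
  have "0 \<le> 2 * ?t + 2 * (k * \<alpha> * z)" using k0 al(1) z0 by simp
  with le powr_less_mono2[of q "2 * ?t + 2 * (k * \<alpha> * z)" "z\<^sup>2"] q
  have "z\<^sup>2 \<le> 2 * ?t + 2 * (k * \<alpha> * z)" by linarith
  then have "z \<le> sqrt (2 * ?t) + 2 * k * \<alpha>"
    using k0 al z0 by (intro quadratic_le_imp_le) (auto simp: algebra_simps)
  then have "z powr (2 * q) \<le> (sqrt (2 * ?t) + 2 * k * \<alpha>) powr (2 * q)"
    using z0 q by (intro powr_mono2) auto
  then show ?thesis unfolding I k_def by (rule ennreal_leI)
qed

end

subsection \<open>Decoupling\<close>

lemma mean_powr_le:
  fixes u :: "'a \<Rightarrow> real"
  assumes "finite I" "I \<noteq> {}" "\<And>i. i \<in> I \<Longrightarrow> 0 \<le> u i" "1 \<le> s"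
  shows "((\<Sum>i\<in>I. u i) / card I) powr s \<le> (\<Sum>i\<in>I. u i powr s) / card I"
proof -
  define A where "A = (\<Sum>i\<in>I. u i powr s) / card I"
  have n: "real (card I) > 0" using assms by (simp add: card_gt_0_iff)
  have A: "0 \<le> A" by (auto simp: A_def intro!: divide_nonneg_nonneg sum_nonneg)
  have cA: "(A powr (1 / s)) powr s = A" using A assms by (simp add: powr_powr)
  have "(\<Sum>i\<in>I. u i powr s) \<le> card I * (A powr (1 / s)) powr s"
    unfolding cA using n by (simp add: A_def)
  then have "(\<Sum>i\<in>I. u i powr 1) \<le> card I * (A powr (1 / s)) powr 1"
    by (rule power_mean_sum[rotated 5]) (use assms in auto)
  then have "(\<Sum>i\<in>I. u i) / card I \<le> A powr (1 / s)"
    using n assms by (simp add: field_simps)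
  then have "((\<Sum>i\<in>I. u i) / card I) powr s \<le> (A powr (1 / s)) powr s"
    using assms by (intro powr_mono2 divide_nonneg_nonneg sum_nonneg) auto
  then show ?thesis unfolding cA by (simp add: A_def)
qed

text \<open>Flipping the value at \<open>i\<close> or at \<open>j\<close> permutes all subsets, so
  the four membership patterns of two distinct points are equally frequent.\<close>

lemma sum_indicator_split:
  fixes i j :: "'i::finite"
  assumes "i \<noteq> j"
  shows "(\<Sum>e\<in>(UNIV :: ('i \<Rightarrow> bool) set). if e i \<and> \<not> e j then 1 else 0) = (2 ^ CARD('i) / 4 :: real)"
proof -
  define F where "F a b = (\<Sum>e\<in>(UNIV :: ('i \<Rightarrow> bool) set). if e i = a \<and> e j = b then 1 else 0 :: real)" for a b
  have "F a b = F (\<not> a) b" "F a b = F a (\<not> b)" for a b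
    unfolding F_def
    by (subst sum_flip[symmetric, of _ i], rule sum.cong, use assms in \<open>auto simp: flip_def\<close>)
      (subst sum_flip[symmetric, of _ j], rule sum.cong, use assms in \<open>auto simp: flip_def\<close>)
  then have eq: "F True True = F True False" "F False True = F True False" "F False False = F True False"
    by (metis (full_types))+
  have "2 ^ CARD('i) = (\<Sum>e\<in>(UNIV :: ('i \<Rightarrow> bool) set). 1 :: real)"
    using card_bool_fun[where 'j = 'i] by simp
  also have "\<dots> = F True True + F True False + F False True + F False False"
    unfolding F_def sum.distrib[symmetric] by (rule sum.cong) auto
  finally have "F True False = 2 ^ CARD('i) / 4" using eq by simp
  then show ?thesis by (simp add: F_def)
qed

text \<open>A random set separates an ordered pair of distinct points with probability 1/4, whence
  the 4; it never separates a point from itself, so the diagonal has to vanish.\<close>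

lemma sum_if_split:
  fixes h :: "'i::finite \<Rightarrow> 'i \<Rightarrow> 'b::real_vector"
  assumes "\<And>i. h i i = 0"
  shows "(\<Sum>i\<in>UNIV. \<Sum>j\<in>UNIV. h i j)
    = (4 / 2 ^ CARD('i)) *\<^sub>R (\<Sum>e\<in>UNIV. \<Sum>i\<in>{i. e i}. \<Sum>j\<in>-{i. e i}. h i j)"
proof -
  have "(\<Sum>i\<in>{i. e i}. \<Sum>j\<in>-{i. e i}. h i j)
     = (\<Sum>i\<in>UNIV. \<Sum>j\<in>UNIV. (if e i \<and> \<not> e j then 1 else 0 :: real) *\<^sub>R h i j)" for e :: "'i \<Rightarrow> bool"
    by (intro sum.mono_neutral_cong_left sum.mono_neutral_cong_left[of _ "- {i. e i}"]) auto
  then have "(\<Sum>e\<in>UNIV. \<Sum>i\<in>{i. e i}. \<Sum>j\<in>-{i. e i}. h i j)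
    = (\<Sum>e\<in>(UNIV :: ('i \<Rightarrow> bool) set). \<Sum>i\<in>UNIV. \<Sum>j\<in>UNIV. (if e i \<and> \<not> e j then 1 else 0 :: real) *\<^sub>R h i j)"
    by simp
  also have "\<dots> = (\<Sum>i\<in>UNIV. \<Sum>e\<in>(UNIV :: ('i \<Rightarrow> bool) set). \<Sum>j\<in>UNIV. (if e i \<and> \<not> e j then 1 else 0 :: real) *\<^sub>R h i j)"
    by (rule sum.swap)
  also have "\<dots> = (\<Sum>i\<in>UNIV. \<Sum>j\<in>UNIV. \<Sum>e\<in>(UNIV :: ('i \<Rightarrow> bool) set). (if e i \<and> \<not> e j then 1 else 0 :: real) *\<^sub>R h i j)"
    by (intro sum.cong refl sum.swap)
  also have "\<dots> = (\<Sum>i\<in>UNIV. \<Sum>j\<in>UNIV. (2 ^ CARD('i) / 4) *\<^sub>R h i j)"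
  proof (intro sum.cong refl)
    fix i j
    show "(\<Sum>e\<in>(UNIV :: ('i \<Rightarrow> bool) set). (if e i \<and> \<not> e j then 1 else 0 :: real) *\<^sub>R h i j) = (2 ^ CARD('i) / 4) *\<^sub>R h i j"
      unfolding scaleR_left.sum[symmetric]
    proof (cases "i = j")
      case True
      then show "(\<Sum>e\<in>(UNIV :: ('i \<Rightarrow> bool) set). if e i \<and> \<not> e j then 1 else 0) *\<^sub>R h i j = (2 ^ CARD('i) / 4) *\<^sub>R h i j"
        using assms[of i] by simp
    qed (subst sum_indicator_split, auto)
  qed
  finally show ?thesis
    by (simp add: scaleR_right.sum)
qed

text \<open>\<open>M\<close> is the law of one observation. Extending the kernel by zero to the
  diagonal turns off-diagonal sums into full double sums. Degeneracy in the first argument follows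
  from \<open>sym\<close>.\<close>

locale degenerate_kernel = prob_space M for M :: "'a measure" +
  fixes h :: "'i::finite \<Rightarrow> 'i \<Rightarrow> 'a \<Rightarrow> 'a \<Rightarrow> complex^'d^'d"
  assumes measurable_kernel: "\<And>i j. (\<lambda>(x, y). h i j x y) \<in> borel_measurable (M \<Otimes>\<^sub>M M)"
    and herm: "\<And>i j x y. x \<in> space M \<Longrightarrow> y \<in> space M \<Longrightarrow> hermitian_mat (h i j x y)"
    and sym: "\<And>i j x y. x \<in> space M \<Longrightarrow> y \<in> space M \<Longrightarrow> h i j x y = h j i y x"
    and diag: "\<And>i x y. h i i x y = 0"
    and integrable_right: "\<And>i j x. x \<in> space M \<Longrightarrow> integrable M (\<lambda>y. h i j x y)"
    and mean_right: "\<And>i j x. x \<in> space M \<Longrightarrow> (\<integral>y. h i j x y \<partial>M) = 0"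
begin

abbreviation PM :: "('i \<Rightarrow> 'a) measure" where
  "PM \<equiv> iid_prod M"

sublocale P: prob_space PM
  by (rule prob_space_iid_prod)

sublocale PP: pair_sigma_finite PM PM ..

lemma measurable_h [measurable (raw)]:
  assumes [measurable]: "f \<in> L \<rightarrow>\<^sub>M M" "g \<in> L \<rightarrow>\<^sub>M M"
  shows "(\<lambda>w. h i j (f w) (g w)) \<in> borel_measurable L"
  using measurable_compose[OF measurable_Pair[OF assms] measurable_kernel[of i j]] by simp

lemma integrable_left: "y \<in> space M \<Longrightarrow> integrable M (\<lambda>x. h i j x y)"
  using integrable_right[of y j i] by (subst Bochner_Integration.integrable_cong[OF refl sym]) auto

lemma mean_left: "y \<in> space M \<Longrightarrow> (\<integral>x. h i j x y \<partial>M) = 0"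
  using mean_right[of y j i] by (subst Bochner_Integration.integral_cong[OF refl sym]) auto

text \<open>The coordinates in \<open>J\<close> and those outside are independent, so two
  independent samples may supply them. The index sets are then enlarged to all indices, one argument
  at a time: the added terms have conditional mean zero, and averaging them out does not increase
  moments.\<close>

lemma decoupling_part:
  assumes s: "1 \<le> s"
  shows "(\<integral>\<^sup>+x. ennreal (spec_norm (\<Sum>i\<in>J. \<Sum>j\<in>-J. h i j (x i) (x j)) powr s) \<partial>PM)
    \<le> (\<integral>\<^sup>+x. \<integral>\<^sup>+y. ennreal (spec_norm (\<Sum>i\<in>UNIV. \<Sum>j\<in>UNIV. h i j (x i) (y j)) powr s) \<partial>PM \<partial>PM)"
proof -
  have "(\<integral>\<^sup>+x. ennreal (spec_norm (\<Sum>i\<in>J. \<Sum>j\<in>-J. h i j (x i) (x j)) powr s) \<partial>PM)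
     = (\<integral>\<^sup>+x. \<integral>\<^sup>+y. ennreal (spec_norm (\<Sum>i\<in>J. \<Sum>j\<in>-J. h i j (merge_on J x y i) (merge_on J x y j)) powr s) \<partial>PM \<partial>PM)"
    by (rule nn_integral_merge_on[symmetric]) measurable
  \<comment> \<open>On J x -J the merged sample takes its first argument from \<open>x\<close> and
    its second from \<open>y\<close>.\<close>
  also have "\<dots> = (\<integral>\<^sup>+x. \<integral>\<^sup>+y. ennreal (spec_norm (\<Sum>j\<in>-J. \<Sum>i\<in>J. h i j (x i) (y j)) powr s) \<partial>PM \<partial>PM)"
    by (subst sum.swap) (simp add: merge_on_def)
  also have "\<dots> \<le> (\<integral>\<^sup>+x. \<integral>\<^sup>+y. ennreal (spec_norm (\<Sum>j\<in>UNIV. \<Sum>i\<in>J. h i j (x i) (y j)) powr s) \<partial>PM \<partial>PM)"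
  proof (rule nn_integral_mono)
    fix x :: "'i \<Rightarrow> 'a" assume "x \<in> space PM"
    then have x: "\<And>i. x i \<in> space M" by (simp add: space_iid_prod)
    show "(\<integral>\<^sup>+y. ennreal (spec_norm (\<Sum>j\<in>-J. \<Sum>i\<in>J. h i j (x i) (y j)) powr s) \<partial>PM)
      \<le> (\<integral>\<^sup>+y. ennreal (spec_norm (\<Sum>j\<in>UNIV. \<Sum>i\<in>J. h i j (x i) (y j)) powr s) \<partial>PM)"
      using partial_average_le[of "\<lambda>j y. \<Sum>i\<in>J. h i j (x i) y" s "-J"] s x
      by (simp add: integrable_right mean_right)
  qed
  also have "\<dots> = (\<integral>\<^sup>+y. \<integral>\<^sup>+x. ennreal (spec_norm (\<Sum>i\<in>J. \<Sum>j\<in>UNIV. h i j (x i) (y j)) powr s) \<partial>PM \<partial>PM)"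
    by (subst sum.swap) (rule PP.Fubini', measurable)
  also have "\<dots> \<le> (\<integral>\<^sup>+y. \<integral>\<^sup>+x. ennreal (spec_norm (\<Sum>i\<in>UNIV. \<Sum>j\<in>UNIV. h i j (x i) (y j)) powr s) \<partial>PM \<partial>PM)"
  proof (rule nn_integral_mono)
    fix y :: "'i \<Rightarrow> 'a" assume "y \<in> space PM"
    then have y: "\<And>i. y i \<in> space M" by (simp add: space_iid_prod)
    show "(\<integral>\<^sup>+x. ennreal (spec_norm (\<Sum>i\<in>J. \<Sum>j\<in>UNIV. h i j (x i) (y j)) powr s) \<partial>PM)
      \<le> (\<integral>\<^sup>+x. ennreal (spec_norm (\<Sum>i\<in>UNIV. \<Sum>j\<in>UNIV. h i j (x i) (y j)) powr s) \<partial>PM)"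
      using partial_average_le[of "\<lambda>i x. \<Sum>j\<in>UNIV. h i j x (y j)" s J] s y
      by (simp add: integrable_left mean_left)
  qed
  also have "\<dots> = (\<integral>\<^sup>+x. \<integral>\<^sup>+y. ennreal (spec_norm (\<Sum>i\<in>UNIV. \<Sum>j\<in>UNIV. h i j (x i) (y j)) powr s) \<partial>PM \<partial>PM)"
    by (rule PP.Fubini') measurable
  finally show ?thesis .
qed

lemma decoupling:
  assumes s: "1 \<le> s"
  shows "(\<integral>\<^sup>+x. ennreal (spec_norm (\<Sum>i\<in>UNIV. \<Sum>j\<in>UNIV. h i j (x i) (x j)) powr s) \<partial>PM)
    \<le> ennreal (4 powr s) * (\<integral>\<^sup>+x. \<integral>\<^sup>+y. ennreal (spec_norm (\<Sum>i\<in>UNIV. \<Sum>j\<in>UNIV. h i j (x i) (y j)) powr s) \<partial>PM \<partial>PM)"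
    (is "_ \<le> _ * ?R")
proof -
  let ?E = "UNIV :: ('i \<Rightarrow> bool) set" and ?n = "2 ^ CARD('i) :: real"
  let ?m = "\<lambda>e x. spec_norm (\<Sum>i\<in>{i. e i}. \<Sum>j\<in>-{i. e i}. h i j (x i) (x j))"
  have pt: "spec_norm (\<Sum>i\<in>UNIV. \<Sum>j\<in>UNIV. h i j (x i) (x j)) powr s
     \<le> 4 powr s / ?n * (\<Sum>e\<in>?E. ?m e x powr s)" for x
  proof -
    have "spec_norm (\<Sum>i\<in>UNIV. \<Sum>j\<in>UNIV. h i j (x i) (x j)) \<le> 4 * ((\<Sum>e\<in>?E. ?m e x) / real (card ?E))"
    proof -
      have "spec_norm (\<Sum>i\<in>UNIV. \<Sum>j\<in>UNIV. h i j (x i) (x j))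
        = 4 / ?n * spec_norm (\<Sum>e\<in>?E. \<Sum>i\<in>{i. e i}. \<Sum>j\<in>-{i. e i}. h i j (x i) (x j))"
        by (subst sum_if_split) (simp_all add: diag spec_norm_scaleR)
      also have "\<dots> \<le> 4 / ?n * (\<Sum>e\<in>?E. ?m e x)"
        by (intro mult_left_mono spec_norm_sum) auto
      finally show ?thesis unfolding card_bool_fun by simp
    qed
    then have "spec_norm (\<Sum>i\<in>UNIV. \<Sum>j\<in>UNIV. h i j (x i) (x j)) powr s
       \<le> (4 * ((\<Sum>e\<in>?E. ?m e x) / real (card ?E))) powr s"
      using s by (intro powr_mono2) auto
    also have "\<dots> = 4 powr s * ((\<Sum>e\<in>?E. ?m e x) / real (card ?E)) powr s"
      by (subst powr_mult) (auto intro!: divide_nonneg_nonneg sum_nonneg)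
    also have "\<dots> \<le> 4 powr s * ((\<Sum>e\<in>?E. ?m e x powr s) / real (card ?E))"
      using s by (intro mult_left_mono mean_powr_le) auto
    finally show ?thesis unfolding card_bool_fun by simp
  qed
  have "(\<integral>\<^sup>+x. ennreal (spec_norm (\<Sum>i\<in>UNIV. \<Sum>j\<in>UNIV. h i j (x i) (x j)) powr s) \<partial>PM)
    \<le> (\<integral>\<^sup>+x. ennreal (4 powr s / ?n) * (\<Sum>e\<in>?E. ennreal (?m e x powr s)) \<partial>PM)"
    using pt by (intro nn_integral_mono) (simp add: sum_nonneg ennreal_leI flip: ennreal_mult)
  also have "\<dots> = ennreal (4 powr s / ?n) * (\<Sum>e\<in>?E. \<integral>\<^sup>+x. ennreal (?m e x powr s) \<partial>PM)"
    by (subst nn_integral_cmult, measurable, subst nn_integral_sum) auto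
  also have "\<dots> \<le> ennreal (4 powr s / ?n) * (\<Sum>e\<in>?E. ?R)"
    by (intro mult_left_mono sum_mono decoupling_part s) auto
  also have "(\<Sum>e\<in>?E. ?R) = ennreal ?n * ?R"
    by (simp add: ennreal_of_nat_eq_real_of_nat card_bool_fun)
  also have "ennreal (4 powr s / ?n) * (ennreal ?n * ?R) = ennreal (4 powr s) * ?R"
    by (simp add: mult.assoc[symmetric] flip: ennreal_mult)
  finally show ?thesis .
qed

text \<open>For fixed \<open>y\<close> the sum is centred and independent over \<open>i\<close>, and
  for fixed \<open>x\<close> over \<open>j\<close>. Each conditional symmetrization contributes
  2.\<close>

lemma symmetrization_chaos:
  fixes e e' :: "'i \<Rightarrow> bool"
  assumes s: "1 \<le> s"
  shows "(\<integral>\<^sup>+x. \<integral>\<^sup>+y. ennreal (spec_norm (\<Sum>i\<in>UNIV. \<Sum>j\<in>UNIV. h i j (x i) (y j)) powr s) \<partial>PM \<partial>PM)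
    \<le> ennreal (4 powr s) * (\<integral>\<^sup>+x. \<integral>\<^sup>+y. ennreal (spec_norm
        (rad_sum (\<lambda>i. rad_sum (\<lambda>j. h i j (x i) (y j)) e') e) powr s) \<partial>PM \<partial>PM)"
proof -
  have "(\<integral>\<^sup>+x. \<integral>\<^sup>+y. ennreal (spec_norm (\<Sum>i\<in>UNIV. \<Sum>j\<in>UNIV. h i j (x i) (y j)) powr s) \<partial>PM \<partial>PM)
    = (\<integral>\<^sup>+y. \<integral>\<^sup>+x. ennreal (spec_norm (\<Sum>i\<in>UNIV. \<Sum>j\<in>UNIV. h i j (x i) (y j)) powr s) \<partial>PM \<partial>PM)"
    by (rule PP.Fubini') measurable
  also have "\<dots> \<le> (\<integral>\<^sup>+y. ennreal (2 powr s) * (\<integral>\<^sup>+x. ennreal (spec_norm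
      (rad_sum (\<lambda>i. \<Sum>j\<in>UNIV. h i j (x i) (y j)) e) powr s) \<partial>PM) \<partial>PM)"
  proof (rule nn_integral_mono)
    fix y :: "'i \<Rightarrow> 'a" assume "y \<in> space PM"
    then have y: "\<And>i. y i \<in> space M" by (simp add: space_iid_prod)
    show "(\<integral>\<^sup>+x. ennreal (spec_norm (\<Sum>i\<in>UNIV. \<Sum>j\<in>UNIV. h i j (x i) (y j)) powr s) \<partial>PM)
      \<le> ennreal (2 powr s) * (\<integral>\<^sup>+x. ennreal (spec_norm
      (rad_sum (\<lambda>i. \<Sum>j\<in>UNIV. h i j (x i) (y j)) e) powr s) \<partial>PM)"
      using y s by (intro symmetrization) (simp_all add: integrable_left mean_left)
  qed
  also have "\<dots> = ennreal (2 powr s) * (\<integral>\<^sup>+y. \<integral>\<^sup>+x. ennreal (spec_norm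
      (rad_sum (\<lambda>i. \<Sum>j\<in>UNIV. h i j (x i) (y j)) e) powr s) \<partial>PM \<partial>PM)"
    unfolding rad_sum_def by (rule nn_integral_cmult) measurable
  also have "(\<integral>\<^sup>+y. \<integral>\<^sup>+x. ennreal (spec_norm
      (rad_sum (\<lambda>i. \<Sum>j\<in>UNIV. h i j (x i) (y j)) e) powr s) \<partial>PM \<partial>PM)
    = (\<integral>\<^sup>+x. \<integral>\<^sup>+y. ennreal (spec_norm
      (rad_sum (\<lambda>i. \<Sum>j\<in>UNIV. h i j (x i) (y j)) e) powr s) \<partial>PM \<partial>PM)"
    unfolding rad_sum_def by (rule PP.Fubini') measurable
  also have "\<dots> = (\<integral>\<^sup>+x. \<integral>\<^sup>+y. ennreal (spec_norm
      (\<Sum>j\<in>UNIV. rad_sum (\<lambda>i. h i j (x i) (y j)) e) powr s) \<partial>PM \<partial>PM)"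
    unfolding rad_sum_def scaleR_right.sum by (subst sum.swap) (rule refl)
  also have "\<dots> \<le> (\<integral>\<^sup>+x. ennreal (2 powr s) * (\<integral>\<^sup>+y. ennreal (spec_norm
      (rad_sum (\<lambda>j. rad_sum (\<lambda>i. h i j (x i) (y j)) e) e') powr s) \<partial>PM) \<partial>PM)"
  proof (rule nn_integral_mono)
    fix x :: "'i \<Rightarrow> 'a" assume "x \<in> space PM"
    then have x: "\<And>i. x i \<in> space M" by (simp add: space_iid_prod)
    show "(\<integral>\<^sup>+y. ennreal (spec_norm (\<Sum>j\<in>UNIV. rad_sum (\<lambda>i. h i j (x i) (y j)) e) powr s) \<partial>PM)
      \<le> ennreal (2 powr s) * (\<integral>\<^sup>+y. ennreal (spec_norm
      (rad_sum (\<lambda>j. rad_sum (\<lambda>i. h i j (x i) (y j)) e) e') powr s) \<partial>PM)"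
      using x s by (intro symmetrization[where f = "\<lambda>j y. rad_sum (\<lambda>i. h i j (x i) y) e"])
        (simp_all add: integrable_right mean_right rad_sum_def)
  qed
  also have "\<dots> = ennreal (2 powr s) * (\<integral>\<^sup>+x. \<integral>\<^sup>+y. ennreal (spec_norm
      (rad_sum (\<lambda>j. rad_sum (\<lambda>i. h i j (x i) (y j)) e) e') powr s) \<partial>PM \<partial>PM)"
    unfolding rad_sum_def by (rule nn_integral_cmult) measurable
  also have "(\<lambda>x y. rad_sum (\<lambda>j. rad_sum (\<lambda>i. h i j (x i) (y j)) e) e')
    = (\<lambda>x y. rad_sum (\<lambda>i. rad_sum (\<lambda>j. h i j (x i) (y j)) e') e)"
    unfolding rad_sum_def scaleR_right.sum
    by (intro ext) (subst sum.swap, simp add: mult.commute)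
  finally have "(\<integral>\<^sup>+x. \<integral>\<^sup>+y. ennreal (spec_norm (\<Sum>i\<in>UNIV. \<Sum>j\<in>UNIV. h i j (x i) (y j)) powr s) \<partial>PM \<partial>PM)
    \<le> ennreal (2 powr s) * (ennreal (2 powr s) * (\<integral>\<^sup>+x. \<integral>\<^sup>+y. ennreal (spec_norm
        (rad_sum (\<lambda>i. rad_sum (\<lambda>j. h i j (x i) (y j)) e') e) powr s) \<partial>PM \<partial>PM))"
    by (simp add: mult_left_mono)
  also have "ennreal (2 powr s) * (ennreal (2 powr s) * c) = ennreal (4 powr s) * c" for c
    by (simp add: mult.assoc[symmetric] flip: ennreal_mult powr_mult)
  finally show ?thesis .
qed

end

subsection \<open>Moments of the decoupled sum\<close>

lemma borel_measurable_vecI: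
  fixes f :: "'w \<Rightarrow> 'b::euclidean_space^'n"
  assumes "\<And>i. (\<lambda>w. f w $ i) \<in> borel_measurable L"
  shows "f \<in> borel_measurable L"
  unfolding borel_measurable_euclidean_space[of f]
proof
  fix b :: "'b^'n" assume "b \<in> Basis"
  then obtain i u where b: "b = axis i u" by (auto simp: Basis_vec_def)
  show "(\<lambda>w. f w \<bullet> b) \<in> borel_measurable L"
    unfolding b inner_axis using assms[of i] by measurable
qed

lemma borel_measurable_vec_nth [measurable (raw)]:
  fixes f :: "'w \<Rightarrow> 'b::euclidean_space^'n"
  assumes "f \<in> borel_measurable L"
  shows "(\<lambda>w. f w $ i) \<in> borel_measurable L"
  by (rule measurable_compose[OF assms borel_measurable_continuous_onI])
    (intro continuous_intros)

lemma borel_measurable_matrix_mult [measurable (raw)]: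
  fixes f :: "'w \<Rightarrow> complex^'n^'m" and g :: "'w \<Rightarrow> complex^'k^'n"
  assumes "f \<in> borel_measurable L" "g \<in> borel_measurable L"
  shows "(\<lambda>w. f w ** g w) \<in> borel_measurable L"
  by (rule borel_measurable_continuous_Pair[OF assms])
    (intro matrix_mult.continuous_on continuous_intros)

lemma borel_measurable_adj_mat [measurable (raw)]:
  fixes f :: "'w \<Rightarrow> complex^'n^'m"
  assumes "f \<in> borel_measurable L"
  shows "(\<lambda>w. adj_mat (f w)) \<in> borel_measurable L"
  by (rule measurable_compose[OF assms borel_measurable_continuous_onI])
    (rule linear_continuous_on[OF bounded_linear_adj_mat])

lemma borel_measurable_rad_sum [measurable (raw)]:
  fixes f :: "'j::finite \<Rightarrow> 'w \<Rightarrow> complex^'n^'m"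
  assumes [measurable]: "\<And>j. f j \<in> borel_measurable L"
  shows "(\<lambda>w. rad_sum (\<lambda>j. f j w) e) \<in> borel_measurable L"
  unfolding rad_sum_def by measurable

lemma borel_measurable_dilation [measurable (raw)]:
  assumes [measurable]: "\<And>i. f i \<in> borel_measurable L"
  shows "(\<lambda>w. dilation (\<lambda>i. f i w)) \<in> borel_measurable L"
proof (intro borel_measurable_vecI)
  fix a b
  show "(\<lambda>w. dilation (\<lambda>i. f i w) $ a $ b) \<in> borel_measurable L"
    by (cases "fst a"; cases "fst b") (simp_all add: dilation_def)
qed

text \<open>The zero diagonal of the block matrix in the theorem needs no case distinction here,
  because the extended kernel vanishes there.\<close>

definition block_matrix :: "('i::finite \<Rightarrow> 'j::finite \<Rightarrow> complex^'d^'d) \<Rightarrow> complex^('j \<times> 'd)^('i \<times> 'd)" where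
  "block_matrix A = (\<chi> a b. A (fst a) (fst b) $ snd a $ snd b)"

lemma borel_measurable_block_matrix [measurable (raw)]:
  assumes [measurable]: "\<And>i j. f i j \<in> borel_measurable L"
  shows "(\<lambda>w. block_matrix (\<lambda>i j. f i j w)) \<in> borel_measurable L"
  by (intro borel_measurable_vecI) (simp add: block_matrix_def)

lemma borel_measurable_gram [measurable (raw)]:
  assumes [measurable]: "\<And>i j. f i j \<in> borel_measurable L"
  shows "(\<lambda>w. gram (\<lambda>i j. f i j w)) \<in> borel_measurable L"
  unfolding gram_def by measurable

lemma norm_block_matrix: "(norm (block_matrix A))\<^sup>2 = (\<Sum>i\<in>UNIV. \<Sum>j\<in>UNIV. (norm (A i j))\<^sup>2)"
proof -
  have "(norm (block_matrix A))\<^sup>2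
     = (\<Sum>i\<in>UNIV. \<Sum>k\<in>UNIV. \<Sum>j\<in>UNIV. \<Sum>l\<in>UNIV. (cmod (A i j $ k $ l))\<^sup>2)"
    by (simp add: norm_vec_def L2_set_def sum_nonneg block_matrix_def sum_UNIV_prod)
  also have "\<dots> = (\<Sum>i\<in>UNIV. \<Sum>j\<in>UNIV. \<Sum>k\<in>UNIV. \<Sum>l\<in>UNIV. (cmod (A i j $ k $ l))\<^sup>2)"
    by (intro sum.cong refl sum.swap)
  also have "\<dots> = (\<Sum>i\<in>UNIV. \<Sum>j\<in>UNIV. (norm (A i j))\<^sup>2)"
    by (simp add: norm_vec_def L2_set_def sum_nonneg)
  finally show ?thesis .
qed

definition tail_blocks :: "complex^('i::finite option \<times> 'd::finite) \<Rightarrow> complex^('i \<times> 'd)" where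
  "tail_blocks u = (\<chi> a. u $ (Some (fst a), snd a))"

lemma blk_tail_blocks [simp]: "blk i (tail_blocks u) = blk (Some i) u"
  by (simp add: blk_def tail_blocks_def vec_eq_iff)

lemma norm_tail_blocks: "(norm u)\<^sup>2 = (norm (blk None u))\<^sup>2 + (norm (tail_blocks u))\<^sup>2"
  by (simp add: norm_blk[of u] norm_blk[of "tail_blocks u"] sum_option)

lemma inner_mult_adj: "v \<bullet> ((A ** adj_mat A) *v v) = (norm (adj_mat A *v v))\<^sup>2" for A :: "complex^'n^'m"
  using inner_matrix_vector_mult[of "adj_mat A" v "adj_mat A *v v"]
  by (simp add: power2_norm_eq_inner matrix_vector_mul_assoc)

text \<open>Block diagonality of \<open>gram A\<close>, expressed by quadratic forms: the cross
  terms drop out because each dilation exchanges the distinguished block with the others.\<close>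

lemma inner_gram:
  assumes A: "\<And>i j. hermitian_mat (A i j)"
  shows "u \<bullet> (gram A *v u)
    = tail_blocks u \<bullet> ((block_matrix A ** adj_mat (block_matrix A)) *v tail_blocks u)
      + blk None u \<bullet> ((\<Sum>i\<in>UNIV. \<Sum>j\<in>UNIV. A i j ** A i j) *v blk None u)"
proof -
  have "blk j (adj_mat (block_matrix A) *v tail_blocks u) = (\<Sum>i\<in>UNIV. A i j *v blk (Some i) u)" for j
  proof -
    have "cnj (A i j $ l $ k) = A i j $ k $ l" for i k l
      using A[of i j] unfolding hermitian_mat_def by metis
    then show ?thesis
      by (simp add: vec_eq_iff blk_def adj_mat_def block_matrix_def matrix_vector_mult_def
          sum_UNIV_prod tail_blocks_def sum_component)
  qed
  then have "tail_blocks u \<bullet> ((block_matrix A ** adj_mat (block_matrix A)) *v tail_blocks u)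
     = (\<Sum>j\<in>UNIV. (norm (\<Sum>i\<in>UNIV. A i j *v blk (Some i) u))\<^sup>2)"
    by (simp add: inner_mult_adj norm_blk[of "adj_mat (block_matrix A) *v tail_blocks u"])
  moreover have "blk None u \<bullet> ((\<Sum>i\<in>UNIV. \<Sum>j\<in>UNIV. A i j ** A i j) *v blk None u)
     = (\<Sum>j\<in>UNIV. \<Sum>i\<in>UNIV. (norm (A i j *v blk None u))\<^sup>2)"
    by (simp add: matrix_vector_mult.sum_left inner_sum_right inner_square A) (rule sum.swap)
  ultimately show ?thesis
    unfolding gram_def by (simp add: inner_sum_squares hermitian_dilation A norm_dilation_vec sum.distrib)
qed

text \<open>Through the trace of R^2: an integrable square controls the squared Frobenius norm, as
  the domination arguments require.\<close>

lemma norm_square_le: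
  fixes R :: "complex^'d^'d"
  assumes "hermitian_mat R"
  shows "(norm R)\<^sup>2 \<le> real CARD('d) * norm (R ** R)"
  unfolding rtrace_square[OF assms, symmetric]
  by (intro order_trans[OF rtrace_le] mult_left_mono spec_norm_le_norm) auto

lemma norm_matrix_mult_le_norms: "norm (A ** B) \<le> norm A * norm B"
  for A :: "complex^'n^'m" and B :: "complex^'k^'n"
  by (intro order_trans[OF norm_matrix_mult_le] mult_right_mono spec_norm_le_norm) auto

text \<open>The entries contain mixed products of different \<open>f i\<close>; squared Frobenius
  norms dominate them, and these are controlled by the integrable squares.\<close>

lemma integrable_dilation_square:
  fixes f :: "'i::finite \<Rightarrow> 'w \<Rightarrow> complex^'d^'d"
  assumes [measurable]: "\<And>i. f i \<in> borel_measurable L"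
    and herm: "\<And>i w. w \<in> space L \<Longrightarrow> hermitian_mat (f i w)"
    and int: "\<And>i. integrable L (\<lambda>w. f i w ** f i w)"
  shows "integrable L (\<lambda>w. dilation (\<lambda>i. f i w) ** dilation (\<lambda>i. f i w))"
proof (rule Bochner_Integration.integrable_bound)
  show "integrable L (\<lambda>w. 2 * (\<Sum>i\<in>UNIV. real CARD('d) * norm (f i w ** f i w)))"
    using int by auto
  show "AE w in L. norm (dilation (\<lambda>i. f i w) ** dilation (\<lambda>i. f i w))
    \<le> norm (2 * (\<Sum>i\<in>UNIV. real CARD('d) * norm (f i w ** f i w)))"
  proof (rule AE_I2)
    fix w assume w: "w \<in> space L"
    have "norm (dilation (\<lambda>i. f i w) ** dilation (\<lambda>i. f i w)) \<le> (norm (dilation (\<lambda>i. f i w)))\<^sup>2"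
      using norm_matrix_mult_le_norms by (simp add: power2_eq_square)
    also have "\<dots> \<le> 2 * (\<Sum>i\<in>UNIV. real CARD('d) * norm (f i w ** f i w))"
      unfolding norm_dilation using herm[OF w] by (intro mult_left_mono sum_mono norm_square_le) auto
    finally show "norm (dilation (\<lambda>i. f i w) ** dilation (\<lambda>i. f i w))
      \<le> norm (2 * (\<Sum>i\<in>UNIV. real CARD('d) * norm (f i w ** f i w)))" by simp
  qed
qed measurable

lemma integrable_block_matrix_adj:
  fixes f :: "'i::finite \<Rightarrow> 'j::finite \<Rightarrow> 'w \<Rightarrow> complex^'d^'d"
  assumes [measurable]: "\<And>i j. f i j \<in> borel_measurable L"
    and herm: "\<And>i j w. w \<in> space L \<Longrightarrow> hermitian_mat (f i j w)"
    and int: "\<And>i j. integrable L (\<lambda>w. f i j w ** f i j w)"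
  shows "integrable L (\<lambda>w. block_matrix (\<lambda>i j. f i j w) ** adj_mat (block_matrix (\<lambda>i j. f i j w)))"
proof (rule Bochner_Integration.integrable_bound)
  show "integrable L (\<lambda>w. (\<Sum>i\<in>UNIV. \<Sum>j\<in>UNIV. real CARD('d) * norm (f i j w ** f i j w)))"
    using int by auto
  show "AE w in L. norm (block_matrix (\<lambda>i j. f i j w) ** adj_mat (block_matrix (\<lambda>i j. f i j w)))
    \<le> norm (\<Sum>i\<in>UNIV. \<Sum>j\<in>UNIV. real CARD('d) * norm (f i j w ** f i j w))"
  proof (rule AE_I2)
    fix w assume w: "w \<in> space L"
    have "norm (block_matrix (\<lambda>i j. f i j w) ** adj_mat (block_matrix (\<lambda>i j. f i j w)))
      \<le> (norm (block_matrix (\<lambda>i j. f i j w)))\<^sup>2"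
      using norm_matrix_mult_le_norms[of _ "adj_mat _"] by (simp add: power2_eq_square norm_adj_mat)
    also have "\<dots> \<le> (\<Sum>i\<in>UNIV. \<Sum>j\<in>UNIV. real CARD('d) * norm (f i j w ** f i j w))"
      unfolding norm_block_matrix using herm[OF w] by (intro sum_mono norm_square_le) auto
    finally show "norm (block_matrix (\<lambda>i j. f i j w) ** adj_mat (block_matrix (\<lambda>i j. f i j w)))
      \<le> norm (\<Sum>i\<in>UNIV. \<Sum>j\<in>UNIV. real CARD('d) * norm (f i j w ** f i j w))" by (simp add: sum_nonneg)
  qed
qed measurable

lemma lp_le_cmult:
  assumes [measurable]: "f \<in> borel_measurable M" and nn: "\<And>x. x \<in> space M \<Longrightarrow> 0 \<le> f x"
    and kc: "0 \<le> k" "0 \<le> c" and f: "lp_le M f s c"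
  shows "lp_le M (\<lambda>x. k * f x) s (k * c)"
proof -
  have "(\<integral>\<^sup>+x. ennreal ((k * f x) powr s) \<partial>M) = (\<integral>\<^sup>+x. ennreal (k powr s) * ennreal (f x powr s) \<partial>M)"
    using nn kc by (intro nn_integral_cong) (simp add: powr_mult flip: ennreal_mult)
  also have "\<dots> = ennreal (k powr s) * (\<integral>\<^sup>+x. ennreal (f x powr s) \<partial>M)"
    by (rule nn_integral_cmult) measurable
  also have "\<dots> \<le> ennreal (k powr s) * ennreal (c powr s)"
    using f by (intro mult_left_mono) (auto simp: lp_le_def)
  also have "\<dots> = ennreal ((k * c) powr s)"
    using kc by (simp add: powr_mult flip: ennreal_mult)
  finally show ?thesis by (simp add: lp_le_def)
qed

lemma lp_le_sqrt:
  assumes "\<And>x. x \<in> space M \<Longrightarrow> 0 \<le> f x" "(\<integral>\<^sup>+x. ennreal (f x powr q) \<partial>M) \<le> ennreal (c powr (2 * q))"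
  shows "lp_le M (\<lambda>x. sqrt (f x)) (2 * q) c"
proof -
  have "(\<integral>\<^sup>+x. ennreal (sqrt (f x) powr (2 * q)) \<partial>M) = (\<integral>\<^sup>+x. ennreal (f x powr q) \<partial>M)"
    using assms(1) by (intro nn_integral_cong) (simp add: powr_half_sqrt[symmetric] powr_powr)
  then show ?thesis using assms(2) by (simp add: lp_le_def)
qed

context degenerate_kernel begin

lemma nn_integral_pair:
  assumes "(\<lambda>z. F (fst z) (snd z)) \<in> borel_measurable (PM \<Otimes>\<^sub>M PM)"
  shows "(\<integral>\<^sup>+x. \<integral>\<^sup>+y. F x y \<partial>PM \<partial>PM)
    = (\<integral>\<^sup>+z. F (fst z) (snd z) \<partial>(PM \<Otimes>\<^sub>M PM))"
  using P.nn_integral_fst[OF assms] by simp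

text \<open>\<open>symmetrization_chaos\<close> holds for every pair of sign vectors, so a pair with
  at most average integral may be used; 48/5 is 4 times 12/5.\<close>

lemma chaos_bound:
  assumes r: "1 \<le> r" and d: "real CARD('d) \<le> exp (r - 1)" and q: "1 \<le> q" "q \<le> r"
  shows "(\<integral>\<^sup>+x. \<integral>\<^sup>+y. ennreal (spec_norm (\<Sum>i\<in>UNIV. \<Sum>j\<in>UNIV. h i j (x i) (y j)) powr (2 * q)) \<partial>PM \<partial>PM)
    \<le> ennreal ((48 / 5 * r) powr (2 * q)) *
      (\<integral>\<^sup>+x. \<integral>\<^sup>+y. ennreal (spec_norm (gram (\<lambda>i j. h i j (x i) (y j))) powr q) \<partial>PM \<partial>PM)"
    (is "?L \<le> _ * ?R")
proof -
  let ?c = "\<lambda>e e' x y. ennreal (spec_norm (rad_sum (\<lambda>i. rad_sum (\<lambda>j. h i j (x i) (y j)) e') e) powr (2 * q))"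
  let ?K = "\<lambda>(e', e). \<integral>\<^sup>+x. \<integral>\<^sup>+y. ?c e e' x y \<partial>PM \<partial>PM"
  let ?E = "UNIV :: (('i \<Rightarrow> bool) \<times> ('i \<Rightarrow> bool)) set"
  let ?k = "(12 / 5 * r) powr (2 * q)"
  have cardE: "real (card ?E) = 2 ^ CARD('i) * 2 ^ CARD('i)"
    unfolding UNIV_Times_UNIV[symmetric] card_cartesian_product of_nat_mult card_bool_fun ..
  let ?g = "\<lambda>z. spec_norm (gram (\<lambda>i j. h i j (fst z i) (snd z j)))"
  have m [measurable]: "(\<lambda>z. ?c e e' (fst z) (snd z)) \<in> borel_measurable (PM \<Otimes>\<^sub>M PM)" for e e'
    by measurable
  have R: "?R = (\<integral>\<^sup>+z. ennreal (?g z powr q) \<partial>(PM \<Otimes>\<^sub>M PM))"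
    by (rule nn_integral_pair) measurable
  have "(\<Sum>a\<in>?E. ?K a) = (\<Sum>e'\<in>UNIV. \<Sum>e\<in>UNIV. \<integral>\<^sup>+z. ?c e e' (fst z) (snd z) \<partial>(PM \<Otimes>\<^sub>M PM))"
    unfolding sum_UNIV_prod prod.case by (intro sum.cong refl nn_integral_pair m)
  also have "\<dots> = (\<integral>\<^sup>+z. (\<Sum>e'\<in>UNIV. \<Sum>e\<in>UNIV. ?c e e' (fst z) (snd z)) \<partial>(PM \<Otimes>\<^sub>M PM))"
    by (subst nn_integral_sum, measurable, subst nn_integral_sum) auto
  also have "\<dots> \<le> (\<integral>\<^sup>+z. ennreal (real (card ?E) * ?k) * ennreal (?g z powr q) \<partial>(PM \<Otimes>\<^sub>M PM))"
  proof (intro nn_integral_mono)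
    fix z :: "('i \<Rightarrow> 'a) \<times> ('i \<Rightarrow> 'a)" assume "z \<in> space (PM \<Otimes>\<^sub>M PM)"
    then have A: "\<And>i j. hermitian_mat (h i j (fst z i) (snd z j))"
      by (auto simp: space_pair_measure space_iid_prod intro: herm)
    have "(\<Sum>e'\<in>UNIV. \<Sum>e\<in>UNIV. ?c e e' (fst z) (snd z))
      = ennreal (\<Sum>e'\<in>UNIV. \<Sum>e\<in>UNIV. spec_norm (rad_sum (\<lambda>i. rad_sum (\<lambda>j. h i j (fst z i) (snd z j)) e') e) powr (2 * q))"
      by (simp add: sum_nonneg)
    also have "\<dots> \<le> ennreal (2 ^ CARD('i) * 2 ^ CARD('i) * (12 / 5 * r * sqrt (?g z)) powr (2 * q))"
      by (intro ennreal_leI chaos_moment_powr[of "\<lambda>i j. h i j (fst z i) (snd z j)", OF A r d q])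
    also have "(12 / 5 * r * sqrt (?g z)) powr (2 * q) = ?k * ?g z powr q"
      using r by (subst powr_mult) (simp_all add: powr_half_sqrt[symmetric] powr_powr)
    finally show "(\<Sum>e'\<in>UNIV. \<Sum>e\<in>UNIV. ?c e e' (fst z) (snd z)) \<le> ennreal (real (card ?E) * ?k) * ennreal (?g z powr q)"
      unfolding cardE by (simp add: mult.assoc flip: ennreal_mult)
  qed
  also have "\<dots> = ennreal (real (card ?E) * ?k) * ?R"
    unfolding R by (rule nn_integral_cmult) measurable
  also have "\<dots> = of_nat (card ?E) * (ennreal ?k * ?R)"
    by (simp add: ennreal_of_nat_eq_real_of_nat ennreal_mult mult.assoc)
  finally have sum_le: "(\<Sum>a\<in>?E. ?K a) \<le> of_nat (card ?E) * (ennreal ?k * ?R)" .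
  \<comment> \<open>The pair of sign vectors is deterministic: it is chosen after integrating over
    both samples.\<close>
  obtain a where a: "?K a \<le> ennreal ?k * ?R"
    using exists_le_of_sum_le[OF finite UNIV_not_empty sum_le] ..
  obtain e' e where "a = (e', e)" by (cases a) blast
  with a have K: "?K (e', e) \<le> ennreal ?k * ?R" by (simp only:)
  have "?L \<le> ennreal (4 powr (2 * q)) * ?K (e', e)"
    using symmetrization_chaos[of "2 * q" e' e] q by simp
  also have "\<dots> \<le> ennreal (4 powr (2 * q)) * (ennreal ?k * ?R)"
    by (intro mult_left_mono K) auto
  also have "\<dots> = ennreal ((48 / 5 * r) powr (2 * q)) * ?R"
    using r by (simp add: mult.assoc[symmetric] flip: ennreal_mult powr_mult)
  finally show ?thesis .
qed

end

context degenerate_kernel begin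

section \<open>Conditional squares and moments of the Gram matrix\<close>

definition row_max :: "('i \<Rightarrow> 'a) \<Rightarrow> ('i \<Rightarrow> 'a) \<Rightarrow> real" where
  "row_max x y = Max (range (\<lambda>i. spec_norm (\<Sum>j\<in>UNIV. h i j (x i) (y j) ** h i j (x i) (y j))))"

definition cond_square :: "'i \<Rightarrow> 'i \<Rightarrow> 'a \<Rightarrow> complex^'d^'d" where
  "cond_square i j x = (\<integral>y. h i j x y ** h i j x y \<partial>M)"

definition cond_block :: "('i \<Rightarrow> 'a) \<Rightarrow> complex^('i \<times> 'd)^('i \<times> 'd)" where
  "cond_block x = (\<integral>y. block_matrix (\<lambda>i j. h i j (x i) (y j)) **
     adj_mat (block_matrix (\<lambda>i j. h i j (x i) (y j))) \<partial>PM)"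

text \<open>The points at which \<open>cond_square\<close> and \<open>cond_block\<close> are genuine
  integrals rather than the default value 0; almost every \<open>x\<close> is one.\<close>

definition square_integrable_at :: "('i \<Rightarrow> 'a) \<Rightarrow> bool" where
  "square_integrable_at x \<longleftrightarrow> (\<forall>i j. integrable M (\<lambda>y. h i j (x i) y ** h i j (x i) y))"

lemma measurable_row_max [measurable (raw)]:
  assumes [measurable]: "f \<in> L \<rightarrow>\<^sub>M PM" "g \<in> L \<rightarrow>\<^sub>M PM"
  shows "(\<lambda>w. row_max (f w) (g w)) \<in> borel_measurable L"
  unfolding row_max_def by (intro borel_measurable_Max) auto

lemma measurable_cond_square [measurable]: "cond_square i j \<in> borel_measurable M"
  unfolding cond_square_def by measurable

lemma measurable_cond_block [measurable]: "cond_block \<in> borel_measurable PM"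
  unfolding cond_block_def by measurable

lemma row_max_ge: "spec_norm (\<Sum>j\<in>UNIV. h i j (x i) (y j) ** h i j (x i) (y j)) \<le> row_max x y"
  unfolding row_max_def by (rule Max_ge) auto

text \<open>Permutation symmetry turns a column into a row with the two samples exchanged, so a
  single maximum serves for both.\<close>

lemma col_le_row_max:
  assumes "x \<in> space PM" "y \<in> space PM"
  shows "spec_norm (\<Sum>i\<in>UNIV. h i j (x i) (y j) ** h i j (x i) (y j)) \<le> row_max y x"
  using row_max_ge[of j y x] assms by (simp add: space_iid_prod sym[of "x _" "y j"])

lemma psd_cond_square: "x \<in> space M \<Longrightarrow> psd_mat (cond_square i j x)"
  unfolding cond_square_def by (intro psd_integral psd_square herm)

text \<open>Integrating \<open>inner_gram\<close> over the second sample keeps the block structure;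
  the norm is bounded by the sum of the norms of the two integrated blocks.\<close>

lemma spec_norm_mean_gram_le:
  assumes x: "x \<in> space PM" "square_integrable_at x"
  shows "spec_norm (\<Sum>j\<in>UNIV. \<integral>y. dilation (\<lambda>i. h i j (x i) y) ** dilation (\<lambda>i. h i j (x i) y) \<partial>M)
    \<le> spec_norm (\<Sum>i\<in>UNIV. \<Sum>j\<in>UNIV. cond_square i j (x i)) + spec_norm (cond_block x)"
proof -
  have xs: "\<And>i. x i \<in> space M" using x by (simp add: space_iid_prod)
  have [measurable]: "(\<lambda>y. h i j (x i) y) \<in> borel_measurable M" for i j
    using integrable_right[OF xs] by (rule borel_measurable_integrable)
  have sq: "integrable M (\<lambda>y. h i j (x i) y ** h i j (x i) y)" for i j
    using x by (simp add: square_integrable_at_def)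
  let ?W = "\<lambda>j y. dilation (\<lambda>i. h i j (x i) y) ** dilation (\<lambda>i. h i j (x i) y)"
  let ?A = "\<lambda>y i j. h i j (x i) (y j)"
  let ?G = "\<lambda>y. block_matrix (?A y) ** adj_mat (block_matrix (?A y))"
  let ?V = "\<lambda>y. \<Sum>i\<in>UNIV. \<Sum>j\<in>UNIV. ?A y i j ** ?A y i j"
  have hx: "hermitian_mat (h i j (x i) y)" if "y \<in> space M" for i j y
    using xs that by (rule herm)
  have W: "integrable M (?W j)" for j
    by (intro integrable_dilation_square sq hx) auto
  have G: "integrable PM ?G"
  proof (intro integrable_block_matrix_adj)
    show "integrable PM (\<lambda>y. ?A y i j ** ?A y i j)" for i j
      by (rule integral_iid_component(1)[OF sq])
  qed (auto simp: space_iid_prod intro: hx)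
  have V: "integrable PM ?V" "(\<integral>y. ?V y \<partial>PM) = (\<Sum>i\<in>UNIV. \<Sum>j\<in>UNIV. cond_square i j (x i))"
  proof -
    have "integrable PM (\<lambda>y. ?A y i j ** ?A y i j)"
      "(\<integral>y. ?A y i j ** ?A y i j \<partial>PM) = cond_square i j (x i)" for i j
      unfolding cond_square_def by (rule integral_iid_component[OF sq])+
    then show "integrable PM ?V" "(\<integral>y. ?V y \<partial>PM) = (\<Sum>i\<in>UNIV. \<Sum>j\<in>UNIV. cond_square i j (x i))"
      by simp_all
  qed
  have gW: "integrable PM (\<lambda>y. gram (?A y))" "(\<integral>y. gram (?A y) \<partial>PM) = (\<Sum>j\<in>UNIV. \<integral>y. ?W j y \<partial>M)"
  proof -
    have "integrable PM (\<lambda>y. ?W j (y j))" "(\<integral>y. ?W j (y j) \<partial>PM) = (\<integral>y. ?W j y \<partial>M)" for j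
      by (rule integral_iid_component[OF W])+
    then show "integrable PM (\<lambda>y. gram (?A y))" "(\<integral>y. gram (?A y) \<partial>PM) = (\<Sum>j\<in>UNIV. \<integral>y. ?W j y \<partial>M)"
      unfolding gram_def by simp_all
  qed
  have psd: "psd_mat (\<Sum>j\<in>UNIV. \<integral>y. ?W j y \<partial>M)"
    by (intro psd_sum psd_integral psd_square hermitian_dilation hx)
  show ?thesis
  proof (rule psd_spec_norm_le[OF psd])
    fix u :: "complex^('i option \<times> 'd)"
    let ?t = "tail_blocks u" and ?b = "blk None u"
    have "u \<bullet> ((\<Sum>j\<in>UNIV. \<integral>y. ?W j y \<partial>M) *v u) = (\<integral>y. u \<bullet> (gram (?A y) *v u) \<partial>PM)"
      unfolding gW(2)[symmetric] by (rule inner_mult_integral(2)[OF gW(1)])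
    also have "\<dots> = (\<integral>y. ?t \<bullet> (?G y *v ?t) + ?b \<bullet> (?V y *v ?b) \<partial>PM)"
      by (intro Bochner_Integration.integral_cong refl inner_gram) (auto simp: space_iid_prod intro: hx)
    also have "\<dots> = ?t \<bullet> (cond_block x *v ?t) + ?b \<bullet> ((\<Sum>i\<in>UNIV. \<Sum>j\<in>UNIV. cond_square i j (x i)) *v ?b)"
      unfolding cond_block_def V(2)[symmetric] inner_mult_integral(2)[OF G] inner_mult_integral(2)[OF V(1)]
      by (intro Bochner_Integration.integral_add inner_mult_integral(1) G V)
    also have "\<dots> \<le> spec_norm (cond_block x) * (norm ?t)\<^sup>2 + spec_norm (\<Sum>i\<in>UNIV. \<Sum>j\<in>UNIV. cond_square i j (x i)) * (norm ?b)\<^sup>2"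
      by (intro add_mono inner_mult_vec_le)
    also have "\<dots> \<le> spec_norm (cond_block x) * (norm u)\<^sup>2 + spec_norm (\<Sum>i\<in>UNIV. \<Sum>j\<in>UNIV. cond_square i j (x i)) * (norm u)\<^sup>2"
      unfolding norm_tail_blocks[of u] by (intro add_mono mult_left_mono) auto
    finally show "u \<bullet> ((\<Sum>j\<in>UNIV. \<integral>y. ?W j y \<partial>M) *v u)
      \<le> (spec_norm (\<Sum>i\<in>UNIV. \<Sum>j\<in>UNIV. cond_square i j (x i)) + spec_norm (cond_block x)) * (norm u)\<^sup>2"
      by (simp add: algebra_simps)
  qed
qed

text \<open>With the first sample frozen, the terms of \<open>gram\<close> are independent over
  \<open>j\<close>, and the largest of them is bounded by a column, hence by
  \<open>row_max y x\<close>.\<close>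

lemma gram_cond_moment:
  assumes x: "x \<in> space PM" "square_integrable_at x"
    and r: "1 \<le> r" and d: "real CARD('d) \<le> exp (r - 1)" and q: "1 \<le> q" "q \<le> r"
    and a: "0 \<le> a" "(\<integral>\<^sup>+y. ennreal (row_max y x powr q) \<partial>PM) \<le> ennreal (a powr (2 * q))"
  shows "(\<integral>\<^sup>+y. ennreal (spec_norm (gram (\<lambda>i j. h i j (x i) (y j))) powr q) \<partial>PM)
    \<le> ennreal ((sqrt 2 * sqrt (spec_norm (\<Sum>i\<in>UNIV. \<Sum>j\<in>UNIV. cond_square i j (x i)))
      + sqrt 2 * sqrt (spec_norm (cond_block x)) + 2 * sqrt (24 / 5 * r) * a) powr (2 * q))"
proof -
  have xs: "\<And>i. x i \<in> space M" using x by (simp add: space_iid_prod)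
  have [measurable]: "(\<lambda>y. h i j (x i) y) \<in> borel_measurable M" for i j
    using integrable_right[OF xs] by (rule borel_measurable_integrable)
  have hx: "hermitian_mat (h i j (x i) y)" if "y \<in> space M" for i j y
    using xs that by (rule herm)
  let ?W = "\<lambda>j y. dilation (\<lambda>i. h i j (x i) y) ** dilation (\<lambda>i. h i j (x i) y)"
  let ?v = "spec_norm (\<Sum>i\<in>UNIV. \<Sum>j\<in>UNIV. cond_square i j (x i))" and ?g = "spec_norm (cond_block x)"
  let ?t = "spec_norm (\<Sum>j\<in>UNIV. \<integral>y. ?W j y \<partial>M)"
  have gram_W: "gram (\<lambda>i j. h i j (x i) (y j)) = (\<Sum>j\<in>UNIV. ?W j (y j))" for y
    by (simp add: gram_def)
  have "(\<integral>\<^sup>+y. ennreal (spec_norm (\<Sum>j\<in>UNIV. ?W j (y j)) powr q) \<partial>PM)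
     \<le> ennreal ((sqrt (2 * ?t) + 2 * sqrt (24 / 5 * r) * a) powr (2 * q))"
  proof (rule psd_sum_moment[where \<mu> = "\<lambda>y. row_max y x" and d = "real CARD('d)"])
    show "integrable M (?W j)" for j
      using x by (intro integrable_dilation_square hx) (auto simp: square_integrable_at_def)
    show "psd_mat (?W j y)" if "y \<in> space M" for j y
      using that by (intro psd_square hermitian_dilation hx)
    show "(\<lambda>y. row_max y x) \<in> borel_measurable PM"
      using x by measurable
    fix y :: "'i \<Rightarrow> 'a" assume y: "y \<in> space PM"
    then have hy: "hermitian_mat (h i j (x i) (y j))" for i j
      by (auto simp: space_iid_prod intro: hx)
    show "rtrace (\<Sum>j\<in>UNIV. ?W j (y j)) \<le> 2 * real CARD('d) * spec_norm (\<Sum>j\<in>UNIV. ?W j (y j))"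
      unfolding gram_W[symmetric] by (rule rtrace_gram_le[OF hy])
    show "spec_norm (?W j (y j)) \<le> row_max y x" for j
      by (rule order_trans[OF spec_norm_dilation_square_le[OF hy] col_le_row_max[OF x(1) y]])
  qed (use r d q a in auto)
  also have "\<dots> \<le> ennreal ((sqrt 2 * sqrt ?v + sqrt 2 * sqrt ?g + 2 * sqrt (24 / 5 * r) * a) powr (2 * q))"
  proof -
    have "sqrt (2 * ?t) \<le> sqrt (2 * (?v + ?g))"
      using spec_norm_mean_gram_le[OF x] by simp
    also have "\<dots> \<le> sqrt 2 * sqrt ?v + sqrt 2 * sqrt ?g"
      unfolding real_sqrt_mult distrib_left[symmetric]
      by (intro mult_left_mono sqrt_add_le_add_sqrt) auto
    finally show ?thesis
      using r q a by (intro ennreal_leI powr_mono2) auto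
  qed
  finally show ?thesis unfolding gram_W .
qed

context
  assumes square_integrable: "\<And>i j. integrable (M \<Otimes>\<^sub>M M) (\<lambda>(x, y). h i j x y ** h i j x y)"
begin

interpretation MM: pair_sigma_finite M M ..

lemma AE_square_integrable_at: "AE x in PM. square_integrable_at x"
proof -
  have "AE x in M. integrable M (\<lambda>y. h i j x y ** h i j x y)" for i j
    using MM.AE_integrable_fst'[OF square_integrable[of i j]] by simp
  then have "AE x in PM. integrable M (\<lambda>y. h i j (x i) y ** h i j (x i) y)" for i j
    by (intro AE_PiM_component prob_space_axioms) auto
  then show ?thesis
    unfolding square_integrable_at_def by (simp add: AE_all_countable)
qed

text \<open>The summands are functions of the separate x i, so the bound for independent positive
  semidefinite sums applies once more, now to d x d matrices.\<close>

lemma row_moment: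
  assumes r: "1 \<le> r" and d: "real CARD('d) \<le> exp (r - 1)" and q: "1 \<le> q" "q \<le> r"
    and al: "0 \<le> \<alpha>" "(\<integral>\<^sup>+x. \<integral>\<^sup>+y. ennreal (row_max x y powr q) \<partial>PM \<partial>PM) \<le> ennreal (\<alpha> powr (2 * q))"
  shows "(\<integral>\<^sup>+x. ennreal (spec_norm (\<Sum>i\<in>UNIV. \<Sum>j\<in>UNIV. cond_square i j (x i)) powr q) \<partial>PM)
    \<le> ennreal ((sqrt 2 * sqrt (spec_norm (\<Sum>i\<in>UNIV. \<Sum>j\<in>UNIV. \<integral>z. h i j (fst z) (snd z) ** h i j (fst z) (snd z) \<partial>(M \<Otimes>\<^sub>M M)))
      + 2 * sqrt (24 / 5 * r) * \<alpha>) powr (2 * q))"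
proof -
  let ?W = "\<lambda>i x. \<Sum>j\<in>UNIV. cond_square i j x"
  define \<mu> where "\<mu> x = Max (range (\<lambda>i. spec_norm (?W i (x i))))" for x
  have [measurable]: "\<mu> \<in> borel_measurable PM"
    unfolding \<mu>_def by (intro borel_measurable_Max) auto
  have int: "integrable M (cond_square i j)"
    "(\<integral>x. cond_square i j x \<partial>M) = (\<integral>z. h i j (fst z) (snd z) ** h i j (fst z) (snd z) \<partial>(M \<Otimes>\<^sub>M M))" for i j
    using MM.integrable_fst'[OF square_integrable[of i j]] MM.integral_fst'[OF square_integrable[of i j]]
    by (simp_all add: cond_square_def[abs_def] case_prod_beta')
  have mean: "(\<integral>x. ?W i x \<partial>M) = (\<Sum>j\<in>UNIV. \<integral>z. h i j (fst z) (snd z) ** h i j (fst z) (snd z) \<partial>(M \<Otimes>\<^sub>M M))" for i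
    by (simp add: int)
  have "(\<integral>\<^sup>+x. ennreal (spec_norm (\<Sum>i\<in>UNIV. ?W i (x i)) powr q) \<partial>PM)
     \<le> ennreal ((sqrt (2 * spec_norm (\<Sum>i\<in>UNIV. \<integral>x. ?W i x \<partial>M)) + 2 * sqrt (24 / 5 * r) * \<alpha>) powr (2 * q))"
  proof (rule psd_sum_moment[where \<mu> = \<mu> and d = "real CARD('d)"])
    show "integrable M (?W i)" for i using int by auto
    show "psd_mat (?W i x)" if "x \<in> space M" for i x
      using that by (intro psd_sum psd_cond_square)
    show "rtrace (\<Sum>i\<in>UNIV. ?W i (x i)) \<le> 2 * real CARD('d) * spec_norm (\<Sum>i\<in>UNIV. ?W i (x i))" for x
      by (rule order_trans[OF rtrace_le]) (simp add: mult_right_mono)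
    show "spec_norm (?W i (x i)) \<le> \<mu> x" for i x
      unfolding \<mu>_def by (rule Max_ge) auto
    have "(\<integral>\<^sup>+x. ennreal (\<mu> x powr q) \<partial>PM) \<le> (\<integral>\<^sup>+x. \<integral>\<^sup>+y. ennreal (row_max x y powr q) \<partial>PM \<partial>PM)"
    proof (rule nn_integral_mono_AE)
      show "AE x in PM. ennreal (\<mu> x powr q) \<le> (\<integral>\<^sup>+y. ennreal (row_max x y powr q) \<partial>PM)"
        using AE_square_integrable_at AE_space
      proof eventually_elim
        case (elim x)
        then have sq: "integrable M (\<lambda>y. h i j (x i) y ** h i j (x i) y)" for i j
          by (simp add: square_integrable_at_def)
        \<comment> \<open>The maximising row depends on \<open>x\<close> alone and is fixed while
          \<open>y\<close> varies. Its conditional mean is then bounded by Jensen, and the row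
          itself by \<open>row_max x y\<close>.\<close>
        have "\<mu> x \<in> range (\<lambda>i. spec_norm (?W i (x i)))" unfolding \<mu>_def by (intro Max_in) auto
        then obtain i where i: "\<mu> x = spec_norm (?W i (x i))" by blast
        let ?Z = "\<lambda>y. \<Sum>j\<in>UNIV. h i j (x i) (y j) ** h i j (x i) (y j)"
        have Z: "integrable PM ?Z" "(\<integral>y. ?Z y \<partial>PM) = ?W i (x i)"
        proof -
          have "integrable PM (\<lambda>y. h i j (x i) (y j) ** h i j (x i) (y j))"
            "(\<integral>y. h i j (x i) (y j) ** h i j (x i) (y j) \<partial>PM) = cond_square i j (x i)" for j
            unfolding cond_square_def by (rule integral_iid_component[OF sq])+
          then show "integrable PM ?Z" "(\<integral>y. ?Z y \<partial>PM) = ?W i (x i)"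
            by simp_all
        qed
        have "ennreal (\<mu> x powr q) \<le> (\<integral>\<^sup>+y. ennreal (spec_norm (?Z y) powr q) \<partial>PM)"
          using P.jensen_spec_norm[OF Z(1) q(1)] by (simp add: i Z(2))
        also have "\<dots> \<le> (\<integral>\<^sup>+y. ennreal (row_max x y powr q) \<partial>PM)"
          using q by (intro nn_integral_mono ennreal_leI powr_mono2 row_max_ge) auto
        finally show ?case .
      qed
    qed
    then show "(\<integral>\<^sup>+x. ennreal (\<mu> x powr q) \<partial>PM) \<le> ennreal (\<alpha> powr (2 * q))"
      using al(2) by (rule order_trans)
  qed (use r d q al in auto)
  then show ?thesis by (simp add: mean real_sqrt_mult)
qed

text \<open>Minkowski in \<open>x\<close> applied to the conditional bound. The maximum enters
  twice: through \<open>row_moment\<close>, and through the conditional moment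
  \<open>a x\<close>.\<close>

lemma gram_moment:
  assumes r: "1 \<le> r" and d: "real CARD('d) \<le> exp (r - 1)" and q: "1 \<le> q" "q \<le> r"
    and al: "0 \<le> \<alpha>" "(\<integral>\<^sup>+x. \<integral>\<^sup>+y. ennreal (row_max x y powr q) \<partial>PM \<partial>PM) \<le> ennreal (\<alpha> powr (2 * q))"
    and ga: "0 \<le> \<gamma>" "(\<integral>\<^sup>+x. ennreal (spec_norm (cond_block x) powr q) \<partial>PM) \<le> ennreal (\<gamma> powr (2 * q))"
  defines "\<beta> \<equiv> sqrt (spec_norm (\<Sum>i\<in>UNIV. \<Sum>j\<in>UNIV. \<integral>z. h i j (fst z) (snd z) ** h i j (fst z) (snd z) \<partial>(M \<Otimes>\<^sub>M M)))"
  shows "(\<integral>\<^sup>+x. \<integral>\<^sup>+y. ennreal (spec_norm (gram (\<lambda>i j. h i j (x i) (y j))) powr q) \<partial>PM \<partial>PM)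
    \<le> ennreal ((sqrt 2 * (sqrt 2 * \<beta> + 2 * sqrt (24 / 5 * r) * \<alpha>) + sqrt 2 * \<gamma> + 2 * sqrt (24 / 5 * r) * \<alpha>) powr (2 * q))"
proof -
  let ?v = "\<lambda>x. spec_norm (\<Sum>i\<in>UNIV. \<Sum>j\<in>UNIV. cond_square i j (x i))"
  let ?k = "2 * sqrt (24 / 5 * r)"
  let ?A = "\<lambda>x. \<integral>\<^sup>+y. ennreal (row_max y x powr q) \<partial>PM"
  define a where "a x = enn2real (?A x) powr (1 / (2 * q))" for x
  have b0: "0 \<le> \<beta>" by (simp add: \<beta>_def)
  have k0: "0 \<le> ?k" using r by simp
  \<comment> \<open>Fubini and an exchange of the two samples, which have the same law, reduce the
    column version to the assumed row version.\<close>
  have A_int: "(\<integral>\<^sup>+x. ?A x \<partial>PM) \<le> ennreal (\<alpha> powr (2 * q))"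
    using al(2) by (subst PP.Fubini') auto
  have "(\<integral>\<^sup>+x. ?A x \<partial>PM) \<noteq> \<infinity>" using A_int by (auto simp: top_unique)
  then have A_fin: "AE x in PM. ?A x \<noteq> \<infinity>" by (intro nn_integral_noteq_infinite) auto
  have a_pow: "ennreal (a x powr (2 * q)) \<le> ?A x" for x
    using q by (cases "?A x") (simp_all add: a_def powr_powr)
  have a_fin: "?A x \<le> ennreal (a x powr (2 * q))" if "?A x \<noteq> \<infinity>" for x
    using that q by (cases "?A x") (simp_all add: a_def powr_powr)
  have am [measurable]: "a \<in> borel_measurable PM" unfolding a_def by measurable
  have v: "lp_le PM (\<lambda>x. sqrt (?v x)) (2 * q) (sqrt 2 * \<beta> + ?k * \<alpha>)"
    using row_moment[OF r d q al] by (intro lp_le_sqrt) (auto simp: \<beta>_def)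
  have g: "lp_le PM (\<lambda>x. sqrt (spec_norm (cond_block x))) (2 * q) \<gamma>"
    using ga by (intro lp_le_sqrt) auto
  have "(\<integral>\<^sup>+x. ennreal (a x powr (2 * q)) \<partial>PM) \<le> (\<integral>\<^sup>+x. ?A x \<partial>PM)"
    by (intro nn_integral_mono a_pow)
  then have a: "lp_le PM a (2 * q) \<alpha>"
    unfolding lp_le_def using A_int by (rule order_trans)
  have "lp_le PM (\<lambda>x. sqrt 2 * sqrt (?v x) + sqrt 2 * sqrt (spec_norm (cond_block x)) + ?k * a x) (2 * q)
    (sqrt 2 * (sqrt 2 * \<beta> + ?k * \<alpha>) + sqrt 2 * \<gamma> + ?k * \<alpha>)"
  proof (intro lp_le_add lp_le_cmult v g a)
    show "0 \<le> a x" for x by (simp add: a_def)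
  qed (use q r al ga b0 k0 in \<open>auto simp: a_def\<close>)
  moreover have "(\<integral>\<^sup>+x. \<integral>\<^sup>+y. ennreal (spec_norm (gram (\<lambda>i j. h i j (x i) (y j))) powr q) \<partial>PM \<partial>PM)
    \<le> (\<integral>\<^sup>+x. ennreal ((sqrt 2 * sqrt (?v x) + sqrt 2 * sqrt (spec_norm (cond_block x)) + ?k * a x) powr (2 * q)) \<partial>PM)"
  proof (rule nn_integral_mono_AE)
    show "AE x in PM. (\<integral>\<^sup>+y. ennreal (spec_norm (gram (\<lambda>i j. h i j (x i) (y j))) powr q) \<partial>PM)
      \<le> ennreal ((sqrt 2 * sqrt (?v x) + sqrt 2 * sqrt (spec_norm (cond_block x)) + ?k * a x) powr (2 * q))"
      using AE_square_integrable_at A_fin AE_space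
    proof eventually_elim
      case (elim x)
      then show ?case
        by (intro gram_cond_moment r d q a_fin) (auto simp: a_def)
    qed
  qed
  ultimately show ?thesis by (simp add: lp_le_def)
qed

end

end

subsection \<open>Transfer to the original probability space\<close>

lemma epowr_mono: "a \<le> b \<Longrightarrow> 0 \<le> p \<Longrightarrow> epowr a p \<le> epowr b p"
  by (cases a; cases b) (auto simp: epowr_def top_unique intro!: ennreal_leI powr_mono2)

lemma epowr_ennreal: "0 \<le> c \<Longrightarrow> epowr (ennreal c) p = ennreal (c powr p)"
  by (simp add: epowr_def)

lemma epowr_powr_inverse: "0 \<le> c \<Longrightarrow> 0 < s \<Longrightarrow> epowr (ennreal (c powr s)) (1 / s) = ennreal c"
  by (simp add: epowr_ennreal powr_powr)

lemma epowr_mult_powr: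
  assumes "0 < k" "0 < s"
  shows "epowr (ennreal (k powr s) * I) (1 / s) = ennreal k * epowr I (1 / s)"
proof (cases I)
  case (real l)
  then show ?thesis
    using assms by (simp add: epowr_ennreal powr_mult powr_powr flip: ennreal_mult)
next
  case top
  then show ?thesis using assms by (simp add: epowr_def ennreal_mult_top)
qed

lemma epowr_finite:
  assumes "0 < s" "epowr I (1 / s) \<noteq> \<infinity>"
  obtains c where "0 \<le> c" "I = ennreal (c powr s)" "epowr I (1 / s) = ennreal c"
proof (cases I)
  case (real l)
  have "(l powr (1 / s)) powr s = l" using assms real by (simp add: powr_powr)
  with real that[of "l powr (1 / s)"] show thesis by (simp add: epowr_ennreal)
qed (use assms in \<open>simp add: epowr_def\<close>)

lemma weighted_sum_eq_top:
  fixes a b c k l m :: ennreal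
  assumes "m \<noteq> 0" "k \<noteq> 0" "l \<noteq> 0" "a = \<infinity> \<or> c = \<infinity> \<or> b = \<infinity>"
  shows "m * (k * a + l * b + l * c) = \<infinity>"
  using assms by (auto simp: ennreal_mult_eq_top_iff)

lemma ennreal_weighted_sum:
  assumes "0 \<le> m" "0 \<le> k" "0 \<le> l" "0 \<le> a" "0 \<le> b" "0 \<le> c"
  shows "ennreal (m * (k * a + l * b + l * c))
    = ennreal m * (ennreal k * ennreal a + ennreal l * ennreal b + ennreal l * ennreal c)"
  using assms by (simp add: ennreal_mult)

lemma sum_offdiag: "(\<Sum>(i, j)\<in>offdiag. g i j) = (\<Sum>i\<in>UNIV. \<Sum>j\<in>UNIV. if i = j then 0 else g i j)"
  for g :: "'i::finite \<Rightarrow> 'i \<Rightarrow> 'b::comm_monoid_add"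
proof -
  have "(\<Sum>(i, j)\<in>offdiag. g i j) = (\<Sum>(i, j)\<in>UNIV. if i = j then 0 else g i j)"
    by (rule sum.mono_neutral_cong_left) (auto simp: offdiag_def)
  then show ?thesis by (simp add: sum_UNIV_prod)
qed

lemma sum_neq: "(\<Sum>j\<in>{j. j \<noteq> i}. g j) = (\<Sum>j\<in>UNIV. if i = j then 0 else g j)"
  for g :: "'i::finite \<Rightarrow> 'b::comm_monoid_add"
  by (rule sum.mono_neutral_cong_left) auto

section \<open>The joint law of the two samples\<close>

lemma measurable_join_iid:
  "(\<lambda>(x, y) a. if fst a then x (snd a) else y (snd a))
    \<in> iid_prod N \<Otimes>\<^sub>M iid_prod N \<rightarrow>\<^sub>M (iid_prod N :: (bool \<times> 'i \<Rightarrow> 's) measure)"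
proof -
  have "(\<lambda>z a. if fst a then fst z (snd a) else snd z (snd a))
    \<in> iid_prod N \<Otimes>\<^sub>M iid_prod N \<rightarrow>\<^sub>M (iid_prod N :: (bool \<times> 'i \<Rightarrow> 's) measure)"
  proof (rule measurable_PiM_single')
    fix a :: "bool \<times> 'i"
    show "(\<lambda>z. if fst a then fst z (snd a) else snd z (snd a)) \<in> iid_prod N \<Otimes>\<^sub>M iid_prod N \<rightarrow>\<^sub>M N"
      by (cases "fst a") auto
  qed (auto simp: space_pair_measure space_PiM PiE_iff)
  then show ?thesis by (simp add: case_prod_beta')
qed

text \<open>Independence is assumed for all variables jointly, indexed by tagged indices in bool x
  'i. This identity splits that product measure into two independent samples.\<close>

lemma (in prob_space) distr_join_iid:
  "distr (iid_prod M \<Otimes>\<^sub>M iid_prod M) (iid_prod M) (\<lambda>(x, y) a. if fst a then x (snd a) else y (snd a))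
    = (iid_prod M :: (bool \<times> 'i::finite \<Rightarrow> 'a) measure)" (is "distr _ _ ?J = _")
proof -
  interpret PP: prob_space "iid_prod M :: ('i \<Rightarrow> 'a) measure" by (rule prob_space_iid_prod)
  interpret Q: product_prob_space "\<lambda>_::bool \<times> 'i. M" UNIV by standard
  interpret P: product_prob_space "\<lambda>_::'i. M" UNIV by standard
  show ?thesis
  proof (rule Q.PiM_eqI)
    fix A :: "bool \<times> 'i \<Rightarrow> 'a set" assume A: "\<And>a. a \<in> UNIV \<Longrightarrow> A a \<in> sets M"
    define B where "B b = Pi\<^sub>E UNIV (\<lambda>i. A (b, i))" for b
    have B: "B b \<in> sets (iid_prod M)" for b
      unfolding B_def using A by (intro sets_PiM_I_finite) auto
    have "emeasure (distr (iid_prod M \<Otimes>\<^sub>M iid_prod M) (iid_prod M) ?J) (Pi\<^sub>E UNIV A)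
      = emeasure (iid_prod M \<Otimes>\<^sub>M iid_prod M) (?J -` Pi\<^sub>E UNIV A \<inter> space (iid_prod M \<Otimes>\<^sub>M iid_prod M))"
      using A by (intro emeasure_distr measurable_join_iid sets_PiM_I_finite) auto
    also have "?J -` Pi\<^sub>E UNIV A \<inter> space (iid_prod M \<Otimes>\<^sub>M iid_prod M) = B True \<times> B False"
    proof -
      have "A a \<subseteq> space M" for a using A sets.sets_into_space by blast
      then show ?thesis
        by (auto simp: B_def space_pair_measure space_PiM PiE_iff split: if_splits) (blast | metis (full_types))+
    qed
    also have "emeasure (iid_prod M \<Otimes>\<^sub>M iid_prod M) (B True \<times> B False)
      = emeasure (iid_prod M) (B True) * emeasure (iid_prod M) (B False)"
      by (rule PP.emeasure_pair_measure_Times[OF B B])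
    also have "\<dots> = (\<Prod>b\<in>UNIV. \<Prod>i\<in>UNIV. emeasure M (A (b, i)))"
      unfolding B_def using A by (subst (1 2) P.emeasure_PiM) (auto simp: UNIV_bool mult.commute)
    also have "\<dots> = (\<Prod>a\<in>UNIV. emeasure M (A a))"
      by (simp add: prod.cartesian_product flip: UNIV_Times_UNIV)
    finally show "emeasure (distr (iid_prod M \<Otimes>\<^sub>M iid_prod M) (iid_prod M) ?J) (Pi\<^sub>E UNIV A) = (\<Prod>a\<in>UNIV. emeasure M (A a))" .
  qed auto
qed

lemma (in prob_space) distr_iid:
  fixes Y :: "'j::finite \<Rightarrow> 'a \<Rightarrow> 's"
  assumes Y: "indep_vars (\<lambda>_. S) Y UNIV" and N: "\<And>j. distr M S (Y j) = N"
  shows "distr M (iid_prod N) (\<lambda>\<omega> j. Y j \<omega>) = iid_prod N"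
proof -
  have "\<And>j. Y j \<in> M \<rightarrow>\<^sub>M S" using Y unfolding indep_vars_def by auto
  then have eq: "distr M (PiM UNIV (\<lambda>_. S)) (\<lambda>\<omega>. \<lambda>j\<in>UNIV. Y j \<omega>) = iid_prod N"
    using Y by (subst (asm) indep_vars_iff_distr_eq_PiM') (auto simp: N)
  have "sets S = sets N" by (metis N sets_distr)
  then have "sets (iid_prod N :: ('j \<Rightarrow> 's) measure) = sets (PiM UNIV (\<lambda>_. S))"
    by (intro sets_PiM_cong) auto
  then have "distr M (iid_prod N) (\<lambda>\<omega> j. Y j \<omega>) = distr M (PiM UNIV (\<lambda>_. S)) (\<lambda>\<omega>. \<lambda>j\<in>UNIV. Y j \<omega>)"
    by (intro distr_cong) auto
  with eq show ?thesis by (rule trans[rotated])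
qed

lemma (in prob_space) distr_iid_pair:
  fixes X1 X2 :: "'i::finite \<Rightarrow> 'a \<Rightarrow> 's"
  assumes Y: "indep_vars (\<lambda>_. S) (\<lambda>(b, i). if b then X1 i else X2 i) UNIV"
    and N: "\<And>i. distr M S (X1 i) = N" "\<And>i. distr M S (X2 i) = N"
  shows "distr M (iid_prod N \<Otimes>\<^sub>M iid_prod N) (\<lambda>\<omega>. (\<lambda>i. X1 i \<omega>, \<lambda>i. X2 i \<omega>)) = iid_prod N \<Otimes>\<^sub>M iid_prod N"
proof -
  let ?Y = "\<lambda>a. if fst a then X1 (snd a) else X2 (snd a)"
  have Y': "indep_vars (\<lambda>_. S) ?Y UNIV" using Y by (simp add: case_prod_beta')
  have X: "?Y a \<in> M \<rightarrow>\<^sub>M S" for a using Y' unfolding indep_vars_def by blast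
  have S: "sets N = sets S" by (metis N(1) sets_distr)
  have X12 [measurable]: "X1 i \<in> M \<rightarrow>\<^sub>M N" "X2 i \<in> M \<rightarrow>\<^sub>M N" for i
    using X[of "(True, i)"] X[of "(False, i)"] by (simp_all add: measurable_cong_sets[OF refl S])
  interpret N: prob_space N using N(1)[of undefined, symmetric] X[of "(True, undefined)"] prob_space_distr by simp
  \<comment> \<open>\<open>?s\<close> undoes \<open>?J\<close>, so transporting along both returns
    the pair measure.\<close>
  let ?s = "\<lambda>z :: bool \<times> 'i \<Rightarrow> 's. (\<lambda>i. z (True, i), \<lambda>i. z (False, i))"
  let ?J = "\<lambda>(x, y) a. if fst a then x (snd a) else y (snd a)"
  have s: "?s \<in> iid_prod N \<rightarrow>\<^sub>M iid_prod N \<Otimes>\<^sub>M iid_prod N"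
    by (intro measurable_Pair measurable_PiM_single') (auto simp: space_PiM PiE_iff)
  have Z: "(\<lambda>\<omega> a. ?Y a \<omega>) \<in> M \<rightarrow>\<^sub>M iid_prod N"
  proof (rule measurable_PiM_single')
    show "(\<lambda>\<omega>. ?Y a \<omega>) \<in> M \<rightarrow>\<^sub>M N" for a by (cases "fst a") auto
    show "(\<lambda>\<omega> a. ?Y a \<omega>) \<in> space M \<rightarrow> UNIV \<rightarrow>\<^sub>E space N"
      using X12[THEN measurable_space] by auto
  qed
  have Q: "distr M (iid_prod N) (\<lambda>\<omega> a. ?Y a \<omega>) = iid_prod N"
    by (rule distr_iid[OF Y']) (simp add: N)
  have "distr M (iid_prod N \<Otimes>\<^sub>M iid_prod N) (\<lambda>\<omega>. (\<lambda>i. X1 i \<omega>, \<lambda>i. X2 i \<omega>))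
    = distr (distr M (iid_prod N) (\<lambda>\<omega> a. ?Y a \<omega>)) (iid_prod N \<Otimes>\<^sub>M iid_prod N) ?s"
    by (subst distr_distr[OF s Z]) (simp add: o_def)
  also have "\<dots> = distr (distr (iid_prod N \<Otimes>\<^sub>M iid_prod N) (iid_prod N) ?J) (iid_prod N \<Otimes>\<^sub>M iid_prod N) ?s"
    by (simp only: Q N.distr_join_iid)
  also have "\<dots> = distr (iid_prod N \<Otimes>\<^sub>M iid_prod N) (iid_prod N \<Otimes>\<^sub>M iid_prod N) (\<lambda>z. z)"
    by (subst distr_distr[OF s measurable_join_iid]) (simp add: o_def case_prod_beta')
  finally show ?thesis by (simp only: distr_id)
qed

text \<open>The mean term is the tight one: 4 * 48/5 * 2 = 384/5, about 76.8, against 128 / sqrt e,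
  about 77.6. The other two terms have room to spare.\<close>

lemma final_constant:
  fixes r \<alpha> \<beta> \<gamma> :: real
  assumes r: "1 \<le> r" and nn: "0 \<le> \<alpha>" "0 \<le> \<beta>" "0 \<le> \<gamma>"
  shows "4 * (48 / 5 * r * (sqrt 2 * (sqrt 2 * \<beta> + 2 * sqrt (24 / 5 * r) * \<alpha>) + sqrt 2 * \<gamma> + 2 * sqrt (24 / 5 * r) * \<alpha>))
    \<le> 128 / sqrt (exp 1) * (16 * r powr (3 / 2) * \<alpha> + r * \<beta> + r * \<gamma>)"
proof -
  \<comment> \<open>128 divided by 5/3 is exactly 384/5, and e < 2.72 < 25/9.\<close>
  have e: "384 / 5 \<le> 128 / sqrt (exp 1 :: real)"
  proof -
    have "sqrt (exp 1) \<le> sqrt ((5 / 3)\<^sup>2 :: real)"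
      using exp_1_less by (intro real_sqrt_le_mono) (simp add: power2_eq_square)
    then have "sqrt (exp 1) \<le> (5 / 3 :: real)" by simp
    then show ?thesis by (simp add: field_simps)
  qed
  have r32: "r powr (3 / 2) = r * sqrt r"
  proof -
    have "r powr (3 / 2) = r powr (1 + 1 / 2)" by simp
    also have "\<dots> = r * sqrt r" using r by (simp only: powr_add powr_half_sqrt) simp
    finally show ?thesis .
  qed
  have k: "sqrt (24 / 5 * r) \<le> 3 * sqrt r"
  proof -
    have "sqrt (24 / 5 * r) \<le> sqrt (9 * r)" using r by (intro real_sqrt_le_mono) auto
    then show ?thesis by (simp add: real_sqrt_mult)
  qed
  have s2: "sqrt 2 * sqrt 2 = (2 :: real)" "sqrt 2 \<le> (2 :: real)" using sqrt_2_less by simp_all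
  have "sqrt 2 * (sqrt 2 * \<beta> + 2 * sqrt (24 / 5 * r) * \<alpha>) + sqrt 2 * \<gamma> + 2 * sqrt (24 / 5 * r) * \<alpha>
    = 2 * \<beta> + sqrt 2 * \<gamma> + sqrt (24 / 5 * r) * ((2 * sqrt 2 + 2) * \<alpha>)"
    using s2(1) by (simp add: algebra_simps)
  \<comment> \<open>Here 3 (2 * 2 + 2) = 18 is rounded up to 32, twice the 16 of the claim.\<close>
  also have "\<dots> \<le> 2 * \<beta> + 2 * \<gamma> + (3 * sqrt r) * ((2 * 2 + 2) * \<alpha>)"
    using nn r k s2 by (intro add_mono mult_mono mult_right_mono) auto
  also have "\<dots> \<le> 2 * \<beta> + 2 * \<gamma> + 32 * sqrt r * \<alpha>"
    using nn r by (simp add: mult_right_mono)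
  finally have "4 * (48 / 5 * r * (sqrt 2 * (sqrt 2 * \<beta> + 2 * sqrt (24 / 5 * r) * \<alpha>) + sqrt 2 * \<gamma> + 2 * sqrt (24 / 5 * r) * \<alpha>))
    \<le> 4 * (48 / 5 * r * (2 * \<beta> + 2 * \<gamma> + 32 * sqrt r * \<alpha>))"
    using r by (intro mult_left_mono) auto
  also have "\<dots> = 384 / 5 * (16 * r powr (3 / 2) * \<alpha> + r * \<beta> + r * \<gamma>)"
    unfolding r32 by (simp add: algebra_simps)
  also have "\<dots> \<le> 128 / sqrt (exp 1) * (16 * r powr (3 / 2) * \<alpha> + r * \<beta> + r * \<gamma>)"
    using e nn r by (intro mult_right_mono) auto
  finally show ?thesis .
qed

theorem theorem3p1:
  fixes M :: "'a measure" and S :: "'s measure"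
    and X X1 X2 :: "'i::finite \<Rightarrow> 'a \<Rightarrow> 's"
    and H :: "'i \<Rightarrow> 'i \<Rightarrow> 's \<Rightarrow> 's \<Rightarrow> complex^'d::finite^'d"
    and q :: real
  assumes "prob_space M"
    and n2: "CARD('i) \<ge> 2"
    and iidX: "iid M S X UNIV"
    and iid12: "iid M S (\<lambda>(b, i). if b then X1 i else X2 i) UNIV"
    and copy: "\<forall>i. distr M S (X1 i) = distr M S (X i)"
    and meas: "\<forall>i j. i \<noteq> j \<longrightarrow> (\<lambda>(x, y). H i j x y) \<in> borel_measurable (S \<Otimes>\<^sub>M S)"
    and herm: "\<forall>i j x y. i \<noteq> j \<longrightarrow> x \<in> space S \<longrightarrow> y \<in> space S \<longrightarrow> hermitian_mat (H i j x y)"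
    and sym: "\<forall>i j x y. i \<noteq> j \<longrightarrow> x \<in> space S \<longrightarrow> y \<in> space S \<longrightarrow> H i j x y = H j i y x"
    and degen: "\<forall>i j k x. i \<noteq> j \<longrightarrow> x \<in> space S \<longrightarrow>
        integrable M (\<lambda>\<omega>. H i j x (X k \<omega>)) \<and> integral\<^sup>L M (\<lambda>\<omega>. H i j x (X k \<omega>)) = 0"
    and q1: "q \<ge> 1"
  defines "r \<equiv> max q (ln (exp 1 * real CARD('d)))"
  shows
    "moment M (\<lambda>\<omega>. spec_norm (\<Sum>(i, j)\<in>offdiag. H i j (X i \<omega>) (X j \<omega>))) (2 * q)
       \<le> 4 * moment M (\<lambda>\<omega>. spec_norm (\<Sum>(i, j)\<in>offdiag. H i j (X1 i \<omega>) (X2 j \<omega>))) (2 * q)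
     \<and>
     4 * moment M (\<lambda>\<omega>. spec_norm (\<Sum>(i, j)\<in>offdiag. H i j (X1 i \<omega>) (X2 j \<omega>))) (2 * q)
       \<le> ennreal (128 / sqrt (exp 1)) *
          (ennreal (16 * r powr (3 / 2)) *
             epowr (\<integral>\<^sup>+ \<omega>. ennreal ((Max (range (\<lambda>i. spec_norm
                 (\<Sum>j\<in>{j. j \<noteq> i}. H i j (X1 i \<omega>) (X2 j \<omega>) ** H i j (X1 i \<omega>) (X2 j \<omega>)))))
                 powr q) \<partial>M) (1 / (2 * q))
           + ennreal r *
             (if (\<forall>(i, j)\<in>offdiag. integrable M
                    (\<lambda>\<omega>. H i j (X1 i \<omega>) (X2 j \<omega>) ** H i j (X1 i \<omega>) (X2 j \<omega>)))
              then ennreal (sqrt (spec_norm (\<Sum>(i, j)\<in>offdiag. integral\<^sup>L M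
                    (\<lambda>\<omega>. H i j (X1 i \<omega>) (X2 j \<omega>) ** H i j (X1 i \<omega>) (X2 j \<omega>)))))
              else \<infinity>)
           + ennreal r *
             epowr (\<integral>\<^sup>+ \<omega>. epowr (E2_norm M H X1 X2 \<omega>) q \<partial>M) (1 / (2 * q)))"
proof -
  interpret prob_space M by fact
  \<comment> \<open>The common law of all observations; every expectation is carried over to powers
    of \<open>N\<close>.\<close>
  define N where "N = distr M S (X1 undefined)"
  have ind12: "indep_vars (\<lambda>_. S) (\<lambda>(b, i). if b then X1 i else X2 i) UNIV"
    and eq12: "\<And>a b. distr M S (case a of (b, i) \<Rightarrow> if b then X1 i else X2 i) = distr M S (case b of (b, i) \<Rightarrow> if b then X1 i else X2 i)"
    using iid12 by (auto simp: iid_def)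
  have N1: "distr M S (X1 i) = N" for i
    using eq12[of "(True, i)" "(True, undefined)"] by (simp add: N_def)
  have N2: "distr M S (X2 i) = N" for i
    using eq12[of "(False, i)" "(True, undefined)"] by (simp add: N_def)
  have NX: "distr M S (X i) = N" for i using copy N1 by simp
  have indX: "indep_vars (\<lambda>_. S) X UNIV" using iidX by (simp add: iid_def)
  have sN: "sets N = sets S" and spN: "space N = space S" by (simp_all add: N_def)
  have XS: "X i \<in> M \<rightarrow>\<^sub>M S" for i using indX unfolding indep_vars_def by blast
  have X12S: "(case a of (b, i) \<Rightarrow> if b then X1 i else X2 i) \<in> M \<rightarrow>\<^sub>M S" for a
    using ind12 unfolding indep_vars_def by blast
  have XN [measurable]: "X i \<in> M \<rightarrow>\<^sub>M N" "X1 i \<in> M \<rightarrow>\<^sub>M N" "X2 i \<in> M \<rightarrow>\<^sub>M N" for i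
    using XS[of i] X12S[of "(True, i)"] X12S[of "(False, i)"]
    by (simp_all add: measurable_cong_sets[OF refl sN])
  interpret N: prob_space N
    unfolding N_def using X12S[of "(True, undefined)"] by (intro prob_space_distr) simp
  define h where "h i j x y = (if i = j then 0 else H i j x y)" for i j x y
  have hH: "(if i = j then 0 else H i j x y) = h i j x y"
    "(if i = j then 0 else H i j x y ** H i j x y) = h i j x y ** h i j x y" for i j x y
    by (auto simp: h_def)
  have mean_h: "integrable N (\<lambda>y. h i j x y)" "(\<integral>y. h i j x y \<partial>N) = 0" if "x \<in> space N" for i j x
  proof -
    have "integrable N (\<lambda>y. h i j x y) \<and> (\<integral>y. h i j x y \<partial>N) = 0"
    proof (cases "i = j")
      case False
      then have m: "(\<lambda>y. H i j x y) \<in> borel_measurable S"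
        using meas that measurable_compose_Pair1[of x S "\<lambda>(x, y). H i j x y" S borel] by (auto simp: spN)
      have "distr M S (X undefined) = N" by (rule NX)
      with integrable_distr_eq[OF XS m] integral_distr[OF XS m] degen False that spN
      show ?thesis by (metis (no_types, lifting) Bochner_Integration.integrable_cong Bochner_Integration.integral_cong h_def)
    qed (simp add: h_def)
    then show "integrable N (\<lambda>y. h i j x y)" "(\<integral>y. h i j x y \<partial>N) = 0" by auto
  qed
  interpret K: degenerate_kernel N h
  proof
    fix i j
    have "(\<lambda>(x, y). h i j x y) \<in> borel_measurable (S \<Otimes>\<^sub>M S)"
      using meas by (cases "i = j") (simp_all add: h_def case_prod_beta')
    then show "(\<lambda>(x, y). h i j x y) \<in> borel_measurable (N \<Otimes>\<^sub>M N)"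
      by (subst measurable_cong_sets[OF sets_pair_measure_cong[OF sN sN] refl])
    fix x y assume "x \<in> space N" "y \<in> space N"
    then show "hermitian_mat (h i j x y)" "h i j x y = h j i y x"
      using herm sym by (auto simp: h_def spN hermitian_zero)
  qed (auto simp: h_def[of i i for i] intro: mean_h)
  let ?P = "iid_prod N :: ('i \<Rightarrow> 's) measure"
  have pair: "distr M (?P \<Otimes>\<^sub>M ?P) (\<lambda>\<omega>. (\<lambda>i. X1 i \<omega>, \<lambda>i. X2 i \<omega>)) = ?P \<Otimes>\<^sub>M ?P"
    by (rule distr_iid_pair[OF ind12 N1 N2])
  have mfun: "(\<lambda>\<omega> i. Y i \<omega>) \<in> M \<rightarrow>\<^sub>M ?P" if "\<And>i. Y i \<in> M \<rightarrow>\<^sub>M N" for Y :: "'i \<Rightarrow> 'a \<Rightarrow> 's"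
    using that by (intro measurable_PiM_single') (auto simp: PiE_iff dest: measurable_space)
  note [measurable] = mfun[of X1, OF XN(2)] mfun[of X2, OF XN(3)] mfun[of X, OF XN(1)]
  have nn_pair: "(\<integral>\<^sup>+\<omega>. F (\<lambda>i. X1 i \<omega>) (\<lambda>i. X2 i \<omega>) \<partial>M) = (\<integral>\<^sup>+x. \<integral>\<^sup>+y. F x y \<partial>?P \<partial>?P)"
    if F: "(\<lambda>z. F (fst z) (snd z)) \<in> borel_measurable (?P \<Otimes>\<^sub>M ?P)" for F
  proof -
    have "(\<integral>\<^sup>+x. \<integral>\<^sup>+y. F x y \<partial>?P \<partial>?P)
      = (\<integral>\<^sup>+z. F (fst z) (snd z) \<partial>distr M (?P \<Otimes>\<^sub>M ?P) (\<lambda>\<omega>. (\<lambda>i. X1 i \<omega>, \<lambda>i. X2 i \<omega>)))"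
      unfolding pair by (rule K.nn_integral_pair[OF F])
    also have "\<dots> = (\<integral>\<^sup>+\<omega>. F (\<lambda>i. X1 i \<omega>) (\<lambda>i. X2 i \<omega>) \<partial>M)"
      using F by (subst nn_integral_distr) auto
    finally show ?thesis ..
  qed
  have X2P: "distr M ?P (\<lambda>\<omega> i. X2 i \<omega>) = ?P"
  proof -
    \<comment> \<open>Merging along the empty set is the second projection.\<close>
    have "distr (?P \<Otimes>\<^sub>M ?P) ?P snd = ?P"
      using N.distr_merge_on[of "{} :: 'i set"] by (simp add: merge_on_def case_prod_beta')
    then have "distr (distr M (?P \<Otimes>\<^sub>M ?P) (\<lambda>\<omega>. (\<lambda>i. X1 i \<omega>, \<lambda>i. X2 i \<omega>))) ?P snd = ?P"
      by (simp only: pair)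
    then show ?thesis by (subst (asm) distr_distr) (auto simp: o_def)
  qed
  have NN: "distr M (N \<Otimes>\<^sub>M N) (\<lambda>\<omega>. (X1 i \<omega>, X2 j \<omega>)) = N \<Otimes>\<^sub>M N" for i j
  proof -
    have comp: "distr ?P N (\<lambda>x. x i) = N" for i
      by (rule distr_PiM_component) (auto intro: N.prob_space_axioms)
    have "distr ?P N (\<lambda>x. x i) \<Otimes>\<^sub>M distr ?P N (\<lambda>x. x j)
      = distr (?P \<Otimes>\<^sub>M ?P) (N \<Otimes>\<^sub>M N) (\<lambda>(x, y). (x i, y j))"
      by (rule pair_measure_distr) (auto simp: comp intro: N.sigma_finite_measure_axioms)
    then have "N \<Otimes>\<^sub>M N = distr (?P \<Otimes>\<^sub>M ?P) (N \<Otimes>\<^sub>M N) (\<lambda>z. (fst z i, snd z j))"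
      by (simp add: comp case_prod_beta')
    also have "\<dots> = distr (distr M (?P \<Otimes>\<^sub>M ?P) (\<lambda>\<omega>. (\<lambda>i. X1 i \<omega>, \<lambda>i. X2 i \<omega>))) (N \<Otimes>\<^sub>M N) (\<lambda>z. (fst z i, snd z j))"
      by (simp only: pair)
    also have "\<dots> = distr M (N \<Otimes>\<^sub>M N) (\<lambda>\<omega>. (X1 i \<omega>, X2 j \<omega>))"
      by (subst distr_distr) (auto simp: o_def)
    finally show ?thesis ..
  qed
  have q0: "0 < 2 * q" using q1 by simp
  have r: "1 \<le> r" "q \<le> r" using q1 by (auto simp: r_def)
  have "ln (real CARD('d)) \<le> r - 1"
  proof -
    have "1 + ln (real CARD('d)) = ln (exp 1 * real CARD('d))" by (simp add: ln_mult)
    also have "\<dots> \<le> r" by (simp add: r_def)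
    finally show ?thesis by simp
  qed
  then have "exp (ln (real CARD('d))) \<le> exp (r - 1)" by (rule exp_le_cancel_iff[THEN iffD2])
  then have d: "real CARD('d) \<le> exp (r - 1)" by simp
  let ?R = "\<integral>\<^sup>+x. \<integral>\<^sup>+y. ennreal (spec_norm (\<Sum>i\<in>UNIV. \<Sum>j\<in>UNIV. h i j (x i) (y j)) powr (2 * q)) \<partial>?P \<partial>?P"
  have mom2: "moment M (\<lambda>\<omega>. spec_norm (\<Sum>(i, j)\<in>offdiag. H i j (X1 i \<omega>) (X2 j \<omega>))) (2 * q) = epowr ?R (1 / (2 * q))"
    unfolding moment_def sum_offdiag hH by (subst nn_pair[symmetric]) auto
  have mom1: "moment M (\<lambda>\<omega>. spec_norm (\<Sum>(i, j)\<in>offdiag. H i j (X i \<omega>) (X j \<omega>))) (2 * q)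
    = epowr (\<integral>\<^sup>+x. ennreal (spec_norm (\<Sum>i\<in>UNIV. \<Sum>j\<in>UNIV. h i j (x i) (x j)) powr (2 * q)) \<partial>?P) (1 / (2 * q))"
  proof -
    let ?F = "\<lambda>x. ennreal (spec_norm (\<Sum>i\<in>UNIV. \<Sum>j\<in>UNIV. h i j (x i) (x j)) powr (2 * q))"
    have "(\<integral>\<^sup>+x. ?F x \<partial>?P) = (\<integral>\<^sup>+x. ?F x \<partial>distr M ?P (\<lambda>\<omega> i. X i \<omega>))"
      by (simp only: distr_iid[OF indX NX])
    also have "\<dots> = (\<integral>\<^sup>+\<omega>. ?F (\<lambda>i. X i \<omega>) \<partial>M)"
      by (rule nn_integral_distr) measurable
    finally show ?thesis unfolding moment_def sum_offdiag hH by simp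
  qed
  have first: "moment M (\<lambda>\<omega>. spec_norm (\<Sum>(i, j)\<in>offdiag. H i j (X i \<omega>) (X j \<omega>))) (2 * q)
    \<le> 4 * moment M (\<lambda>\<omega>. spec_norm (\<Sum>(i, j)\<in>offdiag. H i j (X1 i \<omega>) (X2 j \<omega>))) (2 * q)"
  proof -
    have "epowr (\<integral>\<^sup>+x. ennreal (spec_norm (\<Sum>i\<in>UNIV. \<Sum>j\<in>UNIV. h i j (x i) (x j)) powr (2 * q)) \<partial>?P) (1 / (2 * q))
      \<le> epowr (ennreal (4 powr (2 * q)) * ?R) (1 / (2 * q))"
      using q1 by (intro epowr_mono K.decoupling) auto
    also have "\<dots> = 4 * epowr ?R (1 / (2 * q))"
      using q0 by (subst epowr_mult_powr) simp_all
    finally show ?thesis unfolding mom1 mom2 .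
  qed
  let ?A = "\<integral>\<^sup>+ \<omega>. ennreal ((Max (range (\<lambda>i. spec_norm
                 (\<Sum>j\<in>{j. j \<noteq> i}. H i j (X1 i \<omega>) (X2 j \<omega>) ** H i j (X1 i \<omega>) (X2 j \<omega>))))) powr q) \<partial>M"
  let ?C = "\<integral>\<^sup>+ \<omega>. epowr (E2_norm M H X1 X2 \<omega>) q \<partial>M"
  let ?int = "\<forall>(i, j)\<in>offdiag. integrable M (\<lambda>\<omega>. H i j (X1 i \<omega>) (X2 j \<omega>) ** H i j (X1 i \<omega>) (X2 j \<omega>))"
  let ?B = "sqrt (spec_norm (\<Sum>(i, j)\<in>offdiag. integral\<^sup>L M
                    (\<lambda>\<omega>. H i j (X1 i \<omega>) (X2 j \<omega>) ** H i j (X1 i \<omega>) (X2 j \<omega>))))"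
  have A: "?A = (\<integral>\<^sup>+x. \<integral>\<^sup>+y. ennreal (K.row_max x y powr q) \<partial>?P \<partial>?P)"
    unfolding sum_neq hH K.row_max_def[symmetric] by (rule nn_pair) measurable
  \<comment> \<open>Only an inequality: where the integrand is not integrable,
    \<open>cond_block\<close> is 0 while \<open>E2_norm\<close> is infinite.\<close>
  have E2: "ennreal (spec_norm (K.cond_block (\<lambda>i. X1 i \<omega>)) powr q) \<le> epowr (E2_norm M H X1 X2 \<omega>) q" if "\<omega> \<in> space M" for \<omega>
  proof -
    let ?F = "\<lambda>y. block_matrix (\<lambda>i j. h i j (X1 i \<omega>) (y j)) ** adj_mat (block_matrix (\<lambda>i j. h i j (X1 i \<omega>) (y j)))"
    have F: "block_G H (\<lambda>i. X1 i \<omega>) (\<lambda>j. X2 j \<omega>') ** adj_mat (block_G H (\<lambda>i. X1 i \<omega>) (\<lambda>j. X2 j \<omega>'))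
      = ?F (\<lambda>j. X2 j \<omega>')" for \<omega>'
    proof -
      have "block_G H (\<lambda>i. X1 i \<omega>) (\<lambda>j. X2 j \<omega>') = block_matrix (\<lambda>i j. h i j (X1 i \<omega>) (X2 j \<omega>'))"
        by (simp add: block_G_def block_matrix_def h_def vec_eq_iff)
      then show ?thesis by simp
    qed
    have [measurable]: "(\<lambda>y. h i j (X1 i \<omega>) y) \<in> borel_measurable N" for i j
      by (rule borel_measurable_integrable[OF mean_h(1)[OF measurable_space[OF XN(2) that]]])
    have "K.cond_block (\<lambda>i. X1 i \<omega>) = (\<integral>y. ?F y \<partial>distr M ?P (\<lambda>\<omega> i. X2 i \<omega>))"
      unfolding X2P K.cond_block_def ..
    also have "\<dots> = (\<integral>\<omega>'. ?F (\<lambda>j. X2 j \<omega>') \<partial>M)"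
      by (rule integral_distr) measurable
    finally show ?thesis
      using q1 by (simp add: E2_norm_def F Let_def epowr_ennreal) (simp add: epowr_def)
  qed
  have C: "(\<integral>\<^sup>+x. ennreal (spec_norm (K.cond_block x) powr q) \<partial>?P) \<le> ?C"
  proof -
    have "(\<integral>\<^sup>+x. ennreal (spec_norm (K.cond_block x) powr q) \<partial>?P)
      = (\<integral>\<^sup>+x. \<integral>\<^sup>+y. ennreal (spec_norm (K.cond_block x) powr q) \<partial>?P \<partial>?P)"
      by (simp add: K.P.emeasure_space_1)
    also have "\<dots> = (\<integral>\<^sup>+\<omega>. ennreal (spec_norm (K.cond_block (\<lambda>i. X1 i \<omega>)) powr q) \<partial>M)"
      by (rule nn_pair[symmetric]) measurable
    also have "\<dots> \<le> ?C" by (intro nn_integral_mono E2)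
    finally show ?thesis .
  qed
  let ?rhs = "ennreal (128 / sqrt (exp 1)) * (ennreal (16 * r powr (3 / 2)) * epowr ?A (1 / (2 * q))
     + ennreal r * (if ?int then ennreal ?B else \<infinity>) + ennreal r * epowr ?C (1 / (2 * q)))"
  have pos: "ennreal (128 / sqrt (exp 1)) \<noteq> 0" "ennreal (16 * r powr (3 / 2)) \<noteq> 0" "ennreal r \<noteq> 0"
    using r by (auto simp: ennreal_eq_0_iff not_le)
  have second: "4 * epowr ?R (1 / (2 * q)) \<le> ?rhs"
  \<comment> \<open>All weights on the right are positive, so an infinite term there makes the bound
    trivial. Otherwise the two moments have real roots \<alpha> and \<gamma>, and the squares are
    integrable, as \<open>gram_moment\<close> requires.\<close>
  proof (cases "epowr ?A (1 / (2 * q)) = \<infinity> \<or> epowr ?C (1 / (2 * q)) = \<infinity> \<or> \<not> ?int")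
    case True
    then have "?rhs = \<infinity>"
      by (intro weighted_sum_eq_top pos) auto
    then show ?thesis by (simp only: infinity_ennreal_def top_greatest)
  next
    case False
    then have fin: "epowr ?A (1 / (2 * q)) \<noteq> \<infinity>" "epowr ?C (1 / (2 * q)) \<noteq> \<infinity>" and int: ?int
      by blast+
    obtain \<alpha> where \<alpha>: "0 \<le> \<alpha>" "?A = ennreal (\<alpha> powr (2 * q))" "epowr ?A (1 / (2 * q)) = ennreal \<alpha>"
      by (rule epowr_finite[OF q0 fin(1)])
    obtain \<gamma> where \<gamma>: "0 \<le> \<gamma>" "?C = ennreal (\<gamma> powr (2 * q))" "epowr ?C (1 / (2 * q)) = ennreal \<gamma>"
      by (rule epowr_finite[OF q0 fin(2)])
    let ?b = "sqrt (spec_norm (\<Sum>i\<in>UNIV. \<Sum>j\<in>UNIV. \<integral>z. h i j (fst z) (snd z) ** h i j (fst z) (snd z) \<partial>(N \<Otimes>\<^sub>M N)))"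
    have intM: "integrable M (\<lambda>\<omega>. h i j (X1 i \<omega>) (X2 j \<omega>) ** h i j (X1 i \<omega>) (X2 j \<omega>))" for i j
      using int by (cases "i = j") (auto simp: h_def offdiag_def)
    have intN: "integrable (N \<Otimes>\<^sub>M N) (\<lambda>(x, y). h i j x y ** h i j x y)" for i j
    proof -
      have "integrable (distr M (N \<Otimes>\<^sub>M N) (\<lambda>\<omega>. (X1 i \<omega>, X2 j \<omega>))) (\<lambda>(x, y). h i j x y ** h i j x y)"
        using intM[of i j] by (subst integrable_distr_eq) (auto simp: case_prod_beta')
      then show ?thesis by (simp only: NN)
    qed
    have B: "?B = ?b"
    proof -
      have "(\<integral>z. h i j (fst z) (snd z) ** h i j (fst z) (snd z) \<partial>(N \<Otimes>\<^sub>M N))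
        = (\<integral>\<omega>. h i j (X1 i \<omega>) (X2 j \<omega>) ** h i j (X1 i \<omega>) (X2 j \<omega>) \<partial>M)" for i j
        by (subst (1) NN[of i j, symmetric], subst integral_distr) auto
      moreover have "(if i = j then 0 else integral\<^sup>L M (\<lambda>\<omega>. H i j (X1 i \<omega>) (X2 j \<omega>) ** H i j (X1 i \<omega>) (X2 j \<omega>)))
        = (\<integral>\<omega>. h i j (X1 i \<omega>) (X2 j \<omega>) ** h i j (X1 i \<omega>) (X2 j \<omega>) \<partial>M)" for i j
        by (simp add: h_def)
      ultimately show ?thesis by (simp only: sum_offdiag)
    qed
    let ?D = "sqrt 2 * (sqrt 2 * ?b + 2 * sqrt (24 / 5 * r) * \<alpha>) + sqrt 2 * \<gamma> + 2 * sqrt (24 / 5 * r) * \<alpha>"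
    have D0: "0 \<le> ?D" using \<alpha>(1) \<gamma>(1) r by simp
    have "?R \<le> ennreal ((48 / 5 * r) powr (2 * q)) * (\<integral>\<^sup>+x. \<integral>\<^sup>+y. ennreal (spec_norm (gram (\<lambda>i j. h i j (x i) (y j))) powr q) \<partial>?P \<partial>?P)"
      by (rule K.chaos_bound[OF r(1) d q1 r(2)])
    also have "\<dots> \<le> ennreal ((48 / 5 * r) powr (2 * q)) * ennreal (?D powr (2 * q))"
      using \<alpha> \<gamma> A C by (intro mult_left_mono K.gram_moment[OF intN r(1) d q1 r(2)]) auto
    also have "\<dots> = ennreal ((48 / 5 * r * ?D) powr (2 * q))"
      using D0 r by (subst powr_mult) (auto simp flip: ennreal_mult)
    finally have "epowr ?R (1 / (2 * q)) \<le> epowr (ennreal ((48 / 5 * r * ?D) powr (2 * q))) (1 / (2 * q))"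
      using q0 by (intro epowr_mono) auto
    also have "\<dots> = ennreal (48 / 5 * r * ?D)"
      using D0 r q0 by (intro epowr_powr_inverse) auto
    finally have "4 * epowr ?R (1 / (2 * q)) \<le> ennreal 4 * ennreal (48 / 5 * r * ?D)"
      by (simp add: mult_left_mono)
    also have "\<dots> = ennreal (4 * (48 / 5 * r * ?D))"
      using D0 r by (subst ennreal_mult) auto
    also have "\<dots> \<le> ennreal (128 / sqrt (exp 1) * (16 * r powr (3 / 2) * \<alpha> + r * ?b + r * \<gamma>))"
      using \<alpha>(1) \<gamma>(1) by (intro ennreal_leI final_constant r(1)) auto
    also have "\<dots> = ?rhs"
    proof -
      have "ennreal (128 / sqrt (exp 1) * (16 * r powr (3 / 2) * \<alpha> + r * ?b + r * \<gamma>))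
        = ennreal (128 / sqrt (exp 1)) * (ennreal (16 * r powr (3 / 2)) * ennreal \<alpha> + ennreal r * ennreal ?b + ennreal r * ennreal \<gamma>)"
        using \<alpha>(1) \<gamma>(1) r by (intro ennreal_weighted_sum) auto
      moreover have "(if ?int then ennreal ?B else \<infinity>) = ennreal ?b" unfolding if_P[OF int] B ..
      ultimately show ?thesis by (simp only: \<alpha>(3) \<gamma>(3))
    qed
    finally show ?thesis .
  qed
  show ?thesis using first second unfolding mom2 by blast
qed

end
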